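(* Let $G$ be a topological group, $(\mathcal L,\eta)$ a host algebra for $G$, $\alpha:G\to\mathrm{Aut}(\mathcal A)$ a group homomorphism into the automorphism group of a $C^*$-algebra $\mathcal A$, and let $(\mathcal C,\eta_{\mathcal A},\eta_{\mathcal L})$ be a triple satisfying (CP1), (CP3') and (CP4). Then the triple $(\mathcal C_{\mathcal L}^\vee,\eta_{\mathcal A}^\vee,\eta_{\mathcal L}^\vee)$, for the restricted action $\alpha:G\to\mathrm{Aut}(\mathcal A_{\mathcal L})$, satisfies (CP1)–(CP4); hence $(\mathcal C_{\mathcal L}^\vee,\eta_{\mathcal A}^\vee,\eta_{\mathcal L}^\vee)$ is a (not necessarily full) crossed product host for $(\alpha|_{\mathcal A_{\mathcal L}},\mathcal L)$.
   Context: Conventions. For a $C^*$-algebra $\mathcal B$, $M(\mathcal B)$ denotes its multiplier algebra. A morphism of $C^*$-algebras $\phi:\mathcal S\to M(\mathcal B)$ is non-degenerate if $\mathrm{span}(\phi(\mathcal S)\mathcal B)$ is dense in $\mathcal B$; it then extends uniquely to a strictly continuous unital homomorphism $\tilde\phi:M(\mathcal S)\to M(\mathcal B)$. $\mathrm{Rep}(\mathcal B,\mathcal H)$ is the set of non-degenerate representations of $\mathcal B$ on the complex Hilbert space $\mathcal H$; each $\pi\in\mathrm{Rep}(\mathcal B,\mathcal H)$ extends uniquely to a representation $\tilde\pi$ of $M(\mathcal B)$ on $\mathcal H$. $\mathrm{Rep}(G,\mathcal H)$ is the set of strong-operator continuous unitary representations of $G$ on $\mathcal H$. For sets $X,Y$,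 $XY=\{xy:x\in X,y\in Y\}$; $C^*(S)$ is the generated $C^*$-algebra. Host algebra. A host algebra for $G$ is a pair $(\mathcal L,\eta)$, with $\mathcal L$ a $C^*$-algebra and $\eta:G\to \mathrm U(M(\mathcal L))$ a group homomorphism, such that (H1) for each non-degenerate representation $\pi$ of $\mathcal L$, $\tilde\pi\circ\eta$ is a continuous unitary representation of $G$; (H2) for each $\mathcal H$ the map $\eta^*:\mathrm{Rep}(\mathcal L,\mathcal H)\to\mathrm{Rep}(G,\mathcal H)$, $\pi\mapsto\tilde\pi\circ\eta$, is injective. Conditions on a triple $(\mathcal C,\eta_{\mathcal A},\eta_{\mathcal L})$ ($\mathcal C$ a $C^*$-algebra) relative to an action $\alpha$ on $\mathcal A$ and the host $\mathcal L$: (CP1) $\eta_{\mathcal A}:\mathcal A\to M(\mathcal C)$ and $\eta_{\mathcal L}:\mathcal L\to M(\mathcal C)$ are morphisms of $C^*$-algebras; (CP2) $\eta_{\mathcal L}$ is non-degenerate; (CP3) $\tilde\eta_{\mathcal L}(\eta(g))\eta_{\mathcal A}(A)\tilde\eta_{\mathcal L}(\eta(g))^*=\eta_{\mathcal A}(\alpha_g(A))$ for all $A\in\mathcal A$, $g\in G$; (CP4) $\eta_{\mathcal A}(\mathcal A)\eta_{\mathcal L}(\mathcal L)\subseteq\mathcal C$ and $\mathcal C$ is generated as a $C^*$-algebra by this set. The triple is a crossed product host for $(\alpha,\mathcal L)$ if (CP1)–(CP4) hold. Condition (CP3'). Assume (CP1), (CP4). A representation $\rho\in\mathrm{Rep}(\mathcal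 C,\mathcal H)$ is an $\mathcal L$-representation of $\mathcal C$ if $\tilde\rho\circ\eta_{\mathcal L}:\mathcal L\to B(\mathcal H)$ is non-degenerate; then $U^\rho:=\eta^*(\tilde\rho\circ\eta_{\mathcal L})$ is a continuous unitary representation of $G$. The universal $\mathcal L$-representation $\rho_u$ of $\mathcal C$ is the direct sum of the GNS representations of all states of $\mathcal C$ whose GNS representation is an $\mathcal L$-representation. (CP3'): $\rho_u$ is faithful and $U^{\rho_u}(g)(\tilde\rho_u\circ\eta_{\mathcal A})(A)U^{\rho_u}(g)^*=(\tilde\rho_u\circ\eta_{\mathcal A})(\alpha_g(A))$ for all $g\in G$, $A\in\mathcal A$. Restricted objects. Put $\mathcal C_{\mathcal L}:=\eta_{\mathcal L}(\mathcal L)\,\mathcal C\,\eta_{\mathcal L}(\mathcal L)$ (a hereditary $C^*$-subalgebra of $\mathcal C$), and $$\mathcal A_{\mathcal L}:=\{A\in\mathcal A:\ \eta_{\mathcal A}(A)\mathcal C_{\mathcal L}\subseteq\mathcal C_{\mathcal L}\text{ and }\eta_{\mathcal A}(A^* )\mathcal C_{\mathcal L}\subseteq\mathcal C_{\mathcal L}\},$$ which is an $\alpha_G$-invariant $C^*$-subalgebra of $\mathcal A$. Put $\mathcal C_{\mathcal L}^\vee:=C^*\big(\eta_{\mathcal L}(\mathcal L)\eta_{\mathcal A}(\mathcal A_{\mathcal L})\big)$, which is contained in $\mathcal C_{\mathcal L}\subseteq\mathcal C$. Multiplication by $\eta_{\mathcal L}(L)$, $L\in\mathcal L$, and $\eta_{\mathcal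 A}(A)$, $A\in\mathcal A_{\mathcal L}$, preserves $\mathcal C_{\mathcal L}^\vee$, and one defines $\eta_{\mathcal L}^\vee:\mathcal L\to M(\mathcal C_{\mathcal L}^\vee)$, $\eta_{\mathcal L}^\vee(L)C:=\eta_{\mathcal L}(L)C$, and $\eta_{\mathcal A}^\vee:\mathcal A_{\mathcal L}\to M(\mathcal C_{\mathcal L}^\vee)$, $\eta_{\mathcal A}^\vee(A)C:=\eta_{\mathcal A}(A)C$, for $C\in\mathcal C_{\mathcal L}^\vee$. *)

theory Defs
  imports "HOL-Analysis.Analysis" "HOL-Library.Function_Algebras"
begin

section \<open>Complex vector spaces and C*-algebras\<close>

class complex_vector = ab_group_add +
  fixes scaleC :: "complex \<Rightarrow> 'a \<Rightarrow> 'a"  (infixr "*\<^sub>C" 75)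
  assumes scaleC_add_right: "c *\<^sub>C (x + y) = c *\<^sub>C x + c *\<^sub>C y"
    and scaleC_add_left: "(c + d) *\<^sub>C x = c *\<^sub>C x + d *\<^sub>C x"
    and scaleC_scaleC: "c *\<^sub>C (d *\<^sub>C x) = (c * d) *\<^sub>C x"
    and scaleC_one: "1 *\<^sub>C x = x"

lemma vector_space_scaleC:
  "vector_space (scaleC :: complex \<Rightarrow> 'a \<Rightarrow> 'a::complex_vector)"
  by unfold_locales (simp_all add: scaleC_add_right scaleC_add_left scaleC_scaleC scaleC_one)

definition csubspace :: "'a::complex_vector set \<Rightarrow> bool" where
  "csubspace = module.subspace scaleC"

definition cspan :: "'a::complex_vector set \<Rightarrow> 'a set" where
  "cspan = module.span scaleC"

definition clinear_on :: "'a::complex_vector set \<Rightarrow> ('a \<Rightarrow> 'b::complex_vector) \<Rightarrow> bool" where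
  "clinear_on V f \<longleftrightarrow> (\<forall>x\<in>V. \<forall>y\<in>V. f (x + y) = f x + f y) \<and>
                     (\<forall>c. \<forall>x\<in>V. f (c *\<^sub>C x) = c *\<^sub>C f x)"

instantiation "fun" :: (type, complex_vector) complex_vector
begin
definition scaleC_fun_def: "c *\<^sub>C f = (\<lambda>x. c *\<^sub>C f x)"
instance
  by standard (simp_all add: scaleC_fun_def plus_fun_def scaleC_add_right
      scaleC_add_left scaleC_scaleC scaleC_one)
end

text \<open>Not necessarily unital.\<close>

class cstar_algebra = real_normed_algebra + banach + complex_vector +
  fixes star :: "'a \<Rightarrow> 'a"
  assumes scaleR_scaleC: "r *\<^sub>R x = complex_of_real r *\<^sub>C x"
    and mult_scaleC_left: "(c *\<^sub>C x) * y = c *\<^sub>C (x * y)"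
    and mult_scaleC_right: "x * (c *\<^sub>C y) = c *\<^sub>C (x * y)"
    and norm_scaleC: "norm (c *\<^sub>C x) = cmod c * norm x"
    and star_add: "star (x + y) = star x + star y"
    and star_scaleC: "star (c *\<^sub>C x) = cnj c *\<^sub>C star x"
    and star_mult: "star (x * y) = star y * star x"
    and star_star: "star (star x) = x"
    and norm_star_mult: "norm (star x * x) = (norm x)\<^sup>2"

instantiation complex :: cstar_algebra
begin
definition scaleC_complex_def: "c *\<^sub>C (z::complex) = c * z"
definition star_complex_def: "star (z::complex) = cnj z"
instance
  by standard (simp_all add: scaleC_complex_def star_complex_def algebra_simps
      norm_mult power2_eq_square scaleR_conv_of_real)
end

text \<open>
  A C*-algebra is given by a carrier set that is a closed *-subalgebra of an ambient C*-algebra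
  type; the carrier may be \<open>UNIV\<close>, so this covers every C*-algebra, and subalgebras are again of
  this form.
\<close>

definition cstar_subalgebra :: "'a::cstar_algebra set \<Rightarrow> bool" where
  "cstar_subalgebra B \<longleftrightarrow> closed B \<and> csubspace B \<and>
     (\<forall>x\<in>B. \<forall>y\<in>B. x * y \<in> B) \<and> (\<forall>x\<in>B. star x \<in> B)"

definition cstar_generated :: "'a::cstar_algebra set \<Rightarrow> 'a set" where
  "cstar_generated S = cstar_subalgebra hull S"


section \<open>*-algebras as structures and their homomorphisms\<close>

text \<open>
  C*-algebras, their multiplier algebras and the algebras \<open>B(H)\<close> are all presented as
  values of the following record, so that one notion of *-homomorphism serves for all of them.
\<close>

record 'x star_alg =
  sa_carrier :: "'x set"
  sa_add :: "'x \<Rightarrow> 'x \<Rightarrow> 'x"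
  sa_scale :: "complex \<Rightarrow> 'x \<Rightarrow> 'x"
  sa_mult :: "'x \<Rightarrow> 'x \<Rightarrow> 'x"
  sa_star :: "'x \<Rightarrow> 'x"

definition star_hom :: "'x star_alg \<Rightarrow> 'y star_alg \<Rightarrow> ('x \<Rightarrow> 'y) \<Rightarrow> bool" where
  "star_hom X Y f \<longleftrightarrow>
     (\<forall>x\<in>sa_carrier X. f x \<in> sa_carrier Y) \<and>
     (\<forall>x\<in>sa_carrier X. \<forall>y\<in>sa_carrier X. f (sa_add X x y) = sa_add Y (f x) (f y)) \<and>
     (\<forall>c. \<forall>x\<in>sa_carrier X. f (sa_scale X c x) = sa_scale Y c (f x)) \<and>
     (\<forall>x\<in>sa_carrier X. \<forall>y\<in>sa_carrier X. f (sa_mult X x y) = sa_mult Y (f x) (f y)) \<and>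
     (\<forall>x\<in>sa_carrier X. f (sa_star X x) = sa_star Y (f x))"

definition Alg :: "'a::cstar_algebra set \<Rightarrow> 'a star_alg" where
  "Alg B = \<lparr>sa_carrier = B, sa_add = (+), sa_scale = scaleC, sa_mult = (*), sa_star = star\<rparr>"


section \<open>Multiplier algebras\<close>

text \<open>
  \<open>M(B)\<close> is the algebra of double centralizers: a multiplier \<open>m\<close> is the pair of
  \<open>b \<mapsto> m b\<close> and \<open>b \<mapsto> b m\<close>. Both maps are set to \<open>0\<close> off the carrier \<open>B\<close>, so that equality of
  multipliers is equality of pairs.
\<close>

type_synonym 'b multiplier = "('b \<Rightarrow> 'b) \<times> ('b \<Rightarrow> 'b)"

definition bounded_clinear_on :: "'b::cstar_algebra set \<Rightarrow> ('b \<Rightarrow> 'b) \<Rightarrow> bool" where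
  "bounded_clinear_on B T \<longleftrightarrow> (\<forall>b\<in>B. T b \<in> B) \<and> clinear_on B T \<and>
     (\<exists>K. \<forall>b\<in>B. norm (T b) \<le> K * norm b)"

definition multipliers :: "'b::cstar_algebra set \<Rightarrow> 'b multiplier set" where
  "multipliers B = {(T, S). bounded_clinear_on B T \<and> bounded_clinear_on B S \<and>
     (\<forall>a\<in>B. \<forall>b\<in>B. T (a * b) = T a * b \<and> S (a * b) = a * S b \<and> S a * b = a * T b) \<and>
     (\<forall>b. b \<notin> B \<longrightarrow> T b = 0 \<and> S b = 0)}"

definition Mult :: "'b::cstar_algebra set \<Rightarrow> 'b multiplier star_alg" where
  "Mult B = \<lparr>sa_carrier = multipliers B,
     sa_add = (\<lambda>m n. (\<lambda>b. fst m b + fst n b, \<lambda>b. snd m b + snd n b)),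
     sa_scale = (\<lambda>c m. (\<lambda>b. c *\<^sub>C fst m b, \<lambda>b. c *\<^sub>C snd m b)),
     sa_mult = (\<lambda>m n. (\<lambda>b. fst m (fst n b), \<lambda>b. snd n (snd m b))),
     sa_star = (\<lambda>m. (\<lambda>b. star (snd m (star b)), \<lambda>b. star (fst m (star b))))\<rparr>"

definition mult_one :: "'b::cstar_algebra set \<Rightarrow> 'b multiplier" where
  "mult_one B = (\<lambda>b. if b \<in> B then b else 0, \<lambda>b. if b \<in> B then b else 0)"

text \<open>The canonical embedding of \<open>B\<close> into \<open>M(B)\<close>.\<close>

definition mult_emb :: "'b::cstar_algebra set \<Rightarrow> 'b \<Rightarrow> 'b multiplier" where
  "mult_emb B c = (\<lambda>b. if b \<in> B then c * b else 0, \<lambda>b. if b \<in> B then b * c else 0)"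

definition mult_unitary :: "'b::cstar_algebra set \<Rightarrow> 'b multiplier \<Rightarrow> bool" where
  "mult_unitary B u \<longleftrightarrow> u \<in> multipliers B \<and>
     sa_mult (Mult B) (sa_star (Mult B) u) u = mult_one B \<and>
     sa_mult (Mult B) u (sa_star (Mult B) u) = mult_one B"

definition nondegenerate :: "'s set \<Rightarrow> 'b::cstar_algebra set \<Rightarrow> ('s \<Rightarrow> 'b multiplier) \<Rightarrow> bool" where
  "nondegenerate S B \<phi> \<longleftrightarrow> B \<subseteq> closure (cspan {fst (\<phi> s) b | s b. s \<in> S \<and> b \<in> B})"

text \<open>
  The extension of a non-degenerate morphism \<open>\<phi>\<close> from \<open>B\<close> to \<open>M(B)\<close>, where the target \<open>Y\<close> is a
  multiplier algebra or \<open>B(H)\<close>. Non-degeneracy determines the values on \<open>M(B)\<close> uniquely, so the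
  choice operator is only a way of naming the extension, and strict continuity, which the
  extension has, need not be required in order to single it out.
\<close>

definition extension ::
    "'b::cstar_algebra set \<Rightarrow> 'y star_alg \<Rightarrow> ('b \<Rightarrow> 'y) \<Rightarrow> 'b multiplier \<Rightarrow> 'y" where
  "extension B Y \<phi> = (SOME \<Phi>. star_hom (Mult B) Y \<Phi> \<and>
     (\<forall>y\<in>sa_carrier Y. sa_mult Y (\<Phi> (mult_one B)) y = y \<and> sa_mult Y y (\<Phi> (mult_one B)) = y) \<and>
     (\<forall>b\<in>B. \<Phi> (mult_emb B b) = \<phi> b))"


section \<open>Hilbert spaces and representations\<close>

text \<open>
  A Hilbert space is a linear subspace of a complex vector space together with its own
  inner product, which is linear in the second argument.
\<close>

record 'v hilb =
  hcarrier :: "'v set"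
  hinner :: "'v \<Rightarrow> 'v \<Rightarrow> complex"

definition hnorm :: "'v hilb \<Rightarrow> 'v \<Rightarrow> real" where
  "hnorm H x = sqrt (Re (hinner H x x))"

definition hilbert_space :: "'v::complex_vector hilb \<Rightarrow> bool" where
  "hilbert_space H \<longleftrightarrow> csubspace (hcarrier H) \<and>
     (\<forall>x\<in>hcarrier H. clinear_on (hcarrier H) (hinner H x)) \<and>
     (\<forall>x\<in>hcarrier H. \<forall>y\<in>hcarrier H. hinner H y x = cnj (hinner H x y)) \<and>
     (\<forall>x\<in>hcarrier H. 0 \<le> Re (hinner H x x) \<and> (hinner H x x = 0 \<longrightarrow> x = 0)) \<and>
     (\<forall>X. (\<forall>n. X n \<in> hcarrier H) \<and>
          (\<forall>e>0. \<exists>N. \<forall>m\<ge>N. \<forall>n\<ge>N. hnorm H (X m - X n) < e) \<longrightarrow>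
          (\<exists>x\<in>hcarrier H. (\<lambda>n. hnorm H (X n - x)) \<longlonglongrightarrow> 0))"

definition hdense :: "'v::complex_vector hilb \<Rightarrow> 'v set \<Rightarrow> bool" where
  "hdense H D \<longleftrightarrow> (\<forall>x\<in>hcarrier H. \<forall>e>0. \<exists>y\<in>D. hnorm H (x - y) < e)"

text \<open>Operators on \<open>H\<close> are set to \<open>0\<close> off the carrier of \<open>H\<close>.\<close>

definition bounded_ops :: "'v::complex_vector hilb \<Rightarrow> ('v \<Rightarrow> 'v) set" where
  "bounded_ops H = {T. (\<forall>x\<in>hcarrier H. T x \<in> hcarrier H) \<and> clinear_on (hcarrier H) T \<and>
     (\<exists>K. \<forall>x\<in>hcarrier H. hnorm H (T x) \<le> K * hnorm H x) \<and> (\<forall>x. x \<notin> hcarrier H \<longrightarrow> T x = 0)}"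

definition hadjoint :: "'v::complex_vector hilb \<Rightarrow> ('v \<Rightarrow> 'v) \<Rightarrow> 'v \<Rightarrow> 'v" where
  "hadjoint H T = (THE S. S \<in> bounded_ops H \<and>
     (\<forall>x\<in>hcarrier H. \<forall>y\<in>hcarrier H. hinner H (S x) y = hinner H x (T y)))"

definition hid :: "'v::complex_vector hilb \<Rightarrow> 'v \<Rightarrow> 'v" where
  "hid H = (\<lambda>x. if x \<in> hcarrier H then x else 0)"

definition Bop :: "'v::complex_vector hilb \<Rightarrow> ('v \<Rightarrow> 'v) star_alg" where
  "Bop H = \<lparr>sa_carrier = bounded_ops H,
     sa_add = (\<lambda>T S x. T x + S x), sa_scale = (\<lambda>c T x. c *\<^sub>C T x),
     sa_mult = (\<lambda>T S x. T (S x)), sa_star = hadjoint H\<rparr>"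

definition nondeg_rep ::
    "'b::cstar_algebra set \<Rightarrow> 'v::complex_vector hilb \<Rightarrow> ('b \<Rightarrow> 'v \<Rightarrow> 'v) \<Rightarrow> bool" where
  "nondeg_rep B H \<pi> \<longleftrightarrow> star_hom (Alg B) (Bop H) \<pi> \<and>
     hdense H (cspan {\<pi> b x | b x. b \<in> B \<and> x \<in> hcarrier H})"

text \<open>
  Topological groups are the types of class \<open>topological_group_add\<close>; they are written additively
  but are not assumed to be commutative.
\<close>

definition unitary_rep ::
    "'v::complex_vector hilb \<Rightarrow> ('g::topological_group_add \<Rightarrow> 'v \<Rightarrow> 'v) \<Rightarrow> bool" where
  "unitary_rep H U \<longleftrightarrow>
     (\<forall>g. U g \<in> bounded_ops H \<and>
        (\<lambda>x. hadjoint H (U g) (U g x)) = hid H \<and> (\<lambda>x. U g (hadjoint H (U g) x)) = hid H) \<and>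
     (\<forall>g h. U (g + h) = (\<lambda>x. U g (U h x))) \<and>
     (\<forall>x\<in>hcarrier H. \<forall>g. ((\<lambda>h. hnorm H (U h x - U g x)) \<longlongrightarrow> 0) (at g))"

text \<open>\<open>\<eta>\<^sup>*(\<pi>)\<close>, i.e. the extension of \<open>\<pi>\<close> to \<open>M(L)\<close> composed with \<open>\<eta>\<close>.\<close>

definition eta_star ::
    "'l::cstar_algebra set \<Rightarrow> ('g \<Rightarrow> 'l multiplier) \<Rightarrow> 'v::complex_vector hilb \<Rightarrow>
     ('l \<Rightarrow> 'v \<Rightarrow> 'v) \<Rightarrow> 'g \<Rightarrow> 'v \<Rightarrow> 'v" where
  "eta_star L \<eta> H \<pi> g = extension L (Bop H) \<pi> (\<eta> g)"

text \<open>
  The Hilbert spaces quantified over are those carried by linear subspaces of \<open>'l \<Rightarrow> complex\<close>. This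
  is no restriction: every Hilbert space of dimension at most \<open>|'l|\<close> has a copy there
  (an \<open>\<ell>\<^sup>2(X)\<close> with \<open>X \<subseteq> 'l\<close>). If one of the two conditions fails on some Hilbert space, it fails at
  some vector \<open>x\<close>, and hence already on the closed subspace generated by \<open>x\<close> under the
  one or two representations of \<open>L\<close> involved, whose dimension is at most \<open>|L|\<close> (\<open>L\<close> is infinite
  unless it is \<open>0\<close>). The restrictions to that subspace are still non-degenerate.
\<close>

definition host_algebra ::
    "'l::cstar_algebra set \<Rightarrow> ('g::topological_group_add \<Rightarrow> 'l multiplier) \<Rightarrow> bool" where
  "host_algebra L \<eta> \<longleftrightarrow> cstar_subalgebra L \<and>
     (\<forall>g. mult_unitary L (\<eta> g)) \<and> (\<forall>g h. \<eta> (g + h) = sa_mult (Mult L) (\<eta> g) (\<eta> h)) \<and>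
     (\<forall>H :: ('l \<Rightarrow> complex) hilb. hilbert_space H \<longrightarrow>
        (\<forall>\<pi>. nondeg_rep L H \<pi> \<longrightarrow> unitary_rep H (eta_star L \<eta> H \<pi>)) \<and>
        (\<forall>\<pi>\<^sub>1 \<pi>\<^sub>2. nondeg_rep L H \<pi>\<^sub>1 \<and> nondeg_rep L H \<pi>\<^sub>2 \<and>
           eta_star L \<eta> H \<pi>\<^sub>1 = eta_star L \<eta> H \<pi>\<^sub>2 \<longrightarrow> (\<forall>l\<in>L. \<pi>\<^sub>1 l = \<pi>\<^sub>2 l)))"


section \<open>Crossed product hosts\<close>

text \<open>No continuity of the action is required.\<close>

definition cstar_action ::
    "'a::cstar_algebra set \<Rightarrow> ('g::topological_group_add \<Rightarrow> 'a \<Rightarrow> 'a) \<Rightarrow> bool" where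
  "cstar_action A \<alpha> \<longleftrightarrow>
     (\<forall>g. star_hom (Alg A) (Alg A) (\<alpha> g) \<and> bij_betw (\<alpha> g) A A) \<and>
     (\<forall>g h. \<forall>a\<in>A. \<alpha> (g + h) a = \<alpha> g (\<alpha> h a))"

definition CP1 where
  "CP1 A L C \<eta>A \<eta>L \<longleftrightarrow> star_hom (Alg A) (Mult C) \<eta>A \<and> star_hom (Alg L) (Mult C) \<eta>L"

definition CP2 where
  "CP2 L C \<eta>L \<longleftrightarrow> nondegenerate L C \<eta>L"

definition CP3 where
  "CP3 A L \<eta> \<alpha> C \<eta>A \<eta>L \<longleftrightarrow> (\<forall>g. \<forall>a\<in>A.
     sa_mult (Mult C)
       (sa_mult (Mult C) (extension L (Mult C) \<eta>L (\<eta> g)) (\<eta>A a))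
       (sa_star (Mult C) (extension L (Mult C) \<eta>L (\<eta> g))) = \<eta>A (\<alpha> g a))"

definition CP4 where
  "CP4 A L C \<eta>A \<eta>L \<longleftrightarrow>
     (\<forall>a\<in>A. \<forall>l\<in>L. sa_mult (Mult C) (\<eta>A a) (\<eta>L l) \<in> mult_emb C ` C) \<and>
     C = cstar_generated {c\<in>C. \<exists>a\<in>A. \<exists>l\<in>L. mult_emb C c = sa_mult (Mult C) (\<eta>A a) (\<eta>L l)}"

definition crossed_product_host ::
    "'a::cstar_algebra set \<Rightarrow> 'l::cstar_algebra set \<Rightarrow> ('g::topological_group_add \<Rightarrow> 'l multiplier) \<Rightarrow>
     ('g \<Rightarrow> 'a \<Rightarrow> 'a) \<Rightarrow> 'c::cstar_algebra set \<Rightarrow> ('a \<Rightarrow> 'c multiplier) \<Rightarrow> ('l \<Rightarrow> 'c multiplier) \<Rightarrow> bool"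
  where
  "crossed_product_host A L \<eta> \<alpha> C \<eta>A \<eta>L \<longleftrightarrow>
     cstar_subalgebra A \<and> cstar_action A \<alpha> \<and> host_algebra L \<eta> \<and> cstar_subalgebra C \<and>
     CP1 A L C \<eta>A \<eta>L \<and> CP2 L C \<eta>L \<and> CP3 A L \<eta> \<alpha> C \<eta>A \<eta>L \<and> CP4 A L C \<eta>A \<eta>L"


section \<open>The universal L-representation\<close>

definition state :: "'c::cstar_algebra set \<Rightarrow> ('c \<Rightarrow> complex) \<Rightarrow> bool" where
  "state C \<phi> \<longleftrightarrow> clinear_on C \<phi> \<and>
     (\<forall>c\<in>C. Im (\<phi> (star c * c)) = 0 \<and> 0 \<le> Re (\<phi> (star c * c))) \<and>
     (\<forall>c\<in>C. cmod (\<phi> c) \<le> norm c) \<and> (\<forall>e>0. \<exists>c\<in>C. norm c \<le> 1 \<and> 1 - e < cmod (\<phi> c)) \<and>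
     (\<forall>c. c \<notin> C \<longrightarrow> \<phi> c = 0)"

definition gns_triple ::
    "'c::cstar_algebra set \<Rightarrow> ('c \<Rightarrow> complex) \<Rightarrow> 'v::complex_vector hilb \<Rightarrow> ('c \<Rightarrow> 'v \<Rightarrow> 'v) \<Rightarrow> 'v \<Rightarrow> bool"
  where
  "gns_triple C \<phi> H \<pi> \<Omega> \<longleftrightarrow> hilbert_space H \<and> star_hom (Alg C) (Bop H) \<pi> \<and> \<Omega> \<in> hcarrier H \<and>
     hdense H {\<pi> c \<Omega> | c. c \<in> C} \<and> (\<forall>c\<in>C. \<phi> c = hinner H \<Omega> (\<pi> c \<Omega>))"

definition induced_rep ::
    "'c::cstar_algebra set \<Rightarrow> ('l \<Rightarrow> 'c multiplier) \<Rightarrow> 'v::complex_vector hilb \<Rightarrow>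
     ('c \<Rightarrow> 'v \<Rightarrow> 'v) \<Rightarrow> 'l \<Rightarrow> 'v \<Rightarrow> 'v" where
  "induced_rep C \<eta>X H \<rho> x = extension C (Bop H) \<rho> (\<eta>X x)"

definition L_representation ::
    "'l::cstar_algebra set \<Rightarrow> 'c::cstar_algebra set \<Rightarrow> ('l \<Rightarrow> 'c multiplier) \<Rightarrow>
     'v::complex_vector hilb \<Rightarrow> ('c \<Rightarrow> 'v \<Rightarrow> 'v) \<Rightarrow> bool" where
  "L_representation L C \<eta>L H \<rho> \<longleftrightarrow> nondeg_rep C H \<rho> \<and> nondeg_rep L H (induced_rep C \<eta>L H \<rho>)"

definition hilb_sum :: "'i set \<Rightarrow> ('i \<Rightarrow> 'v::complex_vector hilb) \<Rightarrow> ('i \<Rightarrow> 'v) hilb" where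
  "hilb_sum I K = \<lparr>
     hcarrier = {x. (\<forall>i\<in>I. x i \<in> hcarrier (K i)) \<and> (\<forall>i. i \<notin> I \<longrightarrow> x i = 0) \<and>
                    (\<lambda>i. (hnorm (K i) (x i))\<^sup>2) summable_on I},
     hinner = (\<lambda>x y. \<Sum>\<^sub>\<infinity>i\<in>I. hinner (K i) (x i) (y i))\<rparr>"

definition rep_sum ::
    "'i set \<Rightarrow> ('i \<Rightarrow> 'v::complex_vector hilb) \<Rightarrow> ('i \<Rightarrow> 'c \<Rightarrow> 'v \<Rightarrow> 'v) \<Rightarrow>
     'c \<Rightarrow> ('i \<Rightarrow> 'v) \<Rightarrow> 'i \<Rightarrow> 'v" where
  "rep_sum I K \<pi> c x =
     (if x \<in> hcarrier (hilb_sum I K) then (\<lambda>i. if i \<in> I then \<pi> i c (x i) else 0) else 0)"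

text \<open>
  GNS triples are unique up to unitary equivalence, and so is therefore the universal
  L-representation, which is why it is specified by a predicate. Every GNS triple \<open>(H, \<pi>, \<Omega>)\<close>
  of a state on \<open>C\<close> has a copy inside \<open>'c \<Rightarrow> complex\<close>: send \<open>\<xi> \<in> H\<close> to
  \<open>\<lambda>c. \<langle>\<pi>(c)\<Omega>, \<xi>\<rangle>\<close> (and to \<open>0\<close> off \<open>C\<close>).
\<close>

definition universal_L_rep ::
    "'l::cstar_algebra set \<Rightarrow> 'c::cstar_algebra set \<Rightarrow> ('l \<Rightarrow> 'c multiplier) \<Rightarrow>
     (('c \<Rightarrow> complex) \<Rightarrow> ('c \<Rightarrow> complex)) hilb \<Rightarrow>
     ('c \<Rightarrow> (('c \<Rightarrow> complex) \<Rightarrow> ('c \<Rightarrow> complex)) \<Rightarrow> (('c \<Rightarrow> complex) \<Rightarrow> ('c \<Rightarrow> complex))) \<Rightarrow> bool"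
  where
  "universal_L_rep L C \<eta>L H \<rho> \<longleftrightarrow>
     (\<exists>K \<pi> \<Omega>. (\<forall>\<phi>. state C \<phi> \<longrightarrow> gns_triple C \<phi> (K \<phi>) (\<pi> \<phi>) (\<Omega> \<phi>)) \<and>
        (let I = {\<phi>. state C \<phi> \<and> L_representation L C \<eta>L (K \<phi>) (\<pi> \<phi>)}
         in H = hilb_sum I K \<and> \<rho> = rep_sum I K \<pi>))"

text \<open>
  Both requirements on the universal L-representation are invariant under unitary equivalence,
  so it does not matter which realisation of it is used.
\<close>

definition CP3' where
  "CP3' A L \<eta> \<alpha> C \<eta>A \<eta>L \<longleftrightarrow> (\<exists>H \<rho>. universal_L_rep L C \<eta>L H \<rho> \<and> inj_on \<rho> C \<and>
     (\<forall>g. \<forall>a\<in>A.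
        sa_mult (Bop H)
          (sa_mult (Bop H) (eta_star L \<eta> H (induced_rep C \<eta>L H \<rho>) g) (induced_rep C \<eta>A H \<rho> a))
          (sa_star (Bop H) (eta_star L \<eta> H (induced_rep C \<eta>L H \<rho>) g))
        = induced_rep C \<eta>A H \<rho> (\<alpha> g a)))"


section \<open>The restricted objects\<close>

text \<open>\<open>\<eta>\<^sub>L(L) C \<eta>\<^sub>L(L)\<close>, the set of products, without taking a closed linear span.\<close>

definition C_restr ::
    "'l::cstar_algebra set \<Rightarrow> 'c::cstar_algebra set \<Rightarrow> ('l \<Rightarrow> 'c multiplier) \<Rightarrow> 'c set" where
  "C_restr L C \<eta>L = {fst (\<eta>L l) (snd (\<eta>L l') c) | l c l'. l \<in> L \<and> c \<in> C \<and> l' \<in> L}"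

definition A_restr ::
    "'a::cstar_algebra set \<Rightarrow> 'l::cstar_algebra set \<Rightarrow> 'c::cstar_algebra set \<Rightarrow>
     ('a \<Rightarrow> 'c multiplier) \<Rightarrow> ('l \<Rightarrow> 'c multiplier) \<Rightarrow> 'a set" where
  "A_restr A L C \<eta>A \<eta>L = {a\<in>A. \<forall>x\<in>C_restr L C \<eta>L.
     fst (\<eta>A a) x \<in> C_restr L C \<eta>L \<and> fst (\<eta>A (star a)) x \<in> C_restr L C \<eta>L}"

definition C_vee ::
    "'a::cstar_algebra set \<Rightarrow> 'l::cstar_algebra set \<Rightarrow> 'c::cstar_algebra set \<Rightarrow>
     ('a \<Rightarrow> 'c multiplier) \<Rightarrow> ('l \<Rightarrow> 'c multiplier) \<Rightarrow> 'c set" where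
  "C_vee A L C \<eta>A \<eta>L = cstar_generated
     {c\<in>C. \<exists>l\<in>L. \<exists>a\<in>A_restr A L C \<eta>A \<eta>L. mult_emb C c = sa_mult (Mult C) (\<eta>L l) (\<eta>A a)}"

definition mult_restrict :: "'c::cstar_algebra set \<Rightarrow> 'c multiplier \<Rightarrow> 'c multiplier" where
  "mult_restrict D m = (\<lambda>b. if b \<in> D then fst m b else 0, \<lambda>b. if b \<in> D then snd m b else 0)"

definition eta_vee ::
    "'c::cstar_algebra set \<Rightarrow> ('x \<Rightarrow> 'c multiplier) \<Rightarrow> 'x \<Rightarrow> 'c multiplier" where
  "eta_vee D \<eta>X x = mult_restrict D (\<eta>X x)"

end

theory Submission
  imports Defs
begin

text \<open>
  Everything rests on Cohen's factorization theorem for *-representations of a C*-algebra \<open>L\<close>: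
  the vectors approximable by means of an approximate unit of \<open>L\<close> are exactly the products
  \<open>l v\<close>. It makes \<open>\<eta>\<^sub>L(L) C \<eta>\<^sub>L(L)\<close> a closed subspace, gives the extension of non-degenerate
  representations to multipliers by \<open>m (l v) = (m l) v\<close>, and allows one to write \<open>l = l\<^sub>1 l\<^sub>2\<close>
  and \<open>a = a\<^sub>1 a\<^sub>2\<close> in \<open>l' (a\<^sub>1 a\<^sub>2 l) = (l' a\<^sub>1) (a\<^sub>2 l)\<close> and \<open>a (l\<^sub>1 l\<^sub>2 b) = (a l\<^sub>1) (l\<^sub>2 b)\<close>, so that \<open>L\<close> and \<open>A\<^sub>L\<close> multiply
  \<open>C\<^sub>L\<^sup>\<or>\<close> into itself. For \<open>a \<in> A\<^sub>L\<close> and \<open>y = a l\<close>, the product \<open>y y\<^sup>* y = a (l y\<^sup>* y)\<close> lies in \<open>C\<^sub>L\<close>, hence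
  \<open>y \<in> L C\<close>; this is the non-degeneracy (CP2). Finally the faithfulness of \<open>\<rho>\<^sub>u\<close> turns (CP3') into the
  identity \<open>\<alpha>\<^sub>g(a) l c = \<eta>(g) (a ((\<eta>(g)\<^sup>* l) c))\<close> within \<open>C\<close>, which yields both the invariance of \<open>A\<^sub>L\<close> and (CP3).
\<close>

section \<open>C*-algebras and Hilbert modules\<close>

text \<open>(CP2) is not at hand for the given triple: \<open>L\<close> may act degenerately on
  \<open>C\<close>, and then \<open>\<eta> g\<close> need not define a multiplier of
  \<open>C\<close>. It acts only on the products \<open>l c\<close>. Hence covariance is stated on
  such vectors, with the intermediate result again given as a product, and factorization into
  genuine products, rather than approximation by sums, keeps every step meaningful.

  The norm estimates are algebraic, without spectra or positivity: they come from identities such as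
  q^2 + (1 - z)^2 = 1, which survive in every *-representation. So one locale,
  \<open>star_module\<close>, treats \<open>L\<close> acting on itself, on \<open>C\<close>, on a
  one-sided ideal of \<open>C\<close>, on \<open>C_vee\<close> and on Hilbert spaces alike. The
  algebras may lack a unit, so 1 - e always occurs as the operator v - e v.

  \<open>extension\<close> is named by a choice, so each use is preceded by the construction of some
  extension. For the universal representation this is done componentwise.\<close>

interpretation cvec: vector_space "scaleC :: complex \<Rightarrow> 'a \<Rightarrow> 'a::complex_vector"
  by (rule vector_space_scaleC)

lemma csubspace_iff:
  "csubspace V \<longleftrightarrow> 0 \<in> V \<and> (\<forall>x\<in>V. \<forall>y\<in>V. x + y \<in> V) \<and> (\<forall>c. \<forall>x\<in>V. c *\<^sub>C x \<in> V)"
  unfolding csubspace_def cvec.subspace_def by auto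

lemma csubspace_diff: "csubspace V \<Longrightarrow> x \<in> V \<Longrightarrow> y \<in> V \<Longrightarrow> x - y \<in> V"
  unfolding csubspace_def by (rule cvec.subspace_diff)

lemma clinear_on_zero: "csubspace V \<Longrightarrow> clinear_on V f \<Longrightarrow> f 0 = 0"
  unfolding clinear_on_def csubspace_iff by (metis add_cancel_right_right)

lemma clinear_on_diff:
  assumes "csubspace V" "clinear_on V f" "x \<in> V" "y \<in> V"
  shows "f (x - y) = f x - f y"
proof -
  have "f ((x - y) + y) = f (x - y) + f y"
    using assms csubspace_diff unfolding clinear_on_def by blast
  then show ?thesis by simp
qed

lemma norm_star [simp]: "norm (star x) = norm (x :: 'a::cstar_algebra)"
proof -
  have le: "norm y \<le> norm (star y)" for y :: 'a
  proof (cases "norm y = 0")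
    case False
    have "norm y * norm y \<le> norm (star y) * norm y"
      using norm_star_mult[of y] norm_mult_ineq[of "star y" y] by (simp add: power2_eq_square)
    then show ?thesis using False by simp
  qed simp
  show ?thesis using le[of x] le[of "star x"] by (simp add: star_star)
qed

lemma star_zero [simp]: "star (0 :: 'a::cstar_algebra) = 0"
  using star_add[of "0::'a" 0] by simp

lemma star_minus: "star (- x) = - star (x :: 'a::cstar_algebra)"
  using star_add[of x "- x"] by (simp add: eq_neg_iff_add_eq_0 add.commute)

lemma star_diff: "star (x - y) = star x - star (y :: 'a::cstar_algebra)"
  using star_add[of x "- y"] by (simp add: star_minus)

lemma norm_mult_star: "norm (x * star x) = (norm (x :: 'a::cstar_algebra))\<^sup>2"
  using norm_star_mult[of "star x"] by (simp add: star_star)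

lemma star_mult_self_eq_0: "star x * x = 0 \<Longrightarrow> x = (0 :: 'a::cstar_algebra)"
  using norm_star_mult[of x] by simp

lemma tendsto_star: "(X \<longlongrightarrow> x) F \<Longrightarrow> ((\<lambda>n. star (X n)) \<longlongrightarrow> star (x :: 'a::cstar_algebra)) F"
  by (simp add: tendsto_dist_iff[of X] tendsto_dist_iff[of "\<lambda>n. star (X n)"] dist_norm flip: star_diff)

lemma
  assumes "cstar_subalgebra B"
  shows cstar_sub_closed: "closed B"
    and cstar_sub_csubspace: "csubspace B"
    and cstar_sub_zero: "0 \<in> B"
    and cstar_sub_add: "\<And>x y. x \<in> B \<Longrightarrow> y \<in> B \<Longrightarrow> x + y \<in> B"
    and cstar_sub_diff: "\<And>x y. x \<in> B \<Longrightarrow> y \<in> B \<Longrightarrow> x - y \<in> B"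
    and cstar_sub_scaleC: "\<And>c x. x \<in> B \<Longrightarrow> c *\<^sub>C x \<in> B"
    and cstar_sub_scaleR: "\<And>r x. x \<in> B \<Longrightarrow> r *\<^sub>R x \<in> B"
    and cstar_sub_mult: "\<And>x y. x \<in> B \<Longrightarrow> y \<in> B \<Longrightarrow> x * y \<in> B"
    and cstar_sub_star: "\<And>x. x \<in> B \<Longrightarrow> star x \<in> B"
  using assms csubspace_diff[of B] unfolding cstar_subalgebra_def csubspace_iff
  by (auto simp: scaleR_scaleC)

lemmas cstar_sub_intros =
  cstar_sub_zero cstar_sub_add cstar_sub_diff cstar_sub_scaleC cstar_sub_scaleR
  cstar_sub_mult cstar_sub_star

lemma cstar_subalgebra_generated: "cstar_subalgebra (cstar_generated S)"
  unfolding cstar_generated_def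
  by (rule hull_in) (simp add: cstar_subalgebra_def csubspace_iff closed_Inter Ball_def)

lemma cstar_generated_superset: "S \<subseteq> cstar_generated S"
  unfolding cstar_generated_def by (rule hull_subset)

lemma cstar_generated_minimal: "S \<subseteq> B \<Longrightarrow> cstar_subalgebra B \<Longrightarrow> cstar_generated S \<subseteq> B"
  unfolding cstar_generated_def by (rule hull_minimal)

text \<open>The fixed point equation \<open>z = (q\<^sup>2 + z\<^sup>2) / 2\<close> says \<open>(1 - z)\<^sup>2 = 1 - q\<^sup>2\<close>.\<close>

lemma sqrt_one_minus_square:
  fixes q :: "'a::cstar_algebra"
  assumes L: "cstar_subalgebra L" and q: "q \<in> L" "star q = q" "norm q < 1"
  obtains z where "z \<in> L" "star z = z" "z * q = q * z" "q * q + z * z = z + z"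
proof -
  \<comment> \<open>All invariants of the iteration are closed conditions, so they go into the
    complete set and the fixed point inherits them. The radius \<open>norm q\<close> makes
    \<open>f\<close> a contraction with constant \<open>norm q\<close>.\<close>
  define S where "S = {z. z \<in> L \<and> star z = z \<and> z * q = q * z \<and> norm z \<le> norm q}"
  define f where "f z = (1/2) *\<^sub>R (q * q + z * z)" for z
  have "closed S"
  proof -
    have "S = L \<inter> {z. star z = z} \<inter> {z. z * q = q * z} \<inter> {z. norm z \<le> norm q}"
      unfolding S_def by auto
    moreover have "continuous_on UNIV (star :: 'a \<Rightarrow> 'a)"
      by (auto simp: continuous_on_def intro!: tendsto_star)
    ultimately show ?thesis
      by (auto intro!: closed_Int closed_Collect_eq closed_Collect_le continuous_intros
          cstar_sub_closed[OF L])
  qed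
  then have "complete S" by (simp add: complete_eq_closed)
  moreover have "0 \<in> S" unfolding S_def by (simp add: cstar_sub_zero[OF L])
  moreover have "f ` S \<subseteq> S"
  proof safe
    fix z assume "z \<in> S"
    then have z: "z \<in> L" "star z = z" "z * q = q * z" "norm z \<le> norm q" by (auto simp: S_def)
    have "norm (q * q + z * z) \<le> norm q * norm q + norm z * norm z"
      by (intro norm_triangle_le add_mono norm_mult_ineq)
    also have "\<dots> \<le> norm q * 1 + norm q * 1"
      using z q by (intro add_mono mult_mono) auto
    finally have "norm (f z) \<le> norm q" by (simp add: f_def)
    moreover have "f z * q = q * f z"
    proof -
      have "z * z * q = q * (z * z)" by (metis z(3) mult.assoc)
      then show ?thesis by (simp add: f_def algebra_simps)
    qed
    ultimately show "f z \<in> S"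
      using z q L unfolding S_def f_def
      by (auto intro!: cstar_sub_intros simp: scaleR_scaleC star_scaleC star_add star_mult)
  qed
  moreover have "dist (f z) (f w) \<le> norm q * dist z w" if "z \<in> S" "w \<in> S" for z w
  proof -
    \<comment> \<open>z^2 - w^2 = z (z - w) + (z - w) w requires no commutation between z and
      w.\<close>
    have "f z - f w = (1/2) *\<^sub>R (z * (z - w) + (z - w) * w)"
      by (simp add: f_def algebra_simps)
    then have "norm (f z - f w) \<le> 1/2 * (norm z * norm (z - w) + norm (z - w) * norm w)"
      by simp (intro norm_triangle_le add_mono norm_mult_ineq)
    also have "\<dots> \<le> 1/2 * (norm q * norm (z - w) + norm (z - w) * norm q)"
      using that by (intro mult_left_mono add_mono mult_right_mono) (auto simp: S_def)
    finally show ?thesis by (simp add: dist_norm)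
  qed
  ultimately have "\<exists>!z\<in>S. f z = z"
    using q by (intro Banach_fix[where c = "norm q"]) auto
  then obtain z where z: "z \<in> S" "f z = z" by auto
  from z(2) have "2 *\<^sub>R f z = 2 *\<^sub>R z" by simp
  then have "q * q + z * z = z + z" by (simp add: f_def scaleR_2)
  then show ?thesis using that z(1) by (auto simp: S_def)
qed

text \<open>
  Approximate units are assembled from elements \<open>e\<close> such that \<open>1 - e\<close> is a product of factors
  \<open>1 - q\<^sup>2\<close> with \<open>q\<close> self-adjoint. This makes \<open>1 - e\<close> contractive in every *-representation, and
  it is preserved by \<open>1 - (e + f - e f) = (1 - e) (1 - f)\<close>.
\<close>

inductive_set appr :: "'l::cstar_algebra set \<Rightarrow> 'l set" for L where
  square: "q \<in> L \<Longrightarrow> star q = q \<Longrightarrow> norm q < 1 \<Longrightarrow> q * q \<in> appr L"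
| comp: "e \<in> appr L \<Longrightarrow> f \<in> appr L \<Longrightarrow> e + f - e * f \<in> appr L"

lemma appr_in: assumes L: "cstar_subalgebra L" and e: "e \<in> appr L" shows "e \<in> L"
  using e by (induction rule: appr.induct) (auto intro: cstar_sub_intros[OF L])

text \<open>The adjoint reverses the product (1 - e) (1 - f), so the two factors trade places in
  \<open>comp\<close>.\<close>

lemma appr_star: "e \<in> appr L \<Longrightarrow> star e \<in> appr L"
proof (induction rule: appr.induct)
  case (square q)
  then show ?case using appr.square[of q L] by (simp add: star_mult)
next
  case (comp e f)
  then show ?case using appr.comp[of "star f" L "star e"]
    by (simp add: star_diff star_add star_mult add.commute)
qed

text \<open>Common ground of complex Hilbert spaces and of closed subspaces of a C*-algebra with
  \<open>ip x y = star x * y\<close>. In the first case the values of \<open>ip\<close> lie in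
  \<open>complex\<close>. The length \<open>N\<close> is a parameter because the type of the vectors
  carries no norm in general.\<close>

locale hilbert_module =
  fixes V :: "'v::complex_vector set" and ip :: "'v \<Rightarrow> 'v \<Rightarrow> 'd::cstar_algebra"
    and N :: "'v \<Rightarrow> real"
  assumes V_subspace: "csubspace V"
    and ip_add_right: "x \<in> V \<Longrightarrow> y \<in> V \<Longrightarrow> z \<in> V \<Longrightarrow> ip x (y + z) = ip x y + ip x z"
    and ip_scale_right: "x \<in> V \<Longrightarrow> y \<in> V \<Longrightarrow> ip x (c *\<^sub>C y) = c *\<^sub>C ip x y"
    and ip_star: "x \<in> V \<Longrightarrow> y \<in> V \<Longrightarrow> ip y x = star (ip x y)"
    and ip_le: "x \<in> V \<Longrightarrow> y \<in> V \<Longrightarrow> norm (ip x y) \<le> N x * N y"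
    and N_nonneg: "0 \<le> N x"
    and N_square: "x \<in> V \<Longrightarrow> norm (ip x x) = (N x)\<^sup>2"
    and N_eq_0: "x \<in> V \<Longrightarrow> N x = 0 \<Longrightarrow> x = 0"
    and V_complete: "(\<And>n. X n \<in> V) \<Longrightarrow> (\<And>e. e > 0 \<Longrightarrow> \<exists>M. \<forall>m\<ge>M. \<forall>n\<ge>M. N (X m - X n) < e)
      \<Longrightarrow> \<exists>x\<in>V. (\<lambda>n. N (X n - x)) \<longlonglongrightarrow> 0"
begin

lemma V_zero: "0 \<in> V"
  and V_add: "x \<in> V \<Longrightarrow> y \<in> V \<Longrightarrow> x + y \<in> V"
  and V_scale: "x \<in> V \<Longrightarrow> c *\<^sub>C x \<in> V"
  and V_diff: "x \<in> V \<Longrightarrow> y \<in> V \<Longrightarrow> x - y \<in> V"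
  using V_subspace csubspace_diff[of V] unfolding csubspace_iff by auto

lemma ip_diff_right: "x \<in> V \<Longrightarrow> y \<in> V \<Longrightarrow> z \<in> V \<Longrightarrow> ip x (y - z) = ip x y - ip x z"
  using ip_add_right[of x "y - z" z] V_diff by simp

lemma ip_add_left: "x \<in> V \<Longrightarrow> y \<in> V \<Longrightarrow> z \<in> V \<Longrightarrow> ip (x + y) z = ip x z + ip y z"
  using ip_add_right[of z x y] ip_star[of z "x + y"] ip_star[of z x] ip_star[of z y] V_add
  by (simp add: star_add)

lemma ip_diff_left: "x \<in> V \<Longrightarrow> y \<in> V \<Longrightarrow> z \<in> V \<Longrightarrow> ip (x - y) z = ip x z - ip y z"
  using ip_add_left[of "x - y" y z] V_diff by simp

lemma ip_scale_left: "x \<in> V \<Longrightarrow> z \<in> V \<Longrightarrow> ip (c *\<^sub>C x) z = cnj c *\<^sub>C ip x z"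
  using ip_scale_right[of z x c] ip_star[of z "c *\<^sub>C x"] ip_star[of z x] V_scale
  by (simp add: star_scaleC)

lemma N_scale: assumes "x \<in> V" shows "N (c *\<^sub>C x) = cmod c * N x"
proof -
  have "(N (c *\<^sub>C x))\<^sup>2 = norm (ip (c *\<^sub>C x) (c *\<^sub>C x))" using assms by (simp add: N_square V_scale)
  also have "\<dots> = (cmod c)\<^sup>2 * (N x)\<^sup>2"
    using assms by (simp add: ip_scale_left ip_scale_right V_scale norm_scaleC N_square norm_mult power2_eq_square)
  finally have "(N (c *\<^sub>C x))\<^sup>2 = (cmod c * N x)\<^sup>2" by (simp add: power_mult_distrib)
  then show ?thesis using N_nonneg by (simp add: power2_eq_iff_nonneg)
qed

lemma N_zero [simp]: "N 0 = 0"
  using N_scale[OF V_zero, of 0] by simp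

lemma N_minus_commute: assumes "x \<in> V" "y \<in> V" shows "N (x - y) = N (y - x)"
proof -
  have "x - y = (-1) *\<^sub>C (y - x)" by simp
  then show ?thesis using N_scale[of "y - x" "-1"] assms V_diff by simp
qed

lemma N_triangle: assumes "x \<in> V" "y \<in> V" shows "N (x + y) \<le> N x + N y"
proof (rule power2_le_imp_le)
  have "(N (x + y))\<^sup>2 = norm (ip x x + ip x y + (ip y x + ip y y))"
    using assms by (simp flip: N_square add: V_add ip_add_left ip_add_right algebra_simps)
  also have "\<dots> \<le> N x * N x + N x * N y + (N y * N x + N y * N y)"
    using assms by (intro norm_triangle_le add_mono ip_le)
  finally show "(N (x + y))\<^sup>2 \<le> (N x + N y)\<^sup>2" by (simp add: power2_eq_square algebra_simps)
qed (use N_nonneg in auto)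

lemma N_diff_triangle: assumes "x \<in> V" "y \<in> V" "z \<in> V" shows "N (x - z) \<le> N (x - y) + N (y - z)"
  using N_triangle[of "x - y" "y - z"] assms V_diff by simp

lemma N_le_diff: assumes "x \<in> V" "y \<in> V" shows "N x \<le> N (x - y) + N y"
  using N_triangle[of "x - y" y] assms V_diff by simp

text \<open>The hypotheses say that \<open>a + i b\<close> and \<open>a - i b\<close> both have the norm of \<open>v\<close>.\<close>

lemma N_le_of_isometric_pair:
  assumes ab: "a \<in> V" "b \<in> V" "v \<in> V"
    and cross: "ip a b = ip b a" and sum: "ip a a + ip b b = ip v v"
  shows "N a \<le> N v" "N b \<le> N v"
proof -
  have eq: "N (a + c *\<^sub>C b) = N v" if c: "cnj c = - c" "c * cnj c = 1" for c
  proof -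
    have "ip (a + c *\<^sub>C b) (a + c *\<^sub>C b)
        = ip a a + (c + cnj c) *\<^sub>C ip a b + (c * cnj c) *\<^sub>C ip b b"
      using ab by (simp add: ip_add_left ip_add_right V_add V_scale ip_scale_left ip_scale_right cross
          cvec.scale_left_distrib cvec.scale_right_distrib mult.commute)
    also have "\<dots> = ip v v" using c sum by simp
    finally have "(N (a + c *\<^sub>C b))\<^sup>2 = (N v)\<^sup>2"
      using ab by (simp flip: N_square add: V_add V_scale)
    then show ?thesis using N_nonneg by (simp add: power2_eq_iff_nonneg)
  qed
  define p m where "p = a + \<i> *\<^sub>C b" and "m = a + (- \<i>) *\<^sub>C b"
  have pm: "N p = N v" "N m = N v" "p \<in> V" "m \<in> V"
    using eq[of \<i>] eq[of "- \<i>"] ab by (auto simp: p_def m_def intro!: V_add V_scale V_diff)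
  have half: "(1/2) *\<^sub>C x + (1/2) *\<^sub>C x = x" for x :: 'v
    by (simp flip: cvec.scale_left_distrib)
  have "a = (1/2) *\<^sub>C p + (1/2) *\<^sub>C m"
    by (simp add: p_def m_def cvec.scale_right_distrib cvec.scale_right_diff_distrib half)
  then have "N a \<le> N ((1/2) *\<^sub>C p) + N ((1/2) *\<^sub>C m)"
    using N_triangle pm V_scale by metis
  then show "N a \<le> N v" using pm by (simp add: N_scale)
  have "b = (-\<i>/2) *\<^sub>C p + (\<i>/2) *\<^sub>C m"
    by (simp add: p_def m_def cvec.scale_right_distrib cvec.scale_right_diff_distrib half)
  then have "N b \<le> N ((-\<i>/2) *\<^sub>C p) + N ((\<i>/2) *\<^sub>C m)"
    using N_triangle pm V_scale by metis
  then show "N b \<le> N v" using pm by (simp only: N_scale) (simp add: norm_divide)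
qed

end

text \<open>A *-representation of \<open>L\<close> on a Hilbert module. Adjoints are postulated,
  boundedness is not: it follows from them in \<open>N_T_le\<close>.\<close>

locale star_module = hilbert_module V ip N
  for V :: "'v::complex_vector set" and ip :: "'v \<Rightarrow> 'v \<Rightarrow> 'd::cstar_algebra"
    and N :: "'v \<Rightarrow> real" +
  fixes L :: "'l::cstar_algebra set" and T :: "'l \<Rightarrow> 'v \<Rightarrow> 'v"
  assumes L_sub: "cstar_subalgebra L"
    and T_in: "l \<in> L \<Longrightarrow> v \<in> V \<Longrightarrow> T l v \<in> V"
    and T_linear: "l \<in> L \<Longrightarrow> clinear_on V (T l)"
    and T_add_left: "l \<in> L \<Longrightarrow> k \<in> L \<Longrightarrow> v \<in> V \<Longrightarrow> T (l + k) v = T l v + T k v"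
    and T_scale_left: "l \<in> L \<Longrightarrow> v \<in> V \<Longrightarrow> T (c *\<^sub>C l) v = c *\<^sub>C T l v"
    and T_mult: "l \<in> L \<Longrightarrow> k \<in> L \<Longrightarrow> v \<in> V \<Longrightarrow> T (l * k) v = T l (T k v)"
    and T_adjoint: "l \<in> L \<Longrightarrow> v \<in> V \<Longrightarrow> w \<in> V \<Longrightarrow> ip (T l v) w = ip v (T (star l) w)"
begin

lemmas V_intros = V_zero V_add V_scale V_diff T_in

lemma T_add: "l \<in> L \<Longrightarrow> v \<in> V \<Longrightarrow> w \<in> V \<Longrightarrow> T l (v + w) = T l v + T l w"
  and T_scale: "l \<in> L \<Longrightarrow> v \<in> V \<Longrightarrow> T l (c *\<^sub>C v) = c *\<^sub>C T l v"
  using T_linear unfolding clinear_on_def by auto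

lemma T_diff: "l \<in> L \<Longrightarrow> v \<in> V \<Longrightarrow> w \<in> V \<Longrightarrow> T l (v - w) = T l v - T l w"
  using clinear_on_diff[OF V_subspace T_linear] .

lemma T_diff_left:
  assumes "l \<in> L" "k \<in> L" "v \<in> V" shows "T (l - k) v = T l v - T k v"
proof -
  have "T ((l - k) + k) v = T (l - k) v + T k v"
    using assms by (intro T_add_left cstar_sub_diff[OF L_sub])
  then show ?thesis by simp
qed

text \<open>On the module q and 1 - z act like sine and cosine: they commute, are self-adjoint and
  satisfy q^2 + (1 - z)^2 = 1, so \<open>N_le_of_isometric_pair\<close> bounds both by 1. The second
  claim applies 1 - z twice, since (1 - z)^2 = 1 - q^2.\<close>

lemma sqrt_contractive:
  assumes q: "q \<in> L" "star q = q" "norm q < 1" and v: "v \<in> V"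
  shows "N (T q v) \<le> N v" "N (v - T (q * q) v) \<le> N v"
proof -
  obtain z where z: "z \<in> L" "star z = z" "z * q = q * z" "q * q + z * z = z + z"
    using sqrt_one_minus_square[OF L_sub q] .
  note in_L = q(1) z(1) cstar_sub_mult[OF L_sub q(1) q(1)] cstar_sub_mult[OF L_sub z(1) z(1)]
  have both: "N (T q w) \<le> N w \<and> N (w - T z w) \<le> N w" if w: "w \<in> V" for w
  proof -
    define a b where "a = T q w" and "b = w - T z w"
    have ab: "a \<in> V" "b \<in> V" unfolding a_def b_def using in_L w by (auto intro!: V_intros)
    have "ip a b = ip w (T q w - T (q * z) w)"
      using in_L w q(2) by (simp add: a_def b_def T_adjoint T_diff T_mult V_intros)
    moreover have "ip b a = ip w (T q w - T (z * q) w)"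
      using in_L w z(2) by (simp add: a_def b_def T_adjoint ip_diff_left ip_diff_right T_diff T_mult V_intros)
    ultimately have cross: "ip a b = ip b a" using z(3) by simp
    have "ip a a = ip w (T (q * q) w)"
      using in_L w q(2) by (simp add: a_def T_adjoint T_mult V_intros)
    moreover have "ip b b = ip w (w - T z w - (T z w - T (z * z) w))"
      using in_L w z(2) by (simp add: b_def T_adjoint ip_diff_left ip_diff_right T_diff T_mult V_intros)
    ultimately have "ip a a + ip b b = ip w (T (q * q) w + (w - T z w - (T z w - T (z * z) w)))"
      using in_L w by (simp add: ip_add_right V_intros)
    also have "T (q * q) w + (w - T z w - (T z w - T (z * z) w))
        = w + (T (q * q + z * z) w - T (z + z) w)"
      using in_L w by (simp add: T_add_left algebra_simps)
    finally have sum: "ip a a + ip b b = ip w w" using z(4) by simp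
    show ?thesis using N_le_of_isometric_pair[OF ab w cross sum] by (simp add: a_def b_def)
  qed
  show "N (T q v) \<le> N v" using both v by simp
  define w where "w = v - T z v"
  have w: "w \<in> V" "N w \<le> N v" using both v in_L unfolding w_def by (auto intro!: V_intros)
  have "w - T z w = v - (T (z + z) v - T (z * z) v)"
    unfolding w_def using in_L v by (simp add: T_diff V_intros T_add_left T_mult)
  also have "\<dots> = v - T (q * q) v"
    using in_L v by (simp flip: z(4) add: T_add_left)
  finally show "N (v - T (q * q) v) \<le> N v" using both[OF w(1)] w(2) by simp
qed

lemma appr_contractive:
  assumes "e \<in> appr L" and "v \<in> V"
  shows "N (v - T e v) \<le> N v"
  using assms
proof (induction arbitrary: v rule: appr.induct)
  case (square q)
  then show ?case by (simp add: sqrt_contractive)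
next
  case (comp e f)
  have L: "e \<in> L" "f \<in> L" "e * f \<in> L" using comp appr_in L_sub cstar_sub_mult by blast+
  have eq: "v - T (e + f - e * f) v = (v - T f v) - T e (v - T f v)"
    using L comp.prems by (simp add: T_diff_left T_add_left T_mult T_diff T_in cstar_sub_add L_sub)
  have "v - T f v \<in> V" using comp.prems L by (intro V_diff T_in)
  then show ?case unfolding eq using comp.IH comp.prems by (blast intro: order_trans)
qed

text \<open>A self-adjoint h is scaled to norm below 1 and handled by
  \<open>sqrt_contractive\<close>; a general l is reached through \<open>star l * l\<close> by
  Cauchy-Schwarz and the C*-identity.\<close>

lemma N_T_le:
  assumes l: "l \<in> L" and v: "v \<in> V"
  shows "N (T l v) \<le> norm l * N v"
proof -
  have sa: "N (T h v) \<le> norm h * N v" if h: "h \<in> L" "star h = h" for h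
  proof (rule field_le_epsilon)
    fix e :: real assume "e > 0"
    \<comment> \<open>\<open>t\<close> exceeds \<open>norm h\<close> strictly, so that
      \<open>norm q < 1\<close>; multiplied by \<open>N v\<close> the excess is at most
      \<open>e\<close>. The summand 1 guards against \<open>N v = 0\<close>.\<close>
    define t where "t = norm h + e / (N v + 1)"
    have t: "t > norm h" "t > 0" using \<open>e > 0\<close> N_nonneg[of v]
      by (auto simp: t_def add_nonneg_pos intro!: divide_pos_pos)
    define q where "q = complex_of_real (1/t) *\<^sub>C h"
    have q: "q \<in> L" "star q = q" "norm q < 1"
      using t h L_sub by (auto simp: q_def star_scaleC norm_scaleC norm_divide intro: cstar_sub_intros)
    have "h = complex_of_real t *\<^sub>C q" using t by (simp add: q_def)
    then have "N (T h v) = t * N (T q v)"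
      using q v t by (simp add: T_scale_left N_scale T_in)
    also have "\<dots> \<le> t * N v" using sqrt_contractive(1)[OF q v] t by simp
    also have "\<dots> = norm h * N v + e * (N v / (N v + 1))" by (simp add: t_def algebra_simps)
    also have "\<dots> \<le> norm h * N v + e * 1"
      using \<open>e > 0\<close> N_nonneg[of v] by (intro add_mono mult_left_mono) auto
    finally show "N (T h v) \<le> norm h * N v + e" by simp
  qed
  have ll: "star l * l \<in> L" "star (star l * l) = star l * l"
    using l L_sub by (auto intro: cstar_sub_intros simp: star_mult star_star)
  have "(N (T l v))\<^sup>2 = norm (ip v (T (star l * l) v))"
    using l v L_sub by (simp flip: N_square add: T_in T_adjoint T_mult cstar_sub_star)
  also have "\<dots> \<le> N v * (norm (star l * l) * N v)"
    by (rule order_trans[OF ip_le[OF v T_in[OF ll(1) v]] mult_left_mono[OF sa[OF ll] N_nonneg]])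
  also have "\<dots> = (norm l * N v)\<^sup>2" by (simp add: norm_star_mult power2_eq_square)
  finally show ?thesis by (rule power2_le_imp_le) (simp add: N_nonneg)
qed

end

text \<open>Turns contractivity in modules into norm estimates in \<open>L\<close> itself, such as
  \<open>norm (l - e * l) \<le> norm l\<close> for \<open>e\<close> in
  \<open>appr L\<close>.\<close>

lemma star_module_self:
  assumes "cstar_subalgebra L"
  shows "star_module L (\<lambda>x y. star x * y) norm L (*)"
proof unfold_locales
  show "\<exists>x\<in>L. (\<lambda>n. norm (X n - x)) \<longlonglongrightarrow> 0"
    if "\<And>n. X n \<in> L" "\<And>e. e > 0 \<Longrightarrow> \<exists>M. \<forall>m\<ge>M. \<forall>n\<ge>M. norm (X m - X n) < e" for X
  proof -
    have "Cauchy X" using that(2) by (simp add: Cauchy_def dist_norm)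
    then obtain x where "X \<longlonglongrightarrow> x" using convergentD Cauchy_convergent by blast
    moreover from this have "x \<in> L"
      by (rule closed_sequentially[OF cstar_sub_closed[OF assms] that(1)])
    ultimately show ?thesis by (auto simp: tendsto_dist_iff[of X] dist_norm)
  qed
qed (use assms in \<open>simp_all add: cstar_sub_intros cstar_sub_csubspace clinear_on_def
    distrib_left distrib_right mult_scaleC_left mult_scaleC_right star_mult star_star norm_star_mult
    mult.assoc norm_star norm_mult_ineq[of "star x" for x, simplified]\<close>)

section \<open>Approximate units\<close>

text \<open>
  With \<open>w = q \<plusminus> \<surd>2 i\<close> the cube of \<open>w\<close> has norm at most \<open>3\<surd>3\<close>, and the real part of
  \<open>w\<^sup>3\<close> is \<open>q\<^sup>3 - 6 q\<close>.
\<close>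

lemma cubic_bound:
  fixes q :: "'a::cstar_algebra"
  assumes q: "star q = q" "norm q \<le> 1"
  shows "norm (q - (1/6) *\<^sub>R (q * q * q)) \<le> sqrt 3 / 2"
proof -
  \<comment> \<open>Left multiplication by q + c, taken as an operator because the scalar c has no
    counterpart in an algebra without unit.\<close>
  define f where "f c x = q * x + c *\<^sub>C x" for c x
  define s where "s = \<i> * complex_of_real (sqrt 2)"
  have f_le: "norm (f c x) \<le> sqrt 3 * norm x" if c: "cnj c = - c" "c * cnj c = 2" for c x
  proof (rule power2_le_imp_le)
    have "star (f c x) * f c x = star x * (q * (q * x)) + 2 *\<^sub>C (star x * x)"
    proof -
      have "c * c = - 2" using c by (metis minus_mult_right minus_equation_iff)
      then show ?thesis
        using c(1) q by (simp add: f_def star_add star_mult star_scaleC algebra_simps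
            mult_scaleC_left mult_scaleC_right)
    qed
    then have "(norm (f c x))\<^sup>2 \<le> norm (star x * (q * (q * x))) + norm (2 *\<^sub>C (star x * x))"
      by (simp flip: norm_star_mult add: norm_triangle_ineq)
    also have "\<dots> \<le> norm x * (1 * (1 * norm x)) + 2 * (norm x * norm x)"
    proof (rule add_mono)
      have "norm (q * (q * x)) \<le> norm q * (norm q * norm x)"
        by (rule order_trans[OF norm_mult_ineq mult_left_mono[OF norm_mult_ineq norm_ge_zero]])
      also have "\<dots> \<le> 1 * (1 * norm x)"
        using q by (intro mult_mono) auto
      finally show "norm (star x * (q * (q * x))) \<le> norm x * (1 * (1 * norm x))"
        by (intro order_trans[OF norm_mult_ineq]) (simp add: mult_left_mono)
    qed (simp add: norm_scaleC norm_star_mult power2_eq_square)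
    finally show "(norm (f c x))\<^sup>2 \<le> (sqrt 3 * norm x)\<^sup>2"
      by (simp add: power_mult_distrib power2_eq_square[of "norm x"])
  qed simp
  have s: "cnj s = - s" "s * cnj s = 2" "s * s = -2"
    by (auto simp: s_def complex_eq_iff algebra_simps)
  define y where "y = q * (q * q) - 6 *\<^sub>C q"
  have cube: "norm (f c (f c (f c x))) \<le> 3 * sqrt 3 * norm x"
    if c: "cnj c = - c" "c * cnj c = 2" for c x
  proof -
    have "norm (f c (f c (f c x))) \<le> sqrt 3 * (sqrt 3 * (sqrt 3 * norm x))"
      using f_le[OF c] by (meson mult_left_mono order_trans real_sqrt_ge_zero zero_le_numeral)
    then show ?thesis by (simp add: algebra_simps)
  qed
  have fff: "f c (f c (f c x)) = q * (q * (q * x)) + 3 *\<^sub>C (c *\<^sub>C (q * (q * x)))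
      + 3 *\<^sub>C ((c * c) *\<^sub>C (q * x)) + (c * c * c) *\<^sub>C x" for c x
  proof -
    have 3: "3 *\<^sub>C u = u + u + u" for u :: 'a
      using cvec.scale_left_distrib[of 1 2 u] cvec.scale_left_distrib[of 1 1 u] by simp
    show ?thesis
      unfolding f_def 3 by (simp add: algebra_simps mult_scaleC_right cvec.scale_right_distrib)
  qed
  have yy: "y * y = q * (q * (q * y)) - 6 *\<^sub>C (q * y)"
    by (subst (1) y_def) (simp add: left_diff_distrib mult_scaleC_left mult.assoc)
  \<comment> \<open>Adding the cubes for s and - s isolates the real part q^3 - 6 q, here multiplied
    by y, which is that same element. The result is 2 y^2, so the bound on the operators becomes a
    bound on \<open>norm y\<close>.\<close>
  have "2 *\<^sub>C (y * y) = f s (f s (f s y)) + f (- s) (f (- s) (f (- s) y))"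
    using s(3) cvec.scale_left_distrib[of 1 1 "q * (q * (q * y))"]
      cvec.scale_left_distrib[of 6 6 "q * y"]
    unfolding fff yy by (simp add: cvec.scale_right_diff_distrib)
  then have "norm (2 *\<^sub>C (y * y)) \<le> 3 * sqrt 3 * norm y + 3 * sqrt 3 * norm y"
    using cube[of s y] cube[of "- s" y] s by (metis (no_types, lifting) add_mono
        complex_cnj_minus minus_mult_minus norm_triangle_le)
  moreover have "star y = y"
    using q by (simp add: y_def star_diff star_mult star_scaleC mult.assoc)
  then have "norm (y * y) = norm y * norm y"
    using norm_star_mult[of y] by (simp add: power2_eq_square)
  ultimately have "norm y * norm y \<le> 3 * sqrt 3 * norm y" by (simp add: norm_scaleC mult_ac)
  then have y: "norm y \<le> 3 * sqrt 3" by (cases "norm y = 0") auto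
  have "q - (1/6) *\<^sub>R (q * q * q) = (-1/6) *\<^sub>C y"
    by (simp add: y_def scaleR_scaleC cvec.scale_right_diff_distrib mult.assoc)
  then show ?thesis using y by (simp add: norm_scaleC norm_divide)
qed

text \<open>Each round shrinks the residual q = h - h e by the factor sqrt 3 / 2. With m =
  \<open>norm q\<close> and p = q / (sqrt 6 m), composing e with p^2 leaves q - q^3 / (6 m^2), which
  is m times the expression of \<open>cubic_bound\<close> at q / m. Commutation with h is carried
  along to keep e self-adjoint.\<close>

lemma appr_selfadjoint:
  assumes L: "cstar_subalgebra L" and h: "h \<in> L" "star h = h"
  shows "\<exists>e\<in>appr L. star e = e \<and> h * e = e * h \<and> norm (h - h * e) \<le> (sqrt 3 / 2) ^ n * norm h"
proof (induction n)
  case 0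
  have "0 \<in> appr L" using appr.square[of 0 L] cstar_sub_zero[OF L] by simp
  then show ?case by (intro bexI[of _ 0]) auto
next
  case (Suc n)
  then obtain e where e: "e \<in> appr L" "star e = e" "h * e = e * h"
    "norm (h - h * e) \<le> (sqrt 3 / 2) ^ n * norm h" by auto
  define q where "q = h - h * e"
  have eL: "e \<in> L" using appr_in[OF L] e by auto
  have qL: "q \<in> L" using eL h L by (auto simp: q_def intro: cstar_sub_intros)
  have sq: "star q = q" using h e by (simp add: q_def star_diff star_mult)
  have comm: "h * q = q * h" "e * q = q * e"
    using e(3) by (simp_all add: q_def algebra_simps) (metis mult.assoc)+
  show ?case
  proof (cases "q = 0")
    case True
    then show ?thesis using e q_def by (intro bexI[of _ e]) auto
  next
    case False
    define m where "m = norm q"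
    have m: "m > 0" using False by (simp add: m_def)
    define p where "p = (1 / (sqrt 6 * m)) *\<^sub>R q"
    have pp: "p * p = (1 / (6 * m\<^sup>2)) *\<^sub>R (q * q)"
      using m by (simp add: p_def power2_eq_square field_simps)
    have star_r: "star (r *\<^sub>R x) = r *\<^sub>R star x" for r and x :: 'a
      by (simp add: scaleR_scaleC star_scaleC)
    have "1 < sqrt (6::real)" by simp
    then have "norm p < 1" using m by (simp add: p_def m_def[symmetric])
    then have ppa: "p * p \<in> appr L"
      using qL sq L by (intro appr.square) (auto simp: p_def star_r intro: cstar_sub_intros)
    define e' where "e' = e + p * p - e * (p * p)"
    have "e' \<in> appr L" unfolding e'_def using e(1) ppa by (rule appr.comp)
    moreover have "q * q * h = h * (q * q)" "q * q * e = e * (q * q)"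
      using comm by (metis mult.assoc)+
    then have "star e' = e'" "h * e' = e' * h"
      using e sq unfolding e'_def pp
      by (simp_all add: star_diff star_add star_mult star_r distrib_left distrib_right
          left_diff_distrib right_diff_distrib) (metis mult.assoc)
    moreover have "norm (h - h * e') \<le> (sqrt 3 / 2) ^ Suc n * norm h"
    proof -
      have "h - h * e' = q - (1 / (6 * m\<^sup>2)) *\<^sub>R (q * q * q)"
      proof -
        have "h - h * e' = q - q * (p * p)"
          by (simp add: e'_def q_def algebra_simps)
        then show ?thesis by (simp add: pp mult.assoc)
      qed
      also have "\<dots> = m *\<^sub>R ((1/m) *\<^sub>R q - (1/6) *\<^sub>R ((1/m) *\<^sub>R q * ((1/m) *\<^sub>R q) * ((1/m) *\<^sub>R q)))"
        using m by (simp add: power2_eq_square scaleR_right_diff_distrib field_simps)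
      finally have "norm (h - h * e')
          = m * norm ((1/m) *\<^sub>R q - (1/6) *\<^sub>R ((1/m) *\<^sub>R q * ((1/m) *\<^sub>R q) * ((1/m) *\<^sub>R q)))"
        using m by simp
      also have "\<dots> \<le> m * (sqrt 3 / 2)"
        using m sq by (intro mult_left_mono cubic_bound) (auto simp: star_r m_def)
      also have "\<dots> \<le> ((sqrt 3 / 2) ^ n * norm h) * (sqrt 3 / 2)"
        using e(4) by (intro mult_right_mono) (auto simp: m_def q_def)
      finally show ?thesis by (simp add: algebra_simps)
    qed
    ultimately show ?thesis by blast
  qed
qed

text \<open>With h = \<open>star l * l\<close> one has (l - l e)^* (l - l e) = (1 - e) (h - h e). As
  1 - e is contractive, the square of the error for l is at most the error for h.\<close>

lemma appr_right:
  assumes L: "cstar_subalgebra L" and l: "l \<in> L" and eps: "\<epsilon> > 0"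
  obtains e where "e \<in> appr L" "norm (l - l * e) < \<epsilon>"
proof -
  interpret star_module L "\<lambda>x y. star x * y" norm L "(*)" by (rule star_module_self[OF L])
  define h where "h = star l * l"
  have h: "h \<in> L" "star h = h"
    using l L by (auto simp: h_def star_mult star_star intro: cstar_sub_intros)
  have lt1: "sqrt 3 / 2 < (1::real)" using real_less_lsqrt[of 2 3] by simp
  have "(\<lambda>n. (sqrt 3 / 2) ^ n * norm h) \<longlonglongrightarrow> 0"
    using lt1 by (intro tendsto_mult_left_zero LIMSEQ_realpow_zero) auto
  then obtain n where n: "(sqrt 3 / 2) ^ n * norm h < \<epsilon>\<^sup>2"
    using eps order_tendstoD(2)[of _ 0 sequentially "\<epsilon>\<^sup>2"] unfolding eventually_sequentially
    by (metis order_refl zero_less_power)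
  obtain e where e: "e \<in> appr L" "star e = e" "h * e = e * h"
    "norm (h - h * e) \<le> (sqrt 3 / 2) ^ n * norm h"
    using appr_selfadjoint[OF L h, of n] by blast
  have eL: "e \<in> L" using appr_in[OF L e(1)] .
  have "star (l - l * e) * (l - l * e) = (h - h * e) - e * (h - h * e)"
    using e(2) by (simp add: star_diff star_mult h_def algebra_simps)
  then have "(norm (l - l * e))\<^sup>2 \<le> norm (h - h * e)"
    using appr_contractive[OF e(1), of "h - h * e"] h eL L
    by (simp flip: norm_star_mult add: cstar_sub_diff cstar_sub_mult)
  then have "norm (l - l * e) < \<epsilon>"
    using e(4) n eps by (intro power2_less_imp_less[of _ \<epsilon>]) auto
  then show ?thesis using that e(1) by blast
qed

lemma appr_left:
  assumes L: "cstar_subalgebra L" and l: "l \<in> L" and eps: "\<epsilon> > 0"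
  obtains e where "e \<in> appr L" "norm (l - e * l) < \<epsilon>"
proof -
  obtain e where e: "e \<in> appr L" "norm (star l - star l * e) < \<epsilon>"
    using appr_right[OF L cstar_sub_star[OF L l] eps] .
  have "norm (l - star e * l) = norm (star l - star l * e)"
    by (metis norm_star star_diff star_mult star_star)
  then show ?thesis using that[OF appr_star[OF e(1)]] e(2) by simp
qed

lemma norm_mult_appr_le:
  assumes L: "cstar_subalgebra L" and e: "e \<in> appr L" and l: "l \<in> L"
  shows "norm (l - l * e) \<le> norm l"
proof -
  interpret star_module L "\<lambda>x y. star x * y" norm L "(*)" by (rule star_module_self[OF L])
  have "norm (star l - star e * star l) \<le> norm (star l)"
    using appr_contractive[OF appr_star[OF e]] l cstar_sub_star[OF L] by blast
  then show ?thesis by (metis norm_star star_diff star_mult)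
qed

text \<open>Since right multiplication by 1 - e is contractive, \<open>star e * e\<close> has norm
  at most twice \<open>norm e\<close>; the C*-identity then cancels one factor.\<close>

lemma norm_appr_le:
  assumes L: "cstar_subalgebra L" and e: "e \<in> appr L"
  shows "norm e \<le> 2"
proof -
  have eL: "star e \<in> L" using appr_in[OF L e] cstar_sub_star[OF L] by blast
  have "norm (star e - star e * e) \<le> norm (star e)" by (rule norm_mult_appr_le[OF L e eL])
  moreover have "norm (star e * e) \<le> norm (star e - star e * e) + norm (star e)"
    using norm_triangle_ineq4[of "star e" "star e - star e * e"] by simp
  ultimately have "norm e * norm e \<le> 2 * norm e"
    by (simp add: norm_star_mult power2_eq_square)
  then show ?thesis by (cases "norm e = 0") auto
qed

text \<open>\<open>(1 + e) / 2\<close> is invertible, with inverse \<open>2 - f\<close>.\<close>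

lemma appr_inverse:
  assumes L: "cstar_subalgebra L" and e: "e \<in> appr L"
  obtains f where "f \<in> L" "f + e * f = e + e"
proof -
  interpret star_module L "\<lambda>x y. star x * y" norm L "(*)" by (rule star_module_self[OF L])
  have eL: "e \<in> L" using appr_in[OF L e] .
  \<comment> \<open>Rewrites f + e f = 2 e as f = e + (1 - e) f / 2, a contraction with constant 1/2
    because 1 - e is contractive.\<close>
  define F where "F f = e + (1/2) *\<^sub>R (f - e * f)" for f
  have "\<exists>!f\<in>L. F f = f"
  proof (rule Banach_fix[where c = "1/2"])
    show "complete L" using cstar_sub_closed[OF L] by (simp add: complete_eq_closed)
    show "L \<noteq> {}" using cstar_sub_zero[OF L] by auto
    show "F ` L \<subseteq> L" using eL L by (auto simp: F_def intro!: cstar_sub_intros)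
    show "dist (F f) (F g) \<le> 1/2 * dist f g" if "f \<in> L" "g \<in> L" for f g
    proof -
      have "F f - F g = (1/2) *\<^sub>R ((f - g) - e * (f - g))"
        by (simp add: F_def algebra_simps)
      then show ?thesis
        using appr_contractive[OF e cstar_sub_diff[OF L that]] by (simp add: dist_norm)
    qed
  qed auto
  then obtain f where f: "f \<in> L" "F f = f" by auto
  from f(2) have "2 *\<^sub>R F f = 2 *\<^sub>R f" by simp
  then have "e + e + (f - e * f) = f + f" by (simp add: F_def scaleR_2 scaleR_right_distrib)
  then have "f + e * f = e + e" by (simp add: algebra_simps)
  then show ?thesis using that f(1) by blast
qed

section \<open>The essential part of a module\<close>

context star_module
begin

text \<open>The closure of L V, described by approximants from \<open>appr L\<close> so that Cohen's
  iteration can start; by \<open>ess_eq\<close> it is in the end the set of products itself.\<close>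

definition ess :: "'v set" where
  "ess = {v \<in> V. \<forall>\<epsilon>>0. \<exists>e\<in>appr L. N (v - T e v) < \<epsilon>}"

lemma ess_in: "v \<in> ess \<Longrightarrow> v \<in> V"
  by (simp add: ess_def)

lemma T_in_ess:
  assumes l: "l \<in> L" and v: "v \<in> V" shows "T l v \<in> ess"
proof -
  have "\<exists>e\<in>appr L. N (T l v - T e (T l v)) < \<epsilon>" if "\<epsilon> > 0" for \<epsilon>
  proof -
    have pos: "\<epsilon> / (N v + 1) > 0" using that N_nonneg[of v] by (simp add: add_nonneg_pos)
    obtain e where e: "e \<in> appr L" "norm (l - e * l) < \<epsilon> / (N v + 1)"
      using appr_left[OF L_sub l pos] .
    have eL: "e \<in> L" "e * l \<in> L" "l - e * l \<in> L"
      using appr_in[OF L_sub e(1)] l L_sub by (auto intro: cstar_sub_intros)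
    have "N (T l v - T e (T l v)) = N (T (l - e * l) v)"
      using eL l v by (simp add: T_diff_left T_mult)
    also have "\<dots> \<le> norm (l - e * l) * N v" using N_T_le eL v by blast
    also have "\<dots> \<le> norm (l - e * l) * (N v + 1)" by (intro mult_left_mono) auto
    also have "\<dots> < \<epsilon>" using e(2) N_nonneg[of v] by (simp add: pos_less_divide_eq add_nonneg_pos)
    finally show ?thesis using e(1) by blast
  qed
  then show ?thesis using l v by (simp add: ess_def T_in)
qed

text \<open>The approximants e for v and g for w differ. A common one is 1 - (1 - f) (1 - e), where
  f is an approximant for u = (1 - e) g w: on v the factor 1 - e is small already, and on w, which
  is close to g w, the product gives nearly u - f u.\<close>

lemma ess_add:
  assumes v: "v \<in> ess" and w: "w \<in> ess" shows "v + w \<in> ess"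
proof -
  have vw: "v \<in> V" "w \<in> V" using v w by (auto simp: ess_def)
  have "\<exists>e\<in>appr L. N (v + w - T e (v + w)) < \<epsilon>" if "\<epsilon> > 0" for \<epsilon>
  proof -
    have e3: "\<epsilon> / 3 > 0" using that by simp
    obtain e where e: "e \<in> appr L" "N (v - T e v) < \<epsilon> / 3"
      using v e3 unfolding ess_def by blast
    obtain g where g: "g \<in> appr L" "N (w - T g w) < \<epsilon> / 3"
      using w e3 unfolding ess_def by blast
    have eg: "e \<in> L" "g \<in> L" "e * g \<in> L"
      using e g appr_in[OF L_sub] cstar_sub_mult[OF L_sub] by auto
    define u where "u = T (g - e * g) w"
    have uess: "u \<in> ess" unfolding u_def using eg vw L_sub by (intro T_in_ess cstar_sub_diff)
    then obtain f where f: "f \<in> appr L" "N (u - T f u) < \<epsilon> / 3"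
      using e3 unfolding ess_def by blast
    have fL: "f \<in> L" using f appr_in[OF L_sub] by auto
    define K where "K x = (x - T e x) - T f (x - T e x)" for x
    have K_in: "K x \<in> V" if "x \<in> V" for x using that eg fL by (auto simp: K_def intro!: V_intros)
    have K_add: "K (x + y) = K x + K y" if "x \<in> V" "y \<in> V" for x y
      using that eg fL by (simp add: K_def T_add T_diff V_intros)
    have K_le: "N (K x) \<le> N (x - T e x)" if "x \<in> V" for x
      unfolding K_def using that f(1) eg by (intro appr_contractive V_intros)
    have K_le': "N (K x) \<le> N x" if "x \<in> V" for x
      using K_le[OF that] appr_contractive[OF e(1) that] by simp
    have "K (T g w) = u - T f u"
      unfolding K_def u_def using eg vw by (simp add: T_diff_left T_mult)
    moreover have "K w = K (w - T g w) + K (T g w)"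
      using K_add[of "w - T g w" "T g w"] vw eg by (simp add: V_intros)
    ultimately have "N (K w) \<le> N (K (w - T g w)) + N (u - T f u)"
      using N_triangle[OF K_in K_in, of "w - T g w" "T g w"] vw eg by (simp add: V_diff T_in)
    then have "N (K w) < \<epsilon> / 3 + \<epsilon> / 3"
      using K_le'[of "w - T g w"] g(2) f(2) vw eg V_intros by force
    moreover have "N (K v) < \<epsilon> / 3" using K_le vw e(2) by force
    moreover have "N (K (v + w)) \<le> N (K v) + N (K w)"
      using K_add vw N_triangle K_in by simp
    ultimately have "N (K (v + w)) < \<epsilon>" by linarith
    moreover have "K (v + w) = v + w - T (f + e - f * e) (v + w)"
      unfolding K_def using eg fL vw L_sub
      by (simp add: T_diff_left T_add_left T_mult T_diff V_intros cstar_sub_intros)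
    ultimately show ?thesis using appr.comp[OF f(1) e(1)] by metis
  qed
  then show ?thesis using vw by (simp add: ess_def V_add)
qed

lemma ess_limit:
  assumes v: "v \<in> V" and X: "\<And>\<epsilon>. \<epsilon> > 0 \<Longrightarrow> \<exists>x\<in>ess. N (v - x) < \<epsilon>"
  shows "v \<in> ess"
proof -
  have "\<exists>e\<in>appr L. N (v - T e v) < \<epsilon>" if "\<epsilon> > 0" for \<epsilon>
  proof -
    have e2: "\<epsilon> / 2 > 0" using that by simp
    obtain x where x: "x \<in> ess" "N (v - x) < \<epsilon> / 2" using X[OF e2] by blast
    then obtain e where e: "e \<in> appr L" "N (x - T e x) < \<epsilon> / 2"
      using e2 unfolding ess_def by blast
    have xV: "x \<in> V" "v - x \<in> V" using x v ess_in V_diff by auto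
    have eL: "e \<in> L" using e appr_in[OF L_sub] by auto
    have split: "v - T e v = ((v - x) - T e (v - x)) + (x - T e x)"
      using xV v eL by (simp add: T_diff)
    have "N (v - T e v) \<le> N ((v - x) - T e (v - x)) + N (x - T e x)"
      unfolding split using xV v eL by (intro N_triangle V_diff T_in) auto
    then show ?thesis using appr_contractive[OF e(1) xV(2)] x(2) e by force
  qed
  then show ?thesis using v by (simp add: ess_def)
qed

lemma ess_scale: assumes "v \<in> ess" shows "c *\<^sub>C v \<in> ess"
proof (rule ess_limit)
  have v: "v \<in> V" using assms by (rule ess_in)
  then show "c *\<^sub>C v \<in> V" by (rule V_scale)
  fix \<epsilon> :: real assume "\<epsilon> > 0"
  then have "\<epsilon> / (cmod c + 1) > 0" by (simp add: add_nonneg_pos)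
  then obtain e where e: "e \<in> appr L" "N (v - T e v) < \<epsilon> / (cmod c + 1)"
    using assms unfolding ess_def by blast
  have eL: "e \<in> L" using e appr_in[OF L_sub] by auto
  have "c *\<^sub>C v - T e (c *\<^sub>C v) = c *\<^sub>C (v - T e v)"
    using eL v by (simp add: T_scale cvec.scale_right_diff_distrib)
  then have "N (c *\<^sub>C v - T e (c *\<^sub>C v)) = cmod c * N (v - T e v)"
    using eL v by (simp add: N_scale V_intros)
  also have "\<dots> \<le> (cmod c + 1) * N (v - T e v)" using N_nonneg by (intro mult_right_mono) auto
  also have "\<dots> < \<epsilon>" using e(2) by (simp add: pos_less_divide_eq add_nonneg_pos mult.commute)
  finally show "\<exists>x\<in>ess. N (c *\<^sub>C v - x) < \<epsilon>"
    using T_in_ess[OF eL V_scale[OF v]] by blast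
qed

lemma ess_diff: "v \<in> ess \<Longrightarrow> w \<in> ess \<Longrightarrow> v - w \<in> ess"
  using ess_add[of v "(-1) *\<^sub>C w"] ess_scale[of w "-1"] by simp

lemma ess_zero: "0 \<in> ess"
  using ess_limit[of 0] T_in_ess[OF cstar_sub_zero[OF L_sub] V_zero] V_zero T_scale[OF cstar_sub_zero[OF L_sub] V_zero, of 0] 
  by (metis cvec.scale_zero_left)

lemma ess_csubspace: "csubspace ess"
  unfolding csubspace_iff using ess_zero ess_add ess_scale by blast

text \<open>
  One step of Cohen's iteration: \<open>y'\<close> is \<open>((1 + e) / 2)\<^sup>-\<^sup>1 y\<close>, where \<open>e\<close> is almost a unit for
  \<open>l\<close> and for \<open>y\<close>.
\<close>

lemma cohen_step:
  assumes l: "l \<in> L" and y: "y \<in> ess" and eps: "\<epsilon> > 0"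
  obtains e y' where "e \<in> appr L" "y' \<in> ess" "norm (l - l * e) < \<epsilon>" "N (y' - y) < \<epsilon>"
    "y = (1/2) *\<^sub>C y' + (1/2) *\<^sub>C T e y'"
proof -
  obtain a where a: "a \<in> appr L" "norm (l - l * a) < \<epsilon>" using appr_right[OF L_sub l eps] .
  obtain b where b: "b \<in> appr L" "N (y - T b y) < \<epsilon>" using y eps unfolding ess_def by blast
  \<comment> \<open>The order in 1 - e = (1 - a) (1 - b) matters: multiplied by l from the left it
    meets 1 - a at once, applied to y it meets 1 - b at once, and in each case the other factor is a
    contraction.\<close>
  define e where "e = a + b - a * b"
  have e: "e \<in> appr L" unfolding e_def by (rule appr.comp[OF a(1) b(1)])
  have in_L: "a \<in> L" "b \<in> L" "e \<in> L" using a b e appr_in[OF L_sub] by auto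
  have yV: "y \<in> V" using ess_in[OF y] .
  have l_e: "l - l * e = (l - l * a) - (l - l * a) * b" by (simp add: e_def algebra_simps)
  have "norm (l - l * e) \<le> norm (l - l * a)"
    unfolding l_e using in_L l L_sub
    by (intro norm_mult_appr_le[OF L_sub b(1)] cstar_sub_diff cstar_sub_mult)
  then have le: "norm (l - l * e) < \<epsilon>" using a(2) by simp
  have y_e: "y - T e y = (y - T b y) - T a (y - T b y)"
    using in_L yV L_sub by (simp add: e_def T_diff_left T_add_left T_mult T_diff T_in cstar_sub_intros)
  have "N (y - T e y) \<le> N (y - T b y)"
    unfolding y_e using in_L yV by (intro appr_contractive[OF a(1)] V_diff T_in)
  then have ye: "N (y - T e y) < \<epsilon>" using b(2) by simp
  obtain f where f: "f \<in> L" "f + e * f = e + e" using appr_inverse[OF L_sub e] .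
  define y' where "y' = 2 *\<^sub>C y - T f y"
  have y': "y' \<in> ess" unfolding y'_def using y f yV by (intro ess_diff ess_scale T_in_ess)
  have y'V: "y' \<in> V" using ess_in[OF y'] .
  have two: "2 *\<^sub>C x = x + x" for x :: 'v using cvec.scale_left_distrib[of 1 1 x] by simp
  have half: "(1/2) *\<^sub>C x + (1/2) *\<^sub>C x = x" for x :: 'v by (simp flip: cvec.scale_left_distrib)
  have "y' + T e y' = y + y + (T (e + e) y - T (f + e * f) y)"
    using in_L f(1) yV L_sub unfolding y'_def two
    by (simp add: T_diff T_add T_add_left T_mult V_intros cstar_sub_mult)
  then have sum: "y' + T e y' = y + y" using f(2) by simp
  have "(1/2) *\<^sub>C y' + (1/2) *\<^sub>C T e y' = (1/2) *\<^sub>C (y' + T e y')"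
    by (simp add: cvec.scale_right_distrib)
  then have yeq: "y = (1/2) *\<^sub>C y' + (1/2) *\<^sub>C T e y'"
    unfolding sum by (simp add: cvec.scale_right_distrib half)
  \<comment> \<open>From (1 + e) y' = 2 y one gets (1 + e) (y' - y) = y - e y. In the form used here
    the term with 1 - e is absorbed on the left by contractivity, which leaves
    \<open>N (y' - y) \<le> N (y - T e y)\<close>.\<close>
  have "2 *\<^sub>C (y' - y) = (y - T e y) + ((y' - y) - T e (y' - y))"
    using sum in_L yV y'V unfolding two by (simp add: T_diff algebra_simps)
  then have "2 * N (y' - y) \<le> N (y - T e y) + N ((y' - y) - T e (y' - y))"
    using in_L yV y'V N_triangle[of "y - T e y" "(y' - y) - T e (y' - y)"]
      N_scale[of "y' - y" 2] by (simp add: V_intros)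
  moreover have "N ((y' - y) - T e (y' - y)) \<le> N (y' - y)"
    using e yV y'V by (intro appr_contractive V_diff)
  ultimately have "N (y' - y) < \<epsilon>" using ye by linarith
  then show ?thesis using that e y' le yeq by blast
qed

end

section \<open>Cohen factorization and multipliers\<close>

context star_module
begin

lemma geometric_limit:
  assumes X: "\<And>n. X n \<in> V" and step: "\<And>n. N (X (Suc n) - X n) \<le> K * (1/2) ^ n"
  obtains x where "x \<in> V" "(\<lambda>n. N (X n - x)) \<longlonglongrightarrow> 0"
proof -
  have K: "0 \<le> K" using step[of 0] N_nonneg[of "X (Suc 0) - X 0"] by simp
  \<comment> \<open>The factor 1 - (1/2)^k is that of the exact partial sum of the geometric series,
    which lets the induction close.\<close>
  have add: "N (X (n + k) - X n) \<le> 2 * K * (1/2) ^ n * (1 - (1/2) ^ k)" for n k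
  proof (induction k)
    case (Suc k)
    have "N (X (n + Suc k) - X n) \<le> N (X (Suc (n + k)) - X (n + k)) + N (X (n + k) - X n)"
      using N_diff_triangle[OF X X X] by simp
    also have "\<dots> \<le> K * (1/2) ^ (n + k) + 2 * K * (1/2) ^ n * (1 - (1/2) ^ k)"
      using step Suc.IH by (intro add_mono) auto
    also have "\<dots> = 2 * K * (1/2) ^ n * (1 - (1/2) ^ Suc k)"
      by (simp add: power_add field_simps)
    finally show ?case .
  qed simp
  have le: "N (X m - X n) \<le> 2 * K * (1/2) ^ n" if "n \<le> m" for m n
  proof -
    have "N (X m - X n) \<le> 2 * K * (1/2) ^ n * (1 - (1/2) ^ (m - n))"
      using add[of n "m - n"] that by simp
    also have "\<dots> \<le> 2 * K * (1/2) ^ n * 1" using K by (intro mult_left_mono) auto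
    finally show ?thesis by simp
  qed
  have "\<exists>M. \<forall>m\<ge>M. \<forall>n\<ge>M. N (X m - X n) < e" if "e > 0" for e
  proof -
    have "(\<lambda>n. 2 * K * (1/2) ^ n) \<longlonglongrightarrow> 0"
      by (intro tendsto_mult_right_zero LIMSEQ_realpow_zero) auto
    then have "eventually (\<lambda>n. 2 * K * (1/2) ^ n < e) sequentially"
      using order_tendstoD(2) that by blast
    then obtain M where M: "\<And>n. n \<ge> M \<Longrightarrow> 2 * K * (1/2) ^ n < e"
      unfolding eventually_sequentially by blast
    have "N (X m - X n) < e" if "m \<ge> M" "n \<ge> M" for m n
    proof (cases "n \<le> m")
      case True
      then show ?thesis using le[OF True] M[of n] that by simp
    next
      case False
      then show ?thesis using le[of m n] M[of m] that N_minus_commute[OF X X, of m n] by simp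
    qed
    then show ?thesis by blast
  qed
  from V_complete[OF X this] show ?thesis using that by auto
qed

text \<open>Formally 2^-n + l_n is the product of the first n factors (1 + e_k) / 2, and y_n is the
  image of v under its inverse, so v = 2^-n y_n + l_n y_n at every stage. The scalar part tends to
  0, hence in the limit v is obtained from an element of \<open>L\<close> alone.\<close>

theorem cohen_factorization:
  assumes v: "v \<in> ess"
  obtains l w where "l \<in> L" "w \<in> ess" "v = T l w"
proof -
  interpret S: star_module L "\<lambda>x y. star x * y" norm L "(*)" by (rule star_module_self[OF L_sub])
  define P where "P n s \<longleftrightarrow> fst s \<in> L \<and> snd s \<in> ess \<and>
      v = ((1/2) ^ n) *\<^sub>C snd s + T (fst s) (snd s)" for n and s :: "'l \<times> 'v"
  define Q where "Q n s t \<longleftrightarrow> norm (fst t - fst s) \<le> 2 * (1/2) ^ n \<and>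
      N (snd t - snd s) \<le> 1 * (1/2) ^ n" for n and s t :: "'l \<times> 'v"
  have "\<exists>f. \<forall>n. P n (f n) \<and> Q n (f n) (f (Suc n))"
  proof (rule dependent_nat_choice)
    have "T 0 v = 0" using T_scale_left[OF cstar_sub_zero[OF L_sub] ess_in[OF v], of 0] by simp
    then show "\<exists>s. P 0 s"
      using v by (intro exI[of _ "(0, v)"]) (simp add: P_def cstar_sub_zero[OF L_sub])
  next
    fix s :: "'l \<times> 'v" and n
    assume "P n s"
    then obtain l y where s: "s = (l, y)" and l: "l \<in> L" and y: "y \<in> ess"
      and veq: "v = ((1/2) ^ n) *\<^sub>C y + T l y"
      by (cases s) (auto simp: P_def)
    have "(1/2) ^ n > (0::real)" by simp
    then obtain e y' where e: "e \<in> appr L" and y': "y' \<in> ess"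
      and le: "norm (l - l * e) < (1/2) ^ n" and ly: "N (y' - y) < (1/2) ^ n"
      and yeq: "y = (1/2) *\<^sub>C y' + (1/2) *\<^sub>C T e y'"
      using cohen_step[OF l y] by metis
    define c :: complex where "c = (1/2) ^ n"
    \<comment> \<open>Expansion of (c + l) (1 + e) / 2 without its scalar part c / 2.\<close>
    define l' where "l' = (c/2) *\<^sub>C e + (1/2) *\<^sub>C l + (1/2) *\<^sub>C (l * e)"
    have in_L: "e \<in> L" "l * e \<in> L" "l' \<in> L" using appr_in[OF L_sub e] l L_sub
      by (auto simp: l'_def intro!: cstar_sub_intros)
    have y'V: "y' \<in> V" using ess_in[OF y'] .
    have "v = c *\<^sub>C ((1/2) *\<^sub>C y' + (1/2) *\<^sub>C T e y') + T l ((1/2) *\<^sub>C y' + (1/2) *\<^sub>C T e y')"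
      using veq yeq by (simp add: c_def)
    also have "\<dots> = (c/2) *\<^sub>C y' + T l' y'"
      unfolding l'_def using in_L l y'V L_sub
      by (simp add: T_add T_scale T_mult T_add_left T_scale_left V_intros cstar_sub_intros
          cvec.scale_right_distrib)
    finally have "P (Suc n) (l', y')"
      using in_L y' by (simp add: P_def c_def)
    moreover have "Q n s (l', y')"
    proof -
      have half: "(1/2) *\<^sub>C x + (1/2) *\<^sub>C x = x" for x :: 'l by (simp flip: cvec.scale_left_distrib)
      \<comment> \<open>The difference is governed by l - l e: this is why \<open>cohen_step\<close>
        lets e act almost as a unit on l from the right.\<close>
      have "l' - l = (c/2) *\<^sub>C e - (1/2) *\<^sub>C (l - l * e)"
        using half[of l] by (simp add: l'_def cvec.scale_right_diff_distrib algebra_simps)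
      then have "norm (l' - l) \<le> norm ((c/2) *\<^sub>C e) + norm ((1/2) *\<^sub>C (l - l * e))"
        by (simp add: norm_triangle_ineq4)
      also have "\<dots> = (1/2) ^ n / 2 * norm e + 1/2 * norm (l - l * e)"
        by (simp add: norm_scaleC norm_divide norm_power c_def)
      also have "\<dots> \<le> (1/2) ^ n / 2 * 2 + 1/2 * (1/2) ^ n"
        using norm_appr_le[OF L_sub e] le by (intro add_mono mult_left_mono) auto
      also have "\<dots> \<le> 2 * (1/2) ^ n" by simp
      finally show ?thesis using ly by (simp add: Q_def s)
    qed
    ultimately show "\<exists>t. P (Suc n) t \<and> Q n s t" by blast
  qed
  then obtain f where f: "\<And>n. P n (f n)" "\<And>n. Q n (f n) (f (Suc n))" by blast
  define l y where "l n = fst (f n)" and "y n = snd (f n)" for n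
  have ly: "l n \<in> L" "y n \<in> ess" "y n \<in> V" "v = ((1/2) ^ n) *\<^sub>C y n + T (l n) (y n)" for n
    using f(1)[of n] ess_in by (auto simp: P_def l_def y_def)
  obtain l0 where l0: "l0 \<in> L" "(\<lambda>n. norm (l n - l0)) \<longlonglongrightarrow> 0"
    using S.geometric_limit[of l 2] ly(1) f(2) by (auto simp: Q_def l_def)
  obtain y0 where y0: "y0 \<in> V" "(\<lambda>n. N (y n - y0)) \<longlonglongrightarrow> 0"
    using geometric_limit[of y 1] ly(3) f(2) by (auto simp: Q_def y_def)
  have y0_ess: "y0 \<in> ess"
  proof (rule ess_limit[OF y0(1)])
    fix \<epsilon> :: real assume "\<epsilon> > 0"
    then obtain n where "N (y n - y0) < \<epsilon>"
      using order_tendstoD(2)[OF y0(2)] unfolding eventually_sequentially by blast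
    then show "\<exists>x\<in>ess. N (y0 - x) < \<epsilon>" using ly y0(1) N_minus_commute by metis
  qed
  have vV: "v \<in> V" using ess_in[OF v] .
  \<comment> \<open>Estimates v - l0 y0 = 2^-n y_n + l0 (y_n - y0) + (l_n - l0) y_n, with
    \<open>N (y n)\<close> replaced by a majorant that is known to converge.\<close>
  define r where "r n = (1/2) ^ n * (N (y n - y0) + N y0) + norm (l0) * N (y n - y0)
      + norm (l n - l0) * (N (y n - y0) + N y0)" for n
  have "N (v - T l0 y0) \<le> r n" for n
  proof -
    have in': "((1/2) ^ n) *\<^sub>C y n \<in> V" "T l0 (y n - y0) \<in> V" "T (l n - l0) (y n) \<in> V"
      "l n - l0 \<in> L"
      using ly l0 y0 L_sub by (auto intro!: V_intros cstar_sub_intros)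
    have Ny: "N (y n) \<le> N (y n - y0) + N y0" using N_le_diff ly y0 by blast
    have "v - T l0 y0 = ((1/2) ^ n) *\<^sub>C y n + T l0 (y n - y0) + T (l n - l0) (y n)"
      using ly(1,3)[of n] l0 y0 by (subst ly(4)[of n]) (simp add: T_diff T_diff_left)
    then have "N (v - T l0 y0)
        \<le> N (((1/2) ^ n) *\<^sub>C y n) + N (T l0 (y n - y0)) + N (T (l n - l0) (y n))"
      using N_triangle[OF V_add[OF in'(1,2)] in'(3)] N_triangle[OF in'(1,2)] by simp
    also have "\<dots> \<le> (1/2) ^ n * N (y n) + norm l0 * N (y n - y0) + norm (l n - l0) * N (y n)"
      using ly(3)[of n] l0 y0 in'
      by (intro add_mono N_T_le V_diff) (auto simp: N_scale norm_power norm_divide)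
    also have "\<dots> \<le> r n" unfolding r_def using Ny by (intro add_mono mult_left_mono) auto
    finally show ?thesis .
  qed
  moreover have "r \<longlonglongrightarrow> 0 * (0 + N y0) + norm l0 * 0 + 0 * (0 + N y0)"
    unfolding r_def by (intro tendsto_intros y0(2) l0(2) LIMSEQ_realpow_zero) auto
  ultimately have "N (v - T l0 y0) \<le> 0"
    by (intro LIMSEQ_le_const) auto
  then have "v = T l0 y0"
    using N_eq_0[of "v - T l0 y0"] N_nonneg[of "v - T l0 y0"] vV l0 y0 by (auto simp: V_intros)
  then show ?thesis using that l0(1) y0_ess by blast
qed

lemma ess_eq: "ess = {T l w | l w. l \<in> L \<and> w \<in> V}"
  using cohen_factorization ess_in T_in_ess by (auto, metis)

text \<open>Some e in \<open>appr L\<close> nearly fixes u - u' and yet annihilates it. This makes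
  the action of multipliers on \<open>ess\<close> unique.\<close>

lemma ess_faithful:
  assumes u: "u \<in> ess" "u' \<in> ess" and eq: "\<And>d. d \<in> L \<Longrightarrow> T d u = T d u'"
  shows "u = u'"
proof (rule ccontr)
  assume "u \<noteq> u'"
  have d: "u - u' \<in> ess" "u - u' \<in> V" using u ess_diff ess_in by auto
  then have "N (u - u') > 0" using \<open>u \<noteq> u'\<close> N_eq_0[of "u - u'"] N_nonneg[of "u - u'"] by force
  then obtain e where e: "e \<in> appr L" "N (u - u' - T e (u - u')) < N (u - u')"
    using d unfolding ess_def by blast
  moreover have "T e (u - u') = 0"
    using eq[of e] appr_in[OF L_sub e(1)] u ess_in by (simp add: T_diff)
  ultimately show False by simp
qed

end

section \<open>Double centralizers\<close>

lemma
  assumes "m \<in> multipliers B"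
  shows multiplier_fst_in: "b \<in> B \<Longrightarrow> fst m b \<in> B"
    and multiplier_snd_in: "b \<in> B \<Longrightarrow> snd m b \<in> B"
    and multiplier_fst_linear: "clinear_on B (fst m)"
    and multiplier_snd_linear: "clinear_on B (snd m)"
    and multiplier_fst_mult: "a \<in> B \<Longrightarrow> b \<in> B \<Longrightarrow> fst m (a * b) = fst m a * b"
    and multiplier_snd_mult: "a \<in> B \<Longrightarrow> b \<in> B \<Longrightarrow> snd m (a * b) = a * snd m b"
    and multiplier_central: "a \<in> B \<Longrightarrow> b \<in> B \<Longrightarrow> snd m a * b = a * fst m b"
    and multiplier_off: "b \<notin> B \<Longrightarrow> fst m b = 0" "b \<notin> B \<Longrightarrow> snd m b = 0"
    and multiplier_fst_bounded: "\<exists>K. \<forall>b\<in>B. norm (fst m b) \<le> K * norm b"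
    and multiplier_snd_bounded: "\<exists>K. \<forall>b\<in>B. norm (snd m b) \<le> K * norm b"
  using assms unfolding multipliers_def bounded_clinear_on_def by (auto simp: case_prod_beta)

lemma multiplier_snd_bound:
  assumes m: "m \<in> multipliers B"
  obtains K where "0 \<le> K" "\<forall>b\<in>B. norm (snd m b) \<le> K * norm b"
proof -
  obtain K where K: "\<forall>b\<in>B. norm (snd m b) \<le> K * norm b" using multiplier_snd_bounded[OF m] by auto
  have "norm (snd m b) \<le> max K 0 * norm b" if "b \<in> B" for b
    using K that by (meson max.cobounded1 mult_right_mono norm_ge_zero order_trans)
  then show ?thesis using that[of "max K 0"] by simp
qed

lemma Mult_star_star [simp]: "sa_star (Mult B) (sa_star (Mult B) m) = m"
  by (simp add: Mult_def star_star)

lemma multiplier_star_in: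
  assumes B: "cstar_subalgebra B" and m: "m \<in> multipliers B"
  shows "sa_star (Mult B) m \<in> multipliers B"
proof -
  have *: "bounded_clinear_on B (\<lambda>b. star (f (star b)))"
    if f: "\<And>b. b \<in> B \<Longrightarrow> f b \<in> B" "clinear_on B f" "\<exists>K. \<forall>b\<in>B. norm (f b) \<le> K * norm b" for f
  proof -
    obtain K where K: "\<forall>b\<in>B. norm (f b) \<le> K * norm b" using f(3) by auto
    have "\<forall>b\<in>B. norm (star (f (star b))) \<le> K * norm b"
      using K cstar_sub_star[OF B] by (metis norm_star)
    then show ?thesis
      using f cstar_sub_star[OF B] unfolding bounded_clinear_on_def clinear_on_def
      by (auto simp: star_add star_scaleC star_star)
  qed
  have central: "star (fst m (star a)) * b = a * star (snd m (star b))" if "a \<in> B" "b \<in> B" for a b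
    using multiplier_central[OF m, of "star b" "star a"] that cstar_sub_star[OF B]
    by (metis star_mult star_star)
  show ?thesis
    unfolding multipliers_def Mult_def
    using *[OF multiplier_fst_in[OF m] multiplier_fst_linear[OF m] multiplier_fst_bounded[OF m]]
      *[OF multiplier_snd_in[OF m] multiplier_snd_linear[OF m] multiplier_snd_bounded[OF m]]
      central multiplier_fst_mult[OF m] multiplier_snd_mult[OF m] multiplier_off[OF m]
      cstar_sub_star[OF B]
    by (auto simp: star_mult star_star) (metis star_star star_zero)+
qed

lemma mult_emb_in:
  assumes B: "cstar_subalgebra B" and c: "c \<in> B"
  shows "mult_emb B c \<in> multipliers B"
proof -
  have "\<forall>b\<in>B. norm (b * c) \<le> norm c * norm b" "\<forall>b\<in>B. norm (c * b) \<le> norm c * norm b"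
    by (metis mult.commute norm_mult_ineq)+
  then show ?thesis
    using c cstar_sub_intros[OF B]
    unfolding multipliers_def mult_emb_def bounded_clinear_on_def clinear_on_def
    by (auto simp: distrib_left distrib_right mult_scaleC_left mult_scaleC_right mult.assoc
        intro!: exI[of _ "norm c"])
qed

text \<open>The centralizer identity determines the right action from the left one: a difference x
  of right actions satisfies x b = 0 for all b in \<open>B\<close>, in particular for b =
  \<open>star x\<close>.\<close>

lemma multiplier_eqI:
  assumes B: "cstar_subalgebra B" and mn: "m \<in> multipliers B" "n \<in> multipliers B"
    and eq: "\<And>b. b \<in> B \<Longrightarrow> fst m b = fst n b"
  shows "m = n"
proof (rule prod_eqI)
  show "fst m = fst n" using eq multiplier_off(1)[OF mn(1)] multiplier_off(1)[OF mn(2)] by fastforce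
  show "snd m = snd n"
  proof
    fix a
    show "snd m a = snd n a"
    proof (cases "a \<in> B")
      case True
      define x where "x = snd m a - snd n a"
      have x: "x \<in> B" unfolding x_def
        using True multiplier_snd_in mn cstar_sub_diff[OF B] by metis
      have "x * b = 0" if "b \<in> B" for b
        using multiplier_central[OF mn(1) True that] multiplier_central[OF mn(2) True that] eq[OF that]
        by (simp add: x_def left_diff_distrib)
      then have "x * star x = 0" using x cstar_sub_star[OF B] by blast
      then show ?thesis using norm_mult_star[of x] by (simp add: x_def)
    qed (use multiplier_off(2)[OF mn(1)] multiplier_off(2)[OF mn(2)] in simp)
  qed
qed

section \<open>Multipliers of L acting on the essential part\<close>

context star_module
begin

text \<open>The action m (l w) = (m l) w, characterised by d (m v) = (d m) v for all d in
  \<open>L\<close>. This form refers to no factorization of v, so that only uniqueness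
  (\<open>ess_faithful\<close>) and existence (\<open>mop_T\<close>) remain to be shown.\<close>

definition mop :: "'l multiplier \<Rightarrow> 'v \<Rightarrow> 'v" where
  "mop m v = (THE u. u \<in> ess \<and> (\<forall>d\<in>L. T d u = T (snd m d) v))"

lemma mop_eqI:
  assumes "u \<in> ess" "\<And>d. d \<in> L \<Longrightarrow> T d u = T (snd m d) v"
  shows "mop m v = u"
  unfolding mop_def using assms by (intro the_equality) (auto intro: ess_faithful)

lemma mop_T:
  assumes m: "m \<in> multipliers L" and l: "l \<in> L" and w: "w \<in> V"
  shows "mop m (T l w) = T (fst m l) w"
proof (rule mop_eqI)
  show "T d (T (fst m l) w) = T (snd m d) (T l w)" if "d \<in> L" for d
    using that l w multiplier_fst_in[OF m] multiplier_snd_in[OF m] multiplier_central[OF m, of d l]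
    by (simp flip: T_mult)
qed (use T_in_ess multiplier_fst_in[OF m] l w in blast)

lemma mop_in: assumes m: "m \<in> multipliers L" and v: "v \<in> ess" shows "mop m v \<in> ess"
  using cohen_factorization[OF v] mop_T[OF m] multiplier_fst_in[OF m] T_in_ess ess_in by metis

lemma T_mop:
  assumes m: "m \<in> multipliers L" and v: "v \<in> ess" and d: "d \<in> L"
  shows "T d (mop m v) = T (snd m d) v"
proof -
  obtain l w where lw: "l \<in> L" "w \<in> V" "v = T l w" using cohen_factorization[OF v] ess_in by metis
  then show ?thesis
    using d multiplier_fst_in[OF m] multiplier_snd_in[OF m] multiplier_central[OF m, of d l]
    by (simp add: mop_T[OF m] flip: T_mult)
qed

lemma mop_add:
  assumes m: "m \<in> multipliers L" and vw: "v \<in> ess" "w \<in> ess"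
  shows "mop m (v + w) = mop m v + mop m w"
  using vw mop_in[OF m vw(1)] mop_in[OF m vw(2)] ess_in multiplier_snd_in[OF m]
  by (intro mop_eqI ess_add) (auto simp: T_mop[OF m] T_add)

lemma mop_scale:
  assumes m: "m \<in> multipliers L" and v: "v \<in> ess"
  shows "mop m (c *\<^sub>C v) = c *\<^sub>C mop m v"
  using v mop_in[OF m v] ess_in multiplier_snd_in[OF m]
  by (intro mop_eqI ess_scale) (auto simp: T_mop[OF m] T_scale)

lemma mop_Mult_add:
  assumes "m \<in> multipliers L" "n \<in> multipliers L" "v \<in> ess"
  shows "mop (sa_add (Mult L) m n) v = mop m v + mop n v"
  using assms mop_in[OF assms(1,3)] mop_in[OF assms(2,3)] ess_in
    multiplier_snd_in[OF assms(1)] multiplier_snd_in[OF assms(2)]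
  by (intro mop_eqI ess_add) (simp_all add: T_mop T_add T_add_left Mult_def)

lemma mop_Mult_scale:
  assumes "m \<in> multipliers L" "v \<in> ess"
  shows "mop (sa_scale (Mult L) c m) v = c *\<^sub>C mop m v"
  using assms mop_in[OF assms] ess_in multiplier_snd_in[OF assms(1)]
  by (intro mop_eqI ess_scale) (simp_all add: T_mop T_scale T_scale_left Mult_def)

lemma mop_Mult_mult:
  assumes "m \<in> multipliers L" "n \<in> multipliers L" "v \<in> ess"
  shows "mop (sa_mult (Mult L) m n) v = mop m (mop n v)"
  using assms mop_in[OF assms(2,3)] mop_in[OF assms(1)] multiplier_snd_in[OF assms(1)]
  by (intro mop_eqI) (simp_all add: T_mop Mult_def)

lemma mop_emb:
  assumes "c \<in> L" "v \<in> ess" shows "mop (mult_emb L c) v = T c v"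
  using assms ess_in T_in_ess by (intro mop_eqI) (auto simp: mult_emb_def T_mult)

lemma mop_one: "v \<in> ess \<Longrightarrow> mop (mult_one L) v = v"
  by (intro mop_eqI) (auto simp: mult_one_def)

text \<open>For e nearly fixing m v one has e (m v) = (e m) v, and \<open>norm e \<le> 2\<close>
  accounts for the factor 2. The bound depends on m but not on the module, which is what direct sums
  call for.\<close>

lemma N_mop_le:
  assumes m: "m \<in> multipliers L" and v: "v \<in> ess"
    and K: "\<And>l. l \<in> L \<Longrightarrow> norm (snd m l) \<le> K * norm l" "0 \<le> K"
  shows "N (mop m v) \<le> 2 * K * N v"
proof (rule field_le_epsilon)
  fix \<epsilon> :: real assume "\<epsilon> > 0"
  then obtain e where e: "e \<in> appr L" "N (mop m v - T e (mop m v)) < \<epsilon>"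
    using mop_in[OF m v] unfolding ess_def by blast
  have eL: "e \<in> L" using appr_in[OF L_sub e(1)] .
  have "norm (snd m e) \<le> K * 2"
    using K norm_appr_le[OF L_sub e(1)] eL by (meson mult_left_mono order_trans)
  then have "N (T e (mop m v)) \<le> 2 * K * N v"
    using N_T_le[OF multiplier_snd_in[OF m eL] ess_in[OF v]] mult_right_mono[OF _ N_nonneg[of v]]
    by (fastforce simp: T_mop[OF m v eL] mult_ac)
  moreover have "N (mop m v) \<le> N (mop m v - T e (mop m v)) + N (T e (mop m v))"
    using N_le_diff mop_in[OF m v] ess_in T_in[OF eL] by blast
  ultimately show "N (mop m v) \<le> 2 * K * N v + \<epsilon>" using e(2) by simp
qed

lemma mop_bounded:
  assumes m: "m \<in> multipliers L" shows "\<exists>K. \<forall>v\<in>ess. N (mop m v) \<le> K * N v"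
proof -
  obtain K where "0 \<le> K" "\<forall>b\<in>L. norm (snd m b) \<le> K * norm b"
    using multiplier_snd_bound[OF m] .
  then show ?thesis using N_mop_le[OF m, of _ K] by blast
qed

text \<open>For v = l x and w = k y both sides become inner products of x with an element of
  \<open>L\<close> applied to y; the two elements agree by the centralizer identity (m l)^* k = l^*
  (m^* k).\<close>

lemma mop_adjoint:
  assumes m: "m \<in> multipliers L" and v: "v \<in> ess" and w: "w \<in> ess"
  shows "ip (mop m v) w = ip v (mop (sa_star (Mult L) m) w)"
proof -
  obtain l x where l: "l \<in> L" "x \<in> V" "v = T l x"
    using cohen_factorization[OF v] ess_in by metis
  obtain k y where k: "k \<in> L" "y \<in> V" "w = T k y"
    using cohen_factorization[OF w] ess_in by metis
  have sl: "star l \<in> L" using l cstar_sub_star[OF L_sub] by blast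
  have m': "sa_star (Mult L) m \<in> multipliers L" by (rule multiplier_star_in[OF L_sub m])
  have fl: "fst m l \<in> L" using multiplier_fst_in[OF m l(1)] .
  have "ip (mop m v) w = ip x (T (star (fst m l) * k) y)"
    using l k fl mop_T[OF m] L_sub by (simp add: T_adjoint T_in T_mult cstar_sub_star)
  also have "star (fst m l) * k = star l * fst (sa_star (Mult L) m) k"
  proof -
    have "snd (sa_star (Mult L) m) (star l) * k = star l * fst (sa_star (Mult L) m) k"
      by (rule multiplier_central[OF m' sl k(1)])
    then show ?thesis by (simp add: Mult_def star_star)
  qed
  also have "ip x (T (star l * fst (sa_star (Mult L) m) k) y)
      = ip v (T (fst (sa_star (Mult L) m) k) y)"
    using l k sl multiplier_fst_in[OF m'] by (simp add: T_adjoint T_in T_mult)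
  also have "T (fst (sa_star (Mult L) m) k) y = mop (sa_star (Mult L) m) w"
    using mop_T[OF m' k(1,2)] k(3) by simp
  finally show ?thesis .
qed

end

section \<open>Hilbert spaces\<close>

text \<open>Agrees with \<open>hnorm\<close> on the carrier. The modulus instead of the real part
  makes it non-negative for every argument, as \<open>hilbert_module\<close> requires of
  \<open>N\<close>.\<close>

abbreviation hnorm' :: "'v::complex_vector hilb \<Rightarrow> 'v \<Rightarrow> real" where
  "hnorm' H x \<equiv> sqrt (cmod (hinner H x x))"

lemma
  assumes "hilbert_space H"
  shows hilbert_csubspace: "csubspace (hcarrier H)"
    and hinner_linear: "x \<in> hcarrier H \<Longrightarrow> clinear_on (hcarrier H) (hinner H x)"
    and hinner_cnj: "x \<in> hcarrier H \<Longrightarrow> y \<in> hcarrier H \<Longrightarrow> hinner H y x = cnj (hinner H x y)"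
    and hinner_self_nonneg: "x \<in> hcarrier H \<Longrightarrow> 0 \<le> Re (hinner H x x)"
    and hinner_self_eq_0: "x \<in> hcarrier H \<Longrightarrow> hinner H x x = 0 \<Longrightarrow> x = 0"
  using assms unfolding hilbert_space_def by blast+

lemma
  assumes "hilbert_space H" "x \<in> hcarrier H" "y \<in> hcarrier H"
  shows hinner_add_right: "z \<in> hcarrier H \<Longrightarrow> hinner H x (y + z) = hinner H x y + hinner H x z"
    and hinner_scale_right: "hinner H x (c *\<^sub>C y) = c *\<^sub>C hinner H x y"
  using hinner_linear[OF assms(1,2)] assms(3) unfolding clinear_on_def by blast+

lemma hinner_self_Im:
  assumes "hilbert_space H" "x \<in> hcarrier H" shows "Im (hinner H x x) = 0"
  using hinner_cnj[OF assms(1,2,2)] by (metis Reals_cnj_iff complex_is_Real_iff)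

lemma hnorm_eq:
  assumes "hilbert_space H" "x \<in> hcarrier H" shows "hnorm H x = hnorm' H x"
  using hinner_self_Im[OF assms] hinner_self_nonneg[OF assms] by (simp add: hnorm_def cmod_def)

lemma hilbert_cauchy_schwarz:
  assumes H: "hilbert_space H" and x: "x \<in> hcarrier H" and y: "y \<in> hcarrier H"
  shows "cmod (hinner H x y) \<le> hnorm' H x * hnorm' H y"
proof (cases "hinner H y y = 0")
  case True
  then have "y = 0" using hinner_self_eq_0[OF H y] by simp
  then show ?thesis using clinear_on_zero[OF hilbert_csubspace[OF H] hinner_linear[OF H x]] by simp
next
  case False
  note sub = hilbert_csubspace[OF H]
  have V: "\<And>x c. x \<in> hcarrier H \<Longrightarrow> c *\<^sub>C x \<in> hcarrier H" using sub by (auto simp: csubspace_iff)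
  have right: "hinner H u (c *\<^sub>C v - d *\<^sub>C w) = c * hinner H u v - d * hinner H u w"
    if "u \<in> hcarrier H" "v \<in> hcarrier H" "w \<in> hcarrier H" for u v w c d
    using clinear_on_diff[OF sub hinner_linear[OF H that(1)] V V, of v w c d] that
      hinner_scale_right[OF H that(1,2)] hinner_scale_right[OF H that(1,3)]
    by (simp only: scaleC_complex_def)
  define p r a where "p = hinner H x x" and "r = hinner H y y" and "a = hinner H y x"
  have pr: "cnj p = p" "cnj r = r" "hinner H x y = cnj a"
    unfolding p_def r_def a_def
    by (rule hinner_cnj[OF H x x, symmetric] hinner_cnj[OF H y y, symmetric] hinner_cnj[OF H y x])+
  \<comment> \<open>The component of x orthogonal to y, multiplied by r to avoid a division.\<close>
  define z where "z = r *\<^sub>C x - a *\<^sub>C y"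
  have z: "z \<in> hcarrier H" unfolding z_def using x y V csubspace_diff[OF sub] by blast
  have zx: "hinner H z x = r * p - cnj a * a"
    using right[OF x x y, of r a] hinner_cnj[OF H x z] pr by (simp add: z_def p_def a_def)
  have zy: "hinner H z y = 0"
    using right[OF y x y, of r a] hinner_cnj[OF H y z] pr by (simp add: z_def r_def a_def mult.commute)
  have "hinner H z z = r * hinner H z x - a * hinner H z y"
    by (subst (2) z_def) (rule right[OF z x y])
  then have "hinner H z z = r * (r * p - cnj a * a)" by (simp add: zx zy)
  moreover have rp: "r = complex_of_real (Re r)" "p = complex_of_real (Re p)"
    using pr by (auto simp: complex_eq_iff)
  moreover have "cnj a * a = complex_of_real ((cmod a)\<^sup>2)" using complex_norm_square[of a] by (simp add: mult.commute)
  ultimately have "hinner H z z = complex_of_real (Re r * (Re r * Re p - (cmod a)\<^sup>2))"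
    by (metis of_real_diff of_real_mult)
  then have "0 \<le> Re r * (Re r * Re p - (cmod a)\<^sup>2)"
    using hinner_self_nonneg[OF H z] by simp
  moreover have r_pos: "Re r > 0"
    using hinner_self_nonneg[OF H y] False rp(1) by (simp add: r_def order_less_le) (metis of_real_0)
  ultimately have "(cmod a)\<^sup>2 \<le> Re r * Re p" by (simp add: zero_le_mult_iff)
  also have "\<dots> = cmod r * cmod p"
    using rp r_pos hinner_self_nonneg[OF H x] by (metis norm_of_real abs_of_nonneg less_imp_le p_def)
  also have "\<dots> = (hnorm' H x * hnorm' H y)\<^sup>2" by (simp add: p_def r_def power_mult_distrib)
  finally have "cmod a \<le> hnorm' H x * hnorm' H y" by (rule power2_le_imp_le) simp
  then show ?thesis using pr by simp
qed

lemma hilbert_module_hilbert_space: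
  assumes H: "hilbert_space H"
  shows "hilbert_module (hcarrier H) (hinner H) (hnorm' H)"
proof unfold_locales
  show "\<exists>x\<in>hcarrier H. (\<lambda>n. hnorm' H (X n - x)) \<longlonglongrightarrow> 0"
    if X: "\<And>n. X n \<in> hcarrier H"
      "\<And>e. e > 0 \<Longrightarrow> \<exists>M. \<forall>m\<ge>M. \<forall>n\<ge>M. hnorm' H (X m - X n) < e" for X
  proof -
    have eq: "hnorm H (X m - x) = hnorm' H (X m - x)" if "x \<in> hcarrier H" for x m
      by (rule hnorm_eq[OF H csubspace_diff[OF hilbert_csubspace[OF H] X(1) that]])
    have "\<exists>x\<in>hcarrier H. (\<lambda>n. hnorm H (X n - x)) \<longlonglongrightarrow> 0"
      using H X unfolding hilbert_space_def by (simp add: eq[OF X(1)])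
    then show ?thesis using eq by auto
  qed
  show "hinner H y x = star (hinner H x y)" if "x \<in> hcarrier H" "y \<in> hcarrier H" for x y
    using hinner_cnj[OF H that] by (simp add: star_complex_def)
qed (use hilbert_csubspace[OF H] hinner_add_right[OF H] hinner_scale_right[OF H]
    hilbert_cauchy_schwarz[OF H] hinner_self_eq_0[OF H] in simp_all)

text \<open>The representing vector u minimises J x = |x|^2 - 2 Re (f x), because J x = |x - u|^2 -
  |u|^2 for it. A minimising sequence is Cauchy by the parallelogram law, and varying the minimum in
  the direction x gives equality of the real parts; i x then gives the imaginary parts.\<close>

theorem riesz_representation:
  assumes H: "hilbert_space H" and f: "clinear_on (hcarrier H) f"
    and K: "\<And>x. x \<in> hcarrier H \<Longrightarrow> cmod (f x) \<le> K * hnorm' H x"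
  shows "\<exists>u\<in>hcarrier H. \<forall>x\<in>hcarrier H. f x = hinner H u x"
proof -
  interpret hilbert_module "hcarrier H" "hinner H" "hnorm' H"
    by (rule hilbert_module_hilbert_space[OF H])
  define N where "N = hnorm' H"
  define V where "V = hcarrier H"
  note V_rules = V_zero[folded V_def] V_add[folded V_def] V_scale[folded V_def] V_diff[folded V_def]
  have f_add: "f (x + y) = f x + f y" and f_scale: "f (c *\<^sub>C x) = c * f x"
    if "x \<in> V" "y \<in> V" for x y c
    using f that unfolding clinear_on_def V_def scaleC_complex_def by blast+
  have f_diff: "f (x - y) = f x - f y" if "x \<in> V" "y \<in> V" for x y
    using clinear_on_diff[OF V_subspace f] that unfolding V_def by blast
  have N2: "(N x)\<^sup>2 = Re (hinner H x x)" if "x \<in> V" for x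
    using that hinner_self_Im[OF H] hinner_self_nonneg[OF H] unfolding V_def N_def
    by (simp add: cmod_def)
  have sym: "Re (hinner H y x) = Re (hinner H x y)" if "x \<in> V" "y \<in> V" for x y
    using hinner_cnj[OF H, of x y] that unfolding V_def by simp
  have N2_add: "(N (x + y))\<^sup>2 = (N x)\<^sup>2 + 2 * Re (hinner H x y) + (N y)\<^sup>2"
    and N2_diff: "(N (x - y))\<^sup>2 = (N x)\<^sup>2 - 2 * Re (hinner H x y) + (N y)\<^sup>2"
    if "x \<in> V" "y \<in> V" for x y
    using that sym[OF that] V_rules N2
    by (simp_all add: ip_add_left ip_add_right ip_diff_left ip_diff_right V_def[symmetric])
  define J where "J x = (N x)\<^sup>2 - 2 * Re (f x)" for x
  have J_lower: "- K\<^sup>2 \<le> J x" if "x \<in> V" for x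
  proof -
    have "Re (f x) \<le> K * N x"
      using K[of x] complex_Re_le_cmod[of "f x"] that by (simp add: V_def N_def)
    moreover have "0 \<le> (N x - K)\<^sup>2" by simp
    ultimately show ?thesis by (simp add: J_def power2_eq_square algebra_simps)
  qed
  define d where "d = Inf (J ` V)"
  have bdd: "bdd_below (J ` V)" using J_lower by (auto intro!: bdd_belowI)
  have d_le: "d \<le> J x" if "x \<in> V" for x
    unfolding d_def using bdd that by (intro cInf_lower) auto
  have "\<exists>x. x \<in> V \<and> J x < d + 1 / real (Suc n)" for n
  proof (rule ccontr)
    assume "\<not> ?thesis"
    then have "\<And>x. x \<in> V \<Longrightarrow> d + 1 / real (Suc n) \<le> J x" by (meson not_le)
    then have "d + 1 / real (Suc n) \<le> d"
      unfolding d_def using V_rules(1) by (intro cInf_greatest) auto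
    then show False by simp
  qed
  then obtain X where X: "\<And>n. X n \<in> V" "\<And>n. J (X n) < d + 1 / real (Suc n)" by metis
  \<comment> \<open>Parallelogram law, where the midpoint w contributes
    \<open>J w \<ge> d\<close>.\<close>
  have dist: "(N (x - y))\<^sup>2 \<le> 2 * (J x - d) + 2 * (J y - d)" if "x \<in> V" "y \<in> V" for x y
  proof -
    define w where "w = (1/2) *\<^sub>C (x + y)"
    have w: "w \<in> V" unfolding w_def using that V_rules by blast
    have "N w = 1/2 * N (x + y)" unfolding w_def N_def
      using N_scale[of "x + y" "1/2"] that V_rules by (simp add: V_def[symmetric] norm_divide)
    then have "N (x + y) = 2 * N w" by simp
    then have "4 * (N w)\<^sup>2 = (N (x + y))\<^sup>2" by (simp add: power_mult_distrib)
    moreover have fw: "f w = 1/2 * (f x + f y)"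
      unfolding w_def using that V_rules f_scale[of "x + y" "x + y" "1/2"] f_add by simp
    have "2 * Re (f w) = Re (f x) + Re (f y)" unfolding fw by simp
    ultimately have "(N (x - y))\<^sup>2 = 2 * J x + 2 * J y - 4 * J w"
      unfolding J_def using N2_add[OF that] N2_diff[OF that] by (simp add: algebra_simps)
    then show ?thesis using d_le[OF w] by simp
  qed
  have cauchy: "\<exists>M. \<forall>m\<ge>M. \<forall>n\<ge>M. N (X m - X n) < e" if e: "e > 0" for e
  proof -
    obtain M where M: "1 / real (Suc M) < e\<^sup>2 / 4"
      using e reals_Archimedean[of "e\<^sup>2 / 4"] by (auto simp: inverse_eq_divide)
    have "N (X m - X n) < e" if "m \<ge> M" "n \<ge> M" for m n
    proof -
      have "1 / real (Suc m) \<le> 1 / real (Suc M)" "1 / real (Suc n) \<le> 1 / real (Suc M)"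
        using that by (auto intro!: divide_left_mono)
      then have "J (X m) - d \<le> 1 / real (Suc M)" "J (X n) - d \<le> 1 / real (Suc M)"
        using X(2)[of m] X(2)[of n] by (simp_all only: diff_le_eq)
      moreover have "a < b" if "a \<le> 2 * p + 2 * q" "p \<le> c" "q \<le> c" "c < b / 4" for a b c p q :: real
        using that by linarith
      ultimately have "(N (X m - X n))\<^sup>2 < e\<^sup>2"
        using dist[OF X(1) X(1), of m n] M by blast
      then show "N (X m - X n) < e" using e by (intro power2_less_imp_less[of _ e]) simp_all
    qed
    then show ?thesis by blast
  qed
  obtain u where u: "u \<in> V" and lim: "(\<lambda>n. N (X n - u)) \<longlonglongrightarrow> 0"
    using V_complete[of X] X(1) cauchy unfolding V_def N_def by blast
  have "J u \<le> d"
  proof -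
    have "(\<lambda>n. f (X n) - f u) \<longlonglongrightarrow> 0"
    proof (rule tendsto_0_le[OF tendsto_mult_right_zero[OF lim, of K], of _ 1])
      show "\<forall>\<^sub>F n in sequentially. norm (f (X n) - f u) \<le> norm (K * N (X n - u)) * 1"
        using K[of "X n - u" for n] X(1) u V_rules(4) f_diff
        by (intro always_eventually allI) (fastforce simp: V_def N_def intro: order_trans[OF _ abs_ge_self])
    qed
    then have fl: "(\<lambda>n. f (X n)) \<longlonglongrightarrow> f u" by (rule LIM_zero_cancel)
    have "(\<lambda>n. N (X n) - N u) \<longlonglongrightarrow> 0"
    proof (rule tendsto_0_le[OF lim, of _ 1])
      have "\<bar>N x - N y\<bar> \<le> N (x - y)" if "x \<in> V" "y \<in> V" for x y
        using N_le_diff[of x y] N_le_diff[of y x] N_minus_commute[of x y] that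
        unfolding N_def V_def by linarith
      then show "\<forall>\<^sub>F n in sequentially. norm (N (X n) - N u) \<le> norm (N (X n - u)) * 1"
        using X(1) u by (intro always_eventually allI) (simp add: N_def)
    qed
    then have "(\<lambda>n. N (X n)) \<longlonglongrightarrow> N u" by (rule LIM_zero_cancel)
    then have "(\<lambda>n. J (X n)) \<longlonglongrightarrow> J u" unfolding J_def by (intro tendsto_intros fl)
    moreover have "(\<lambda>n. d + 1 / real (Suc n)) \<longlonglongrightarrow> d + 0"
      by (intro tendsto_intros) (rule LIMSEQ_Suc[OF lim_1_over_n])
    ultimately show "J u \<le> d"
      using LIMSEQ_le[of "\<lambda>n. J (X n)" "J u" "\<lambda>n. d + 1 / real (Suc n)" "d + 0"] X(2)
      by (simp add: less_imp_le)
  qed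
  have re: "Re (f x) = Re (hinner H u x)" if x: "x \<in> V" for x
  proof -
    define b where "b = Re (hinner H u x) - Re (f x)"
    \<comment> \<open>Minimises t^2 |x|^2 + 2 t b up to the summand 1, which keeps the denominator
      positive when x = 0.\<close>
    define t where "t = - b / ((N x)\<^sup>2 + 1)"
    define y where "y = complex_of_real t *\<^sub>C x"
    have y: "y \<in> V" using x V_rules by (simp add: y_def)
    have ux: "Re (hinner H u y) = t * Re (hinner H u x)"
      unfolding y_def using u x ip_scale_right[of u x] by (simp add: V_def scaleC_complex_def)
    have Ny: "(N y)\<^sup>2 = t\<^sup>2 * (N x)\<^sup>2"
      unfolding y_def N_def using x N_scale[of x] by (simp add: V_def power_mult_distrib)
    have "J (u + y) = J u + t\<^sup>2 * (N x)\<^sup>2 + 2 * t * b"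
      unfolding J_def N2_add[OF u y] Ny ux using u x y f_add[OF u y] f_scale[OF x x, of t]
      by (simp add: y_def b_def algebra_simps)
    moreover have "J u \<le> J (u + y)" using \<open>J u \<le> d\<close> d_le[of "u + y"] u y V_rules by force
    ultimately have "0 \<le> t\<^sup>2 * (N x)\<^sup>2 + 2 * t * b" by simp
    also have "\<dots> \<le> t\<^sup>2 * ((N x)\<^sup>2 + 1) + 2 * t * b" by (simp add: mult_left_mono)
    also have "\<dots> = - (b\<^sup>2 / ((N x)\<^sup>2 + 1))"
    proof -
      have "(- b / s)\<^sup>2 * s + 2 * (- b / s) * b = - (b\<^sup>2 / s)" if "s \<noteq> 0" for s
        using that by (simp add: power2_eq_square)
      moreover have "(N x)\<^sup>2 + 1 \<noteq> 0" using add_nonneg_pos[of "(N x)\<^sup>2" 1] by simp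
      ultimately show ?thesis unfolding t_def by blast
    qed
    finally have "b\<^sup>2 / ((N x)\<^sup>2 + 1) \<le> 0" by simp
    moreover have "(N x)\<^sup>2 + 1 > 0" by (simp add: add_nonneg_pos)
    ultimately have "b = 0" by (simp add: divide_le_0_iff)
    then show ?thesis by (simp add: b_def)
  qed
  have "f x = hinner H u x" if x: "x \<in> V" for x
  proof -
    have "Re (f (\<i> *\<^sub>C x)) = Re (hinner H u (\<i> *\<^sub>C x))" using re V_rules x by blast
    then have "Im (f x) = Im (hinner H u x)"
      using f_scale[OF x x, of \<i>] u x ip_scale_right[of u x \<i>] by (simp add: V_def scaleC_complex_def)
    then show ?thesis using re[OF x] by (simp add: complex_eq_iff)
  qed
  then show ?thesis using u unfolding V_def by blast
qed

text \<open>Split off from \<open>hilbert_space\<close> because the identification of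
  \<open>hadjoint\<close> with a given operator rests on this property alone.\<close>

definition hinner_separating :: "'v::complex_vector hilb \<Rightarrow> bool" where
  "hinner_separating H \<longleftrightarrow> (\<forall>u\<in>hcarrier H. \<forall>v\<in>hcarrier H.
     (\<forall>y\<in>hcarrier H. hinner H u y = hinner H v y) \<longrightarrow> u = v)"

lemma hinner_separatingD:
  "hinner_separating H \<Longrightarrow> u \<in> hcarrier H \<Longrightarrow> v \<in> hcarrier H \<Longrightarrow>
    (\<And>y. y \<in> hcarrier H \<Longrightarrow> hinner H u y = hinner H v y) \<Longrightarrow> u = v"
  unfolding hinner_separating_def by blast

lemma hilbert_space_separating:
  assumes H: "hilbert_space H" shows "hinner_separating H"
  unfolding hinner_separating_def
proof (intro ballI impI)
  interpret hilbert_module "hcarrier H" "hinner H" "hnorm' H"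
    by (rule hilbert_module_hilbert_space[OF H])
  fix u v assume uv: "u \<in> hcarrier H" "v \<in> hcarrier H"
    and eq: "\<forall>y\<in>hcarrier H. hinner H u y = hinner H v y"
  have "hinner H (u - v) (u - v) = 0"
    using uv eq V_diff[OF uv] by (simp add: ip_diff_left)
  then show "u = v" using hinner_self_eq_0[OF H V_diff[OF uv]] by simp
qed

lemma hadjoint_eqI:
  assumes H: "hinner_separating H" and S: "S \<in> bounded_ops H"
    and adj: "\<And>x y. x \<in> hcarrier H \<Longrightarrow> y \<in> hcarrier H \<Longrightarrow> hinner H (S x) y = hinner H x (T y)"
  shows "hadjoint H T = S"
  unfolding hadjoint_def
proof (rule the_equality)
  fix R assume R: "R \<in> bounded_ops H \<and> (\<forall>x\<in>hcarrier H. \<forall>y\<in>hcarrier H. hinner H (R x) y = hinner H x (T y))"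
  show "R = S"
  proof
    fix x
    show "R x = S x"
    proof (cases "x \<in> hcarrier H")
      case True
      then show ?thesis
        using R S adj by (intro hinner_separatingD[OF H]) (auto simp: bounded_ops_def)
    qed (use R S in \<open>auto simp: bounded_ops_def\<close>)
  qed
qed (use S adj in blast)

lemma bounded_opsD:
  assumes "T \<in> bounded_ops H"
  shows "x \<in> hcarrier H \<Longrightarrow> T x \<in> hcarrier H" "clinear_on (hcarrier H) T" "x \<notin> hcarrier H \<Longrightarrow> T x = 0"
  using assms unfolding bounded_ops_def by auto

lemma bounded_ops_iff:
  assumes H: "hilbert_space H"
  shows "T \<in> bounded_ops H \<longleftrightarrow> (\<forall>x\<in>hcarrier H. T x \<in> hcarrier H) \<and> clinear_on (hcarrier H) T \<and>
     (\<exists>K. \<forall>x\<in>hcarrier H. hnorm' H (T x) \<le> K * hnorm' H x) \<and> (\<forall>x. x \<notin> hcarrier H \<longrightarrow> T x = 0)"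
proof -
  have "(\<forall>x\<in>hcarrier H. hnorm H (T x) \<le> K * hnorm H x) \<longleftrightarrow>
      (\<forall>x\<in>hcarrier H. hnorm' H (T x) \<le> K * hnorm' H x)"
    if "\<forall>x\<in>hcarrier H. T x \<in> hcarrier H" for K
    using that hnorm_eq[OF H] by auto
  then show ?thesis unfolding bounded_ops_def by blast
qed

text \<open>Riesz representation of y \<mapsto> <x, T y> gives S x, and the bound comes from |S x|^2
  = <x, T (S x)>. Off the carrier S is set to 0, as \<open>bounded_ops\<close> demands.\<close>

lemma hadjoint:
  assumes H: "hilbert_space H" and T: "T \<in> bounded_ops H"
  shows hadjoint_in: "hadjoint H T \<in> bounded_ops H"
    and hinner_hadjoint_left:
      "x \<in> hcarrier H \<Longrightarrow> y \<in> hcarrier H \<Longrightarrow> hinner H (hadjoint H T x) y = hinner H x (T y)"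
proof -
  interpret hilbert_module "hcarrier H" "hinner H" "hnorm' H"
    by (rule hilbert_module_hilbert_space[OF H])
  have T_in: "T x \<in> hcarrier H" if "x \<in> hcarrier H" for x using bounded_opsD(1)[OF T that] .
  have T_lin: "T (x + y) = T x + T y" "T (c *\<^sub>C x) = c *\<^sub>C T x"
    if "x \<in> hcarrier H" "y \<in> hcarrier H" for x y c
    using bounded_opsD(2)[OF T] that unfolding clinear_on_def by auto
  obtain K where K: "\<And>x. x \<in> hcarrier H \<Longrightarrow> hnorm' H (T x) \<le> K * hnorm' H x"
    using T unfolding bounded_ops_iff[OF H] by blast
  have bound: "cmod (hinner H x (T y)) \<le> (hnorm' H x * K) * hnorm' H y"
    if "x \<in> hcarrier H" "y \<in> hcarrier H" for x y
    using order_trans[OF ip_le[OF that(1) T_in[OF that(2)]] mult_left_mono[OF K[OF that(2)] N_nonneg]]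
    by (simp add: mult.assoc)
  have "\<exists>u\<in>hcarrier H. \<forall>y\<in>hcarrier H. hinner H x (T y) = hinner H u y" if x: "x \<in> hcarrier H" for x
    using x T_in T_lin bound[OF x]
    by (intro riesz_representation[OF H]) (auto simp: clinear_on_def ip_add_right ip_scale_right)
  then obtain S0 where S0: "\<And>x. x \<in> hcarrier H \<Longrightarrow> S0 x \<in> hcarrier H"
    "\<And>x y. x \<in> hcarrier H \<Longrightarrow> y \<in> hcarrier H \<Longrightarrow> hinner H (S0 x) y = hinner H x (T y)" by metis
  define S where "S x = (if x \<in> hcarrier H then S0 x else 0)" for x
  have S: "S x \<in> hcarrier H" "hinner H (S x) y = hinner H x (T y)"
    if "x \<in> hcarrier H" "y \<in> hcarrier H" for x y
    using S0 that by (auto simp: S_def)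
  note sep = hinner_separatingD[OF hilbert_space_separating[OF H]]
  have "clinear_on (hcarrier H) S"
    unfolding clinear_on_def
  proof (intro conjI ballI allI)
    fix x y c assume xy: "x \<in> hcarrier H" "y \<in> hcarrier H"
    show "S (x + y) = S x + S y"
      using S xy T_in V_add by (intro sep) (auto simp: ip_add_left)
    show "S (c *\<^sub>C x) = c *\<^sub>C S x"
      using S xy T_in V_scale by (intro sep) (auto simp: ip_scale_left)
  qed
  moreover have "\<forall>x\<in>hcarrier H. hnorm' H (S x) \<le> K * hnorm' H x"
  proof
    fix x assume x: "x \<in> hcarrier H"
    define s where "s = hnorm' H (S x)"
    have "s\<^sup>2 \<le> (hnorm' H x * K) * s"
      using bound[OF x S(1)[OF x x]] S(2)[OF x S(1)[OF x x]] N_square[OF S(1)[OF x x]]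
      by (simp add: s_def)
    moreover have "0 \<le> K * hnorm' H x" by (rule order_trans[OF N_nonneg K[OF x]])
    moreover have "0 \<le> s" by (simp add: s_def)
    ultimately have "s \<le> K * hnorm' H x"
      by (cases "s = 0") (simp_all add: power2_eq_square mult.commute)
    then show "hnorm' H (S x) \<le> K * hnorm' H x" by (simp add: s_def)
  qed
  ultimately have SB: "S \<in> bounded_ops H"
    unfolding bounded_ops_iff[OF H] using S by (auto simp: S_def)
  have "hadjoint H T = S"
    using S by (intro hadjoint_eqI hilbert_space_separating[OF H] SB) auto
  then show "hadjoint H T \<in> bounded_ops H"
    and "x \<in> hcarrier H \<Longrightarrow> y \<in> hcarrier H \<Longrightarrow> hinner H (hadjoint H T x) y = hinner H x (T y)"
    using SB S by auto
qed

lemma hinner_hadjoint_right: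
  assumes H: "hilbert_space H" and T: "T \<in> bounded_ops H" and xy: "x \<in> hcarrier H" "y \<in> hcarrier H"
  shows "hinner H (T x) y = hinner H x (hadjoint H T y)"
  using hinner_hadjoint_left[OF H T xy(2,1)] hinner_cnj[OF H] xy bounded_opsD(1)[OF T]
    bounded_opsD(1)[OF hadjoint_in[OF H T]]
  by metis

lemma star_module_rep:
  assumes H: "hilbert_space H" and B: "cstar_subalgebra B" and hom: "star_hom (Alg B) (Bop H) \<pi>"
  shows "star_module (hcarrier H) (hinner H) (hnorm' H) B \<pi>"
proof -
  interpret hilbert_module "hcarrier H" "hinner H" "hnorm' H"
    by (rule hilbert_module_hilbert_space[OF H])
  have bop: "\<pi> b \<in> bounded_ops H" if "b \<in> B" for b
    using hom that by (auto simp: star_hom_def Alg_def Bop_def)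
  have adj: "\<pi> (star b) = hadjoint H (\<pi> b)" if "b \<in> B" for b
    using hom that by (auto simp: star_hom_def Alg_def Bop_def)
  have lin: "\<pi> (b + d) x = \<pi> b x + \<pi> d x" "\<pi> (c *\<^sub>C b) x = c *\<^sub>C \<pi> b x" "\<pi> (b * d) x = \<pi> b (\<pi> d x)"
    if "b \<in> B" "d \<in> B" for b c d x
    using hom that by (auto simp: star_hom_def Alg_def Bop_def)
  show ?thesis
    by unfold_locales (use B bounded_opsD(1,2)[OF bop] hinner_hadjoint_right[OF H bop]
        in \<open>simp_all add: lin adj\<close>)
qed

text \<open>The essential part is a closed subspace and contains all \<open>\<pi> b x\<close>, whose
  span is dense. Multipliers therefore act on the whole Hilbert space.\<close>

lemma nondeg_rep_ess:
  assumes H: "hilbert_space H" and B: "cstar_subalgebra B" and rep: "nondeg_rep B H \<pi>"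
  shows "star_module.ess (hcarrier H) (hnorm' H) B \<pi> = hcarrier H"
proof -
  interpret star_module "hcarrier H" "hinner H" "hnorm' H" B \<pi>
    using star_module_rep[OF H B] rep by (simp add: nondeg_rep_def)
  have sub: "cspan {\<pi> b x | b x. b \<in> B \<and> x \<in> hcarrier H} \<subseteq> ess"
    using T_in_ess ess_csubspace unfolding cspan_def csubspace_def
    by (intro cvec.span_minimal) auto
  have "v \<in> ess" if v: "v \<in> hcarrier H" for v
  proof (rule ess_limit[OF v])
    fix \<epsilon> :: real assume "\<epsilon> > 0"
    then obtain x where x: "x \<in> cspan {\<pi> b x | b x. b \<in> B \<and> x \<in> hcarrier H}"
      and le: "hnorm H (v - x) < \<epsilon>"
      using rep v unfolding nondeg_rep_def hdense_def by blast
    have "x \<in> ess" using sub x by (rule subsetD)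
    then show "\<exists>x\<in>ess. hnorm' H (v - x) < \<epsilon>"
      using le hnorm_eq[OF H V_diff[OF v ess_in]] by auto
  qed
  then show ?thesis using ess_in by auto
qed

section \<open>Extension to multiplier algebras\<close>

text \<open>The condition under the choice operator of \<open>extension\<close>. Naming it lets any
  explicit candidate certify the chosen map.\<close>

definition is_extension ::
    "'b::cstar_algebra set \<Rightarrow> 'y star_alg \<Rightarrow> ('b \<Rightarrow> 'y) \<Rightarrow> ('b multiplier \<Rightarrow> 'y) \<Rightarrow> bool" where
  "is_extension B Y \<phi> \<Phi> \<longleftrightarrow> star_hom (Mult B) Y \<Phi> \<and>
     (\<forall>y\<in>sa_carrier Y. sa_mult Y (\<Phi> (mult_one B)) y = y \<and> sa_mult Y y (\<Phi> (mult_one B)) = y) \<and>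
     (\<forall>b\<in>B. \<Phi> (mult_emb B b) = \<phi> b)"

lemma is_extension_extension:
  "is_extension B Y \<phi> \<Phi> \<Longrightarrow> is_extension B Y \<phi> (extension B Y \<phi>)"
  unfolding extension_def is_extension_def[symmetric] by (rule someI[of "is_extension B Y \<phi>"])

lemma star_homD:
  assumes "star_hom X Y f" "x \<in> sa_carrier X"
  shows "f x \<in> sa_carrier Y" "f (sa_scale X c x) = sa_scale Y c (f x)"
    "f (sa_star X x) = sa_star Y (f x)"
    "y \<in> sa_carrier X \<Longrightarrow> f (sa_add X x y) = sa_add Y (f x) (f y)"
    "y \<in> sa_carrier X \<Longrightarrow> f (sa_mult X x y) = sa_mult Y (f x) (f y)"
  using assms unfolding star_hom_def by auto

lemma Mult_sel:
  "sa_carrier (Mult B) = multipliers B"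
  "fst (sa_add (Mult B) m n) b = fst m b + fst n b" "snd (sa_add (Mult B) m n) b = snd m b + snd n b"
  "fst (sa_scale (Mult B) c m) b = c *\<^sub>C fst m b" "snd (sa_scale (Mult B) c m) b = c *\<^sub>C snd m b"
  "fst (sa_mult (Mult B) m n) b = fst m (fst n b)" "snd (sa_mult (Mult B) m n) b = snd n (snd m b)"
  "fst (sa_star (Mult B) m) b = star (snd m (star b))"
  "snd (sa_star (Mult B) m) b = star (fst m (star b))"
  by (simp_all add: Mult_def)

lemma Alg_sel:
  "sa_carrier (Alg B) = B" "sa_add (Alg B) = (+)" "sa_scale (Alg B) = scaleC"
  "sa_mult (Alg B) = (*)" "sa_star (Alg B) = star"
  by (simp_all add: Alg_def)

lemma Bop_sel:
  "sa_carrier (Bop H) = bounded_ops H" "sa_add (Bop H) S R = (\<lambda>x. S x + R x)"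
  "sa_scale (Bop H) c S = (\<lambda>x. c *\<^sub>C S x)"
  "sa_mult (Bop H) S R = (\<lambda>x. S (R x))" "sa_star (Bop H) = hadjoint H"
  by (simp_all add: Bop_def)

lemma mult_emb_apply: "b \<in> B \<Longrightarrow> fst (mult_emb B c) b = c * b" "b \<in> B \<Longrightarrow> snd (mult_emb B c) b = b * c"
  by (simp_all add: mult_emb_def)

lemma multiplier_zero:
  assumes B: "cstar_subalgebra B" and m: "m \<in> multipliers B"
  shows "fst m 0 = 0" "snd m 0 = 0"
  using clinear_on_zero[OF cstar_sub_csubspace[OF B]] multiplier_fst_linear[OF m]
    multiplier_snd_linear[OF m] by auto

lemma Mult_mult_emb:
  assumes B: "cstar_subalgebra B" and m: "m \<in> multipliers B" and b: "b \<in> B"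
  shows "sa_mult (Mult B) m (mult_emb B b) = mult_emb B (fst m b)"
    and "sa_mult (Mult B) (mult_emb B b) m = mult_emb B (snd m b)"
  using b multiplier_fst_mult[OF m] multiplier_snd_mult[OF m] multiplier_central[OF m]
    multiplier_zero[OF B m] multiplier_off[OF m] multiplier_fst_in[OF m] multiplier_snd_in[OF m]
    cstar_sub_zero[OF B]
  by (auto simp: Mult_def mult_emb_def fun_eq_iff)

lemma mult_emb_inject:
  assumes B: "cstar_subalgebra B" and bc: "b \<in> B" "c \<in> B" and eq: "mult_emb B b = mult_emb B c"
  shows "b = c"
proof -
  have "b * x = c * x" if "x \<in> B" for x using mult_emb_apply(1)[OF that] eq by metis
  then have "(b - c) * star (b - c) = 0"
    using bc cstar_sub_intros[OF B] by (simp add: left_diff_distrib)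
  then show ?thesis using norm_mult_star[of "b - c"] by simp
qed

text \<open>In M(B) the product of m with an embedded b is the embedded m b or b m. The two
  resulting identities pin down an extension on products without recourse to how it was
  chosen.\<close>

lemma is_extension_mult:
  assumes ext: "is_extension B Y \<phi> \<Phi>" and B: "cstar_subalgebra B"
    and m: "m \<in> multipliers B" and b: "b \<in> B"
  shows "sa_mult Y (\<Phi> m) (\<phi> b) = \<phi> (fst m b)" "sa_mult Y (\<phi> b) (\<Phi> m) = \<phi> (snd m b)"
proof -
  have hom: "star_hom (Mult B) Y \<Phi>" and emb: "\<And>b. b \<in> B \<Longrightarrow> \<Phi> (mult_emb B b) = \<phi> b"
    using ext unfolding is_extension_def by auto
  note in_M = m[folded Mult_sel(1)] mult_emb_in[OF B b, folded Mult_sel(1)]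
  show "sa_mult Y (\<Phi> m) (\<phi> b) = \<phi> (fst m b)"
    using star_homD(5)[OF hom in_M] emb[OF b] emb[OF multiplier_fst_in[OF m b]]
    by (simp add: Mult_mult_emb[OF B m b])
  show "sa_mult Y (\<phi> b) (\<Phi> m) = \<phi> (snd m b)"
    using star_homD(5)[OF hom in_M(2,1)] emb[OF b] emb[OF multiplier_snd_in[OF m b]]
    by (simp add: Mult_mult_emb[OF B m b])
qed

lemma is_extension_bounded_ops:
  assumes ext: "is_extension B (Bop H) \<pi> \<Phi>" and m: "m \<in> multipliers B"
  shows "\<Phi> m \<in> bounded_ops H"
proof -
  have "star_hom (Mult B) (Bop H) \<Phi>" using ext by (simp add: is_extension_def)
  from star_homD(1)[OF this] show ?thesis using m by (simp add: Mult_sel Bop_sel)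
qed

lemma hid_comp:
  assumes H: "csubspace (hcarrier H)" and y: "y \<in> bounded_ops H"
  shows "(\<lambda>x. hid H (y x)) = y" "(\<lambda>x. y (hid H x)) = y"
proof -
  have zero: "y 0 = 0" "0 \<in> hcarrier H"
    using clinear_on_zero[OF H bounded_opsD(2)[OF y]] H by (auto simp: csubspace_iff)
  have "hid H (y x) = y x \<and> y (hid H x) = y x" for x
    using bounded_opsD(1,3)[OF y, of x] zero by (cases "x \<in> hcarrier H") (auto simp: hid_def)
  then show "(\<lambda>x. hid H (y x)) = y" "(\<lambda>x. y (hid H x)) = y" by auto
qed

lemma extension_Bop:
  assumes H: "hilbert_space H" and B: "cstar_subalgebra B" and rep: "nondeg_rep B H \<pi>"
  shows "is_extension B (Bop H) \<pi> (extension B (Bop H) \<pi>)"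
proof -
  have hom: "star_hom (Alg B) (Bop H) \<pi>" using rep by (simp add: nondeg_rep_def)
  interpret star_module "hcarrier H" "hinner H" "hnorm' H" B \<pi> by (rule star_module_rep[OF H B hom])
  have ess: "ess = hcarrier H" by (rule nondeg_rep_ess[OF H B rep])
  define \<Phi> where "\<Phi> m = (\<lambda>x. if x \<in> hcarrier H then mop m x else 0)" for m
  note mop_in' = mop_in[unfolded ess]
  have bop: "\<Phi> m \<in> bounded_ops H" if m: "m \<in> multipliers B" for m
    using mop_in'[OF m] mop_add[OF m] mop_scale[OF m] mop_bounded[OF m] V_intros
    unfolding bounded_ops_iff[OF H] clinear_on_def ess by (simp add: \<Phi>_def)
  have adj: "\<Phi> (sa_star (Mult B) m) = hadjoint H (\<Phi> m)" if m: "m \<in> multipliers B" for m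
  proof (rule hadjoint_eqI[symmetric, OF hilbert_space_separating[OF H]])
    show "\<Phi> (sa_star (Mult B) m) \<in> bounded_ops H" by (rule bop[OF multiplier_star_in[OF B m]])
    show "hinner H (\<Phi> (sa_star (Mult B) m) x) y = hinner H x (\<Phi> m y)"
      if "x \<in> hcarrier H" "y \<in> hcarrier H" for x y
      using mop_adjoint[OF multiplier_star_in[OF B m], of x y] that by (simp add: \<Phi>_def ess)
  qed
  have "star_hom (Mult B) (Bop H) \<Phi>"
    unfolding star_hom_def Mult_sel(1) Bop_sel
  proof (intro conjI ballI allI)
    fix m n c assume m: "m \<in> multipliers B" and n: "n \<in> multipliers B"
    show "\<Phi> (sa_add (Mult B) m n) = (\<lambda>x. \<Phi> m x + \<Phi> n x)"
      using mop_Mult_add[OF m n] by (auto simp: \<Phi>_def ess fun_eq_iff)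
    show "\<Phi> (sa_mult (Mult B) m n) = (\<lambda>x. \<Phi> m (\<Phi> n x))"
      using mop_Mult_mult[OF m n] mop_in'[OF n] mop_scale[OF m, of 0 0] V_zero
      by (auto simp: \<Phi>_def ess fun_eq_iff)
    show "\<Phi> (sa_scale (Mult B) c m) = (\<lambda>x. c *\<^sub>C \<Phi> m x)"
      using mop_Mult_scale[OF m] by (auto simp: \<Phi>_def ess fun_eq_iff)
  qed (simp_all add: bop adj)
  moreover have "\<Phi> (mult_one B) = hid H"
    using mop_one by (auto simp: \<Phi>_def hid_def ess fun_eq_iff)
  then have "(\<lambda>x. \<Phi> (mult_one B) (y x)) = y" "(\<lambda>x. y (\<Phi> (mult_one B) x)) = y"
    if "y \<in> bounded_ops H" for y
    using hid_comp[OF V_subspace that] by simp_all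
  moreover have "\<Phi> (mult_emb B b) = \<pi> b" if b: "b \<in> B" for b
    using mop_emb[OF b] star_homD(1)[OF hom] b
    by (auto simp: \<Phi>_def ess fun_eq_iff Alg_sel Bop_sel bounded_ops_def)
  ultimately have "is_extension B (Bop H) \<pi> \<Phi>" unfolding is_extension_def Bop_sel by simp
  then show ?thesis by (rule is_extension_extension)
qed

text \<open>Stated for an invariant closed subspace W because it is to be applied to the left ideal
  C L of \<open>C\<close>, which need not be self-adjoint.\<close>

lemma star_module_Mult:
  assumes D: "cstar_subalgebra D" and B: "cstar_subalgebra B" and hom: "star_hom (Alg B) (Mult D) \<phi>"
    and W: "closed W" "csubspace W" "W \<subseteq> D" "\<And>b w. b \<in> B \<Longrightarrow> w \<in> W \<Longrightarrow> fst (\<phi> b) w \<in> W"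
  shows "star_module W (\<lambda>x y. star x * y) norm B (\<lambda>b. fst (\<phi> b))"
proof -
  interpret S: star_module D "\<lambda>x y. star x * y" norm D "(*)" by (rule star_module_self[OF D])
  have m: "\<phi> b \<in> multipliers D" if "b \<in> B" for b
    using star_homD(1)[OF hom] that by (simp add: Alg_sel Mult_sel)
  show ?thesis
  proof unfold_locales
    show "\<exists>x\<in>W. (\<lambda>n. norm (X n - x)) \<longlonglongrightarrow> 0"
      if X: "\<And>n. X n \<in> W" "\<And>e. e > 0 \<Longrightarrow> \<exists>M. \<forall>m\<ge>M. \<forall>n\<ge>M. norm (X m - X n) < e" for X
    proof -
      obtain x where "(\<lambda>n. norm (X n - x)) \<longlonglongrightarrow> 0" using S.V_complete[of X] X W(3) by blast
      moreover from this have "X \<longlonglongrightarrow> x" by (simp add: tendsto_dist_iff[of X] dist_norm)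
      then have "x \<in> W" by (rule closed_sequentially[OF W(1) X(1)])
      ultimately show ?thesis by blast
    qed
    show "clinear_on W (fst (\<phi> b))" if "b \<in> B" for b
      using multiplier_fst_linear[OF m[OF that]] W(3) unfolding clinear_on_def by blast
    show "star (fst (\<phi> b) v) * w = star v * fst (\<phi> (star b)) w"
      if "b \<in> B" "v \<in> W" "w \<in> W" for b v w
    proof -
      have "snd (\<phi> b) (star w) * v = star w * fst (\<phi> b) v"
        using multiplier_central[OF m[OF that(1)]] that W(3) cstar_sub_star[OF D] by blast
      then have "star v * star (snd (\<phi> b) (star w)) = star (fst (\<phi> b) v) * w"
        by (metis star_mult star_star)
      then show ?thesis using star_homD(3)[OF hom, of b] that by (simp add: Alg_sel Mult_sel)
    qed
  qed (use W B star_homD(2,4,5)[OF hom] in \<open>simp_all add: Alg_sel Mult_sel distrib_left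
      mult_scaleC_right star_mult star_star norm_star_mult norm_mult_ineq[of "star x" for x, simplified]\<close>)
qed

lemma star_module_Mult_self:
  assumes D: "cstar_subalgebra D" and B: "cstar_subalgebra B" and hom: "star_hom (Alg B) (Mult D) \<phi>"
  shows "star_module D (\<lambda>x y. star x * y) norm B (\<lambda>b. fst (\<phi> b))"
proof (intro star_module_Mult[OF D B hom] cstar_sub_closed cstar_sub_csubspace D subset_refl)
  show "fst (\<phi> b) w \<in> D" if "b \<in> B" "w \<in> D" for b w
    using star_homD(1)[OF hom] that by (intro multiplier_fst_in) (simp_all add: Alg_sel Mult_sel)
qed

lemma nondegenerate_ess:
  assumes D: "cstar_subalgebra D" and B: "cstar_subalgebra B" and hom: "star_hom (Alg B) (Mult D) \<phi>"
    and nd: "nondegenerate B D \<phi>"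
  shows "star_module.ess D norm B (\<lambda>b. fst (\<phi> b)) = D"
proof -
  interpret star_module D "\<lambda>x y. star x * y" norm B "\<lambda>b. fst (\<phi> b)"
    by (rule star_module_Mult_self[OF D B hom])
  have sub: "cspan {fst (\<phi> b) x | b x. b \<in> B \<and> x \<in> D} \<subseteq> ess"
    using T_in_ess ess_csubspace unfolding cspan_def csubspace_def
    by (intro cvec.span_minimal) auto
  have "v \<in> ess" if v: "v \<in> D" for v
  proof (rule ess_limit[OF v])
    fix \<epsilon> :: real assume "\<epsilon> > 0"
    moreover have "v \<in> closure (cspan {fst (\<phi> b) x | b x. b \<in> B \<and> x \<in> D})"
      using nd v unfolding nondegenerate_def by blast
    ultimately obtain x where "x \<in> cspan {fst (\<phi> b) x | b x. b \<in> B \<and> x \<in> D}" "dist x v < \<epsilon>"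
      unfolding closure_approachable by blast
    then show "\<exists>x\<in>ess. norm (v - x) < \<epsilon>" using sub by (auto simp: dist_norm norm_minus_commute)
  qed
  then show ?thesis using ess_in by auto
qed

text \<open>\<open>mop\<close> provides the left action only; the right action sends x to the
  adjoint of m^* x^*, where m^* acts by \<open>mop\<close>. Identities for \<open>snd\<close> then
  follow from those for \<open>fst\<close> by \<open>snd_\<Phi>\<close>.\<close>

lemma extension_Mult:
  assumes D: "cstar_subalgebra D" and B: "cstar_subalgebra B" and hom: "star_hom (Alg B) (Mult D) \<phi>"
    and nd: "nondegenerate B D \<phi>"
  shows "is_extension B (Mult D) \<phi> (extension B (Mult D) \<phi>)"
proof -
  interpret star_module D "\<lambda>x y. star x * y" norm B "\<lambda>b. fst (\<phi> b)"
    by (rule star_module_Mult_self[OF D B hom])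
  have ess: "ess = D" by (rule nondegenerate_ess[OF D B hom nd])
  note D_star = cstar_sub_star[OF D] and D_mult = cstar_sub_mult[OF D]
  have phi: "\<phi> b \<in> multipliers D" if "b \<in> B" for b
    using star_homD(1)[OF hom] that by (simp add: Alg_sel Mult_sel)
  define \<Phi> where "\<Phi> m = (\<lambda>x. if x \<in> D then mop m x else 0,
      \<lambda>x. if x \<in> D then star (mop (sa_star (Mult B) m) (star x)) else 0)" for m
  have blin: "bounded_clinear_on D (\<lambda>x. if x \<in> D then mop m x else 0)"
    "bounded_clinear_on D (\<lambda>x. if x \<in> D then star (mop m (star x)) else 0)"
    if m: "m \<in> multipliers B" for m
  proof -
    obtain K where K: "\<And>x. x \<in> D \<Longrightarrow> norm (mop m x) \<le> K * norm x"
      using mop_bounded[OF m] ess by blast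
    then have K': "\<And>x. x \<in> D \<Longrightarrow> norm (star (mop m (star x))) \<le> K * norm x"
      using D_star by (metis norm_star)
    show "bounded_clinear_on D (\<lambda>x. if x \<in> D then mop m x else 0)"
      unfolding bounded_clinear_on_def clinear_on_def
      using K mop_in[OF m] mop_add[OF m] mop_scale[OF m] V_add V_scale by (auto simp: ess)
    show "bounded_clinear_on D (\<lambda>x. if x \<in> D then star (mop m (star x)) else 0)"
      unfolding bounded_clinear_on_def clinear_on_def
      using K' mop_in[OF m] mop_add[OF m] mop_scale[OF m] V_add V_scale D_star
      by (auto simp: ess star_add star_scaleC)
  qed
  have mop_mult: "mop m (a * b) = mop m a * b" if m: "m \<in> multipliers B" and "a \<in> D" "b \<in> D" for m a b
  proof (rule mop_eqI)
    have ma: "mop m a \<in> D" using mop_in[OF m] that ess by blast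
    then show "mop m a * b \<in> ess" using that D_mult ess by blast
    show "fst (\<phi> d) (mop m a * b) = fst (\<phi> (snd m d)) (a * b)" if d: "d \<in> B" for d
      using multiplier_fst_mult[OF phi] T_mop[OF m _ d] ma d multiplier_snd_in[OF m d] \<open>a \<in> D\<close> \<open>b \<in> D\<close>
      by (simp add: ess)
  qed
  have in_M: "\<Phi> m \<in> multipliers D" if m: "m \<in> multipliers B" for m
  proof -
    have m': "sa_star (Mult B) m \<in> multipliers B" by (rule multiplier_star_in[OF B m])
    have "star (mop (sa_star (Mult B) m) (star a)) * b = a * mop m b" if "a \<in> D" "b \<in> D" for a b
      using mop_adjoint[OF m', of "star a" b] that D_star by (simp add: ess star_star)
    then show ?thesis
      unfolding multipliers_def \<Phi>_def
      using blin(1)[OF m] blin(2)[OF m'] mop_mult[OF m] mop_mult[OF m'] D_mult D_star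
      by (auto simp: star_mult star_star)
  qed
  have adj: "\<Phi> (sa_star (Mult B) m) = sa_star (Mult D) (\<Phi> m)" for m
    using D_star by (auto simp: \<Phi>_def Mult_def[of D] star_star fun_eq_iff) (metis star_star)+
  have sa: "fst (\<Phi> m) x = mop m x" if "x \<in> D" for m x using that by (simp add: \<Phi>_def)
  have snd_\<Phi>: "snd (\<Phi> m) x = star (fst (\<Phi> (sa_star (Mult B) m)) (star x))" for m x
    unfolding adj by (simp add: Mult_sel star_star)
  have star_ops: "sa_star (Mult B) (sa_add (Mult B) m n) = sa_add (Mult B) (sa_star (Mult B) m) (sa_star (Mult B) n)"
    "sa_star (Mult B) (sa_scale (Mult B) c m) = sa_scale (Mult B) (cnj c) (sa_star (Mult B) m)"
    "sa_star (Mult B) (sa_mult (Mult B) m n) = sa_mult (Mult B) (sa_star (Mult B) n) (sa_star (Mult B) m)"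
    for m n c
    by (simp_all add: Mult_def star_add star_scaleC star_star)
  have off: "fst (\<Phi> m) x = 0" if "x \<notin> D" for m x using that by (simp add: \<Phi>_def)
  have "star_hom (Mult B) (Mult D) \<Phi>"
    unfolding star_hom_def Mult_sel(1)
  proof (intro conjI ballI allI)
    fix m n c assume m: "m \<in> multipliers B" and n: "n \<in> multipliers B"
    have m': "sa_star (Mult B) m \<in> multipliers B" and n': "sa_star (Mult B) n \<in> multipliers B"
      using multiplier_star_in[OF B] m n by auto
    have add: "fst (\<Phi> (sa_add (Mult B) m n)) x = fst (\<Phi> m) x + fst (\<Phi> n) x"
      if "m \<in> multipliers B" "n \<in> multipliers B" for m n x
      using mop_Mult_add[OF that, of x] off by (cases "x \<in> D") (auto simp: sa ess)
    have scale: "fst (\<Phi> (sa_scale (Mult B) c m)) x = c *\<^sub>C fst (\<Phi> m) x"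
      if "m \<in> multipliers B" for m x c
      using mop_Mult_scale[OF that, of x] off by (cases "x \<in> D") (auto simp: sa ess)
    have mult: "fst (\<Phi> (sa_mult (Mult B) m n)) x = fst (\<Phi> m) (fst (\<Phi> n) x)"
      if "m \<in> multipliers B" "n \<in> multipliers B" for m n x
      using mop_Mult_mult[OF that, of x] off multiplier_zero[OF D in_M[OF that(1)]] mop_in[OF that(2)]
      by (cases "x \<in> D") (auto simp: sa ess)
    show "\<Phi> (sa_add (Mult B) m n) = sa_add (Mult D) (\<Phi> m) (\<Phi> n)"
      by (intro prod_eqI ext) (simp_all add: Mult_sel snd_\<Phi> star_ops star_add add m n m' n')
    show "\<Phi> (sa_scale (Mult B) c m) = sa_scale (Mult D) c (\<Phi> m)"
      by (intro prod_eqI ext) (simp_all add: Mult_sel snd_\<Phi> star_ops star_scaleC scale m m')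
    show "\<Phi> (sa_mult (Mult B) m n) = sa_mult (Mult D) (\<Phi> m) (\<Phi> n)"
      by (intro prod_eqI ext) (simp_all add: Mult_sel snd_\<Phi> star_ops star_star mult m n m' n')
  qed (simp_all add: in_M adj)
  moreover have "\<Phi> (mult_one B) = mult_one D"
  proof -
    have "sa_star (Mult B) (mult_one B) = mult_one B"
      using cstar_sub_star[OF B] by (auto simp: Mult_def mult_one_def fun_eq_iff star_star) (metis star_star)+
    then show ?thesis
      using mop_one D_star by (auto simp: \<Phi>_def mult_one_def[of D] ess star_star fun_eq_iff)
  qed
  then have "sa_mult (Mult D) (\<Phi> (mult_one B)) y = y" "sa_mult (Mult D) y (\<Phi> (mult_one B)) = y"
    if y: "y \<in> multipliers D" for y
  proof -
    have "fst y x \<in> D" "snd y x \<in> D" for x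
      using multiplier_fst_in[OF y] multiplier_snd_in[OF y] multiplier_off[OF y, of x] V_zero
      by (cases "x \<in> D"; simp)+
    then show "sa_mult (Mult D) (\<Phi> (mult_one B)) y = y" "sa_mult (Mult D) y (\<Phi> (mult_one B)) = y"
      using multiplier_off[OF y] multiplier_zero[OF D y] \<open>\<Phi> (mult_one B) = mult_one D\<close>
      by (auto intro!: prod_eqI ext simp: Mult_sel mult_one_def[of D])
  qed
  moreover have "\<Phi> (mult_emb B b) = \<phi> b" if b: "b \<in> B" for b
    using mop_emb[OF b] by (intro multiplier_eqI[OF D in_M[OF mult_emb_in[OF B b]] phi[OF b]])
      (simp add: sa ess)
  ultimately have "is_extension B (Mult D) \<phi> \<Phi>" unfolding is_extension_def Mult_sel(1) by simp
  then show ?thesis by (rule is_extension_extension)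
qed

section \<open>The universal L-representation\<close>

lemma summable_on_nonneg_le:
  fixes f g :: "'i \<Rightarrow> real"
  assumes "g summable_on I" "\<And>i. i \<in> I \<Longrightarrow> 0 \<le> f i" "\<And>i. i \<in> I \<Longrightarrow> f i \<le> g i"
  shows "f summable_on I"
proof -
  have "(\<lambda>i. norm (f i)) summable_on I"
    using assms by (intro Infinite_Sum.abs_summable_on_comparison_test'[of g]) auto
  then show ?thesis using assms(2) by (simp cong: summable_on_cong)
qed

lemma hinner_self_hnorm:
  assumes H: "hilbert_space H" and x: "x \<in> hcarrier H"
  shows "hinner H x x = complex_of_real ((hnorm H x)\<^sup>2)"
  using hinner_self_Im[OF H x] hinner_self_nonneg[OF H x] by (simp add: hnorm_def complex_eq_iff)

lemma hnorm_nonneg: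
  assumes H: "hilbert_space H" and x: "x \<in> hcarrier H" shows "0 \<le> hnorm H x"
  using hinner_self_nonneg[OF H x] by (simp add: hnorm_def)

text \<open>
  Operators on a direct sum are handled componentwise, so its completeness is not needed: the
  separation property suffices to identify adjoints.
\<close>

definition dsum ::
    "'i set \<Rightarrow> ('i \<Rightarrow> 'v::complex_vector hilb) \<Rightarrow> ('i \<Rightarrow> 'v \<Rightarrow> 'v) \<Rightarrow> ('i \<Rightarrow> 'v) \<Rightarrow> 'i \<Rightarrow> 'v" where
  "dsum I K S x = (if x \<in> hcarrier (hilb_sum I K) then (\<lambda>i. if i \<in> I then S i (x i) else 0) else 0)"

lemma rep_sum_eq_dsum: "rep_sum I K \<pi> c = dsum I K (\<lambda>i. \<pi> i c)"
  by (simp add: rep_sum_def dsum_def fun_eq_iff)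

locale hilb_family =
  fixes I :: "'i set" and K :: "'i \<Rightarrow> 'v::complex_vector hilb"
  assumes hilb: "i \<in> I \<Longrightarrow> hilbert_space (K i)"
begin

abbreviation "HS \<equiv> hilb_sum I K"

lemma HS_in: "x \<in> hcarrier HS \<Longrightarrow> i \<in> I \<Longrightarrow> x i \<in> hcarrier (K i)"
  and HS_off: "x \<in> hcarrier HS \<Longrightarrow> i \<notin> I \<Longrightarrow> x i = 0"
  and HS_summable: "x \<in> hcarrier HS \<Longrightarrow> (\<lambda>i. (hnorm (K i) (x i))\<^sup>2) summable_on I"
  by (auto simp: hilb_sum_def)

lemma HS_I:
  "(\<And>i. i \<in> I \<Longrightarrow> x i \<in> hcarrier (K i)) \<Longrightarrow> (\<And>i. i \<notin> I \<Longrightarrow> x i = 0) \<Longrightarrow>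
    (\<lambda>i. (hnorm (K i) (x i))\<^sup>2) summable_on I \<Longrightarrow> x \<in> hcarrier HS"
  by (auto simp: hilb_sum_def)

lemma HS_csubspace: "csubspace (hcarrier HS)"
  unfolding csubspace_iff
proof (intro conjI ballI allI)
  have sub: "csubspace (hcarrier (K i))" if "i \<in> I" for i using hilbert_csubspace[OF hilb[OF that]] .
  have zero: "0 \<in> hcarrier (K i)" if "i \<in> I" for i using sub[OF that] by (simp add: csubspace_iff)
  have "hnorm (K i) 0 = 0" if "i \<in> I" for i
    using clinear_on_zero[OF sub[OF that] hinner_linear[OF hilb[OF that] zero[OF that]]]
    by (simp add: hnorm_def)
  then show "0 \<in> hcarrier HS" using zero by (intro HS_I) (auto cong: summable_on_cong)
  fix x y c assume x: "x \<in> hcarrier HS" and y: "y \<in> hcarrier HS"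
  show "x + y \<in> hcarrier HS"
  proof (rule HS_I)
    show "(x + y) i \<in> hcarrier (K i)" if "i \<in> I" for i
      using sub[OF that] HS_in[OF x that] HS_in[OF y that] by (simp add: csubspace_iff)
    have le: "(hnorm (K i) ((x + y) i))\<^sup>2 \<le> 2 * (hnorm (K i) (x i))\<^sup>2 + 2 * (hnorm (K i) (y i))\<^sup>2"
      if i: "i \<in> I" for i
    proof -
      interpret hilbert_module "hcarrier (K i)" "hinner (K i)" "hnorm' (K i)"
        by (rule hilbert_module_hilbert_space[OF hilb[OF i]])
      have xy: "x i \<in> hcarrier (K i)" "y i \<in> hcarrier (K i)" using HS_in x y i by auto
      have "hnorm (K i) (x i + y i) \<le> hnorm (K i) (x i) + hnorm (K i) (y i)"
        using N_triangle[OF xy] xy V_add[OF xy] by (simp add: hnorm_eq[OF hilb[OF i]])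
      then have "(hnorm (K i) (x i + y i))\<^sup>2 \<le> (hnorm (K i) (x i) + hnorm (K i) (y i))\<^sup>2"
        by (intro power_mono hnorm_nonneg[OF hilb[OF i]] V_add xy)
      also have "\<dots> \<le> 2 * (hnorm (K i) (x i))\<^sup>2 + 2 * (hnorm (K i) (y i))\<^sup>2"
        using sum_squares_bound[of "hnorm (K i) (x i)" "hnorm (K i) (y i)"]
        by (simp add: power2_sum)
      finally show ?thesis by simp
    qed
    show "(\<lambda>i. (hnorm (K i) ((x + y) i))\<^sup>2) summable_on I"
      by (rule summable_on_nonneg_le[OF summable_on_add[OF
            summable_on_cmult_right[OF HS_summable[OF x]] summable_on_cmult_right[OF HS_summable[OF y]]] _ le])
        auto
  qed (use HS_off[OF x] HS_off[OF y] in auto)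
  show "c *\<^sub>C x \<in> hcarrier HS"
  proof (rule HS_I)
    show "(c *\<^sub>C x) i \<in> hcarrier (K i)" if "i \<in> I" for i
      using sub[OF that] HS_in[OF x that] by (simp add: csubspace_iff scaleC_fun_def)
    have eq: "(hnorm (K i) ((c *\<^sub>C x) i))\<^sup>2 = (cmod c)\<^sup>2 * (hnorm (K i) (x i))\<^sup>2" if i: "i \<in> I" for i
    proof -
      interpret hilbert_module "hcarrier (K i)" "hinner (K i)" "hnorm' (K i)"
        by (rule hilbert_module_hilbert_space[OF hilb[OF i]])
      have "x i \<in> hcarrier (K i)" using HS_in x i by auto
      then show ?thesis
        by (simp add: scaleC_fun_def hnorm_eq[OF hilb[OF i]] N_scale V_scale power_mult_distrib
            del: real_sqrt_pow2)
    qed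
    show "(\<lambda>i. (hnorm (K i) ((c *\<^sub>C x) i))\<^sup>2) summable_on I"
      using summable_on_cmult_right[OF HS_summable[OF x], of "(cmod c)\<^sup>2"] eq
      by (simp cong: summable_on_cong)
  qed (use HS_off[OF x] in \<open>auto simp: scaleC_fun_def\<close>)
qed

lemma HS_hnorm:
  assumes x: "x \<in> hcarrier HS"
  shows "hnorm HS x = sqrt (\<Sum>\<^sub>\<infinity>i\<in>I. (hnorm (K i) (x i))\<^sup>2)"
proof -
  have "hinner HS x x = (\<Sum>\<^sub>\<infinity>i\<in>I. complex_of_real ((hnorm (K i) (x i))\<^sup>2))"
    using hinner_self_hnorm[OF hilb HS_in[OF x]] by (simp add: hilb_sum_def cong: infsum_cong)
  also have "\<dots> = complex_of_real (\<Sum>\<^sub>\<infinity>i\<in>I. (hnorm (K i) (x i))\<^sup>2)"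
    by (rule infsumI[OF has_sum_of_real[OF has_sum_infsum[OF HS_summable[OF x]]]])
  finally show ?thesis by (simp add: hnorm_def[of HS])
qed

lemma HS_separating: "hinner_separating HS"
  unfolding hinner_separating_def
proof (intro ballI impI)
  fix u v assume u: "u \<in> hcarrier HS" and v: "v \<in> hcarrier HS"
    and eq: "\<forall>y\<in>hcarrier HS. hinner HS u y = hinner HS v y"
  have zero: "0 \<in> hcarrier (K i)" "w \<in> hcarrier (K i) \<Longrightarrow> hinner (K i) w 0 = 0" if "i \<in> I" for i w
    using hilbert_csubspace[OF hilb[OF that]] hinner_linear[OF hilb[OF that]] clinear_on_zero
    by (auto simp: csubspace_iff)
  show "u = v"
  proof
    fix i
    show "u i = v i"
    proof (cases "i \<in> I")
      case i: True
      show ?thesis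
      proof (rule hinner_separatingD[OF hilbert_space_separating[OF hilb[OF i]] HS_in[OF u i] HS_in[OF v i]])
        fix z assume z: "z \<in> hcarrier (K i)"
        define y where "y j = (if j = i then z else 0)" for j
        have "hnorm (K j) (y j) = 0" if "j \<in> I" "j \<noteq> i" for j
          using zero(2)[OF that(1) zero(1)[OF that(1)]] that by (simp add: y_def hnorm_def)
        then have "{j \<in> I. (hnorm (K j) (y j))\<^sup>2 \<noteq> 0} \<subseteq> {i}" by fastforce
        then have "(\<lambda>j. (hnorm (K j) (y j))\<^sup>2) summable_on I"
          by (rule finite_nonzero_values_imp_summable_on[OF finite_subset]) simp
        then have "y \<in> hcarrier HS" using z zero(1) i by (intro HS_I) (auto simp: y_def)
        moreover have "hinner HS w y = hinner (K i) (w i) z" if w: "w \<in> hcarrier HS" for w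
        proof -
          have "hinner HS w y = (\<Sum>\<^sub>\<infinity>j\<in>I. hinner (K j) (w j) (y j))" by (simp add: hilb_sum_def)
          also have "\<dots> = (\<Sum>\<^sub>\<infinity>j\<in>{i}. hinner (K j) (w j) (y j))"
            using i zero(2) HS_in[OF w] by (intro infsum_cong_neutral) (auto simp: y_def)
          finally show ?thesis by (simp add: y_def)
        qed
        ultimately show "hinner (K i) (u i) z = hinner (K i) (v i) z" using eq u v by metis
      qed
    qed (use HS_off[OF u] HS_off[OF v] in simp)
  qed
qed

lemma dsum_in:
  assumes S: "\<And>i. i \<in> I \<Longrightarrow> S i \<in> bounded_ops (K i)" and "0 \<le> B"
    and B: "\<And>i x. i \<in> I \<Longrightarrow> x \<in> hcarrier (K i) \<Longrightarrow> hnorm (K i) (S i x) \<le> B * hnorm (K i) x"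
  shows "dsum I K S \<in> bounded_ops HS"
proof -
  have le: "(hnorm (K i) (S i x))\<^sup>2 \<le> B\<^sup>2 * (hnorm (K i) x)\<^sup>2" if i: "i \<in> I" and x: "x \<in> hcarrier (K i)" for i x
    using power_mono[OF B[OF i x] hnorm_nonneg[OF hilb[OF i] bounded_opsD(1)[OF S[OF i] x]], of 2]
    by (simp add: power_mult_distrib)
  have sm: "(\<lambda>i. B\<^sup>2 * (hnorm (K i) (x i))\<^sup>2) summable_on I" if "x \<in> hcarrier HS" for x
    by (rule summable_on_cmult_right[OF HS_summable[OF that]])
  have sm': "(\<lambda>i. (hnorm (K i) (S i (x i)))\<^sup>2) summable_on I" if "x \<in> hcarrier HS" for x
    using le HS_in[OF that] by (intro summable_on_nonneg_le[OF sm[OF that]]) auto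
  have in': "dsum I K S x \<in> hcarrier HS" if x: "x \<in> hcarrier HS" for x
    using x bounded_opsD(1)[OF S HS_in[OF x]] sm'[OF x]
    by (intro HS_I) (auto simp: dsum_def cong: summable_on_cong)
  have "clinear_on (hcarrier HS) (dsum I K S)"
    unfolding clinear_on_def
  proof (intro conjI ballI allI)
    fix x y c assume x: "x \<in> hcarrier HS" and y: "y \<in> hcarrier HS"
    have "x + y \<in> hcarrier HS" "c *\<^sub>C x \<in> hcarrier HS"
      using HS_csubspace x y by (auto simp: csubspace_iff)
    then show "dsum I K S (x + y) = dsum I K S x + dsum I K S y" "dsum I K S (c *\<^sub>C x) = c *\<^sub>C dsum I K S x"
      using x y bounded_opsD(2)[OF S] HS_in
      by (auto simp: dsum_def fun_eq_iff scaleC_fun_def clinear_on_def)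
  qed
  moreover have "hnorm HS (dsum I K S x) \<le> B * hnorm HS x" if x: "x \<in> hcarrier HS" for x
  proof -
    have "(\<Sum>\<^sub>\<infinity>i\<in>I. (hnorm (K i) (dsum I K S x i))\<^sup>2) = (\<Sum>\<^sub>\<infinity>i\<in>I. (hnorm (K i) (S i (x i)))\<^sup>2)"
      using x by (intro infsum_cong) (simp add: dsum_def)
    also have "\<dots> \<le> (\<Sum>\<^sub>\<infinity>i\<in>I. B\<^sup>2 * (hnorm (K i) (x i))\<^sup>2)"
      using le HS_in[OF x] by (intro infsum_mono sm[OF x] sm'[OF x]) auto
    also have "\<dots> = B\<^sup>2 * (\<Sum>\<^sub>\<infinity>i\<in>I. (hnorm (K i) (x i))\<^sup>2)" by (rule infsum_cmult_right')
    finally have "hnorm HS (dsum I K S x) \<le> sqrt (B\<^sup>2 * (\<Sum>\<^sub>\<infinity>i\<in>I. (hnorm (K i) (x i))\<^sup>2))"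
      unfolding HS_hnorm[OF in'[OF x]] by simp
    then show ?thesis using \<open>0 \<le> B\<close> by (simp add: HS_hnorm[OF x] real_sqrt_mult)
  qed
  ultimately show ?thesis
    unfolding bounded_ops_def using in' by (auto simp: dsum_def[of _ _ _ x for x])
qed

text \<open>The operators on the summands need a common bound B; for multipliers
  \<open>N_mop_le\<close> supplies one that does not depend on the summand.\<close>

lemma star_hom_dsum:
  assumes hom: "\<And>i. i \<in> I \<Longrightarrow> star_hom X (Bop (K i)) (\<Psi> i)"
    and star: "\<And>x. x \<in> sa_carrier X \<Longrightarrow> sa_star X x \<in> sa_carrier X"
    and bound: "\<And>x. x \<in> sa_carrier X \<Longrightarrow> \<exists>B\<ge>0. \<forall>i\<in>I. \<forall>v\<in>hcarrier (K i).
      hnorm (K i) (\<Psi> i x v) \<le> B * hnorm (K i) v"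
  shows "star_hom X (Bop HS) (\<lambda>x. dsum I K (\<lambda>i. \<Psi> i x))"
proof -
  have bop: "\<Psi> i x \<in> bounded_ops (K i)" if "i \<in> I" "x \<in> sa_carrier X" for i x
    using star_homD(1)[OF hom that(2)] that by (simp add: Bop_sel)
  have in': "dsum I K (\<lambda>i. \<Psi> i x) \<in> bounded_ops HS" if x: "x \<in> sa_carrier X" for x
  proof -
    obtain B where "0 \<le> B" "\<forall>i\<in>I. \<forall>v\<in>hcarrier (K i). hnorm (K i) (\<Psi> i x v) \<le> B * hnorm (K i) v"
      using bound[OF x] by blast
    then show ?thesis using bop[OF _ x] by (intro dsum_in[of _ B]) auto
  qed
  show ?thesis
    unfolding star_hom_def Bop_sel
  proof (intro conjI ballI allI)
    fix x y c assume x: "x \<in> sa_carrier X" and y: "y \<in> sa_carrier X"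
    show "dsum I K (\<lambda>i. \<Psi> i x) \<in> bounded_ops HS" by (rule in'[OF x])
    show "dsum I K (\<lambda>i. \<Psi> i (sa_add X x y)) = (\<lambda>z. dsum I K (\<lambda>i. \<Psi> i x) z + dsum I K (\<lambda>i. \<Psi> i y) z)"
      using star_homD(4)[OF hom x y] by (auto simp: dsum_def fun_eq_iff Bop_sel)
    show "dsum I K (\<lambda>i. \<Psi> i (sa_scale X c x)) = (\<lambda>z. c *\<^sub>C dsum I K (\<lambda>i. \<Psi> i x) z)"
      using star_homD(2)[OF hom x] by (auto simp: dsum_def fun_eq_iff Bop_sel scaleC_fun_def)
    show "dsum I K (\<lambda>i. \<Psi> i (sa_mult X x y)) = (\<lambda>z. dsum I K (\<lambda>i. \<Psi> i x) (dsum I K (\<lambda>i. \<Psi> i y) z))"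
    proof
      fix z
      show "dsum I K (\<lambda>i. \<Psi> i (sa_mult X x y)) z = dsum I K (\<lambda>i. \<Psi> i x) (dsum I K (\<lambda>i. \<Psi> i y) z)"
      proof (cases "z \<in> hcarrier HS")
        case True
        then show ?thesis
          using bounded_opsD(1)[OF in'[OF y] True] star_homD(5)[OF hom x y]
          by (auto simp: dsum_def[of I K _ "dsum I K (\<lambda>i. \<Psi> i y) z"] fun_eq_iff Bop_sel)
            (auto simp: dsum_def Bop_sel star_homD(5)[OF hom x y])
      next
        case False
        then show ?thesis
          using clinear_on_zero[OF HS_csubspace bounded_opsD(2)[OF in'[OF x]]] by (simp add: dsum_def[of _ _ _ z])
      qed
    qed
    show "dsum I K (\<lambda>i. \<Psi> i (sa_star X x)) = hadjoint HS (dsum I K (\<lambda>i. \<Psi> i x))"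
    proof (rule hadjoint_eqI[symmetric, OF HS_separating in'[OF star[OF x]]])
      fix u v assume u: "u \<in> hcarrier HS" and v: "v \<in> hcarrier HS"
      have "hinner (K i) (\<Psi> i (sa_star X x) (u i)) (v i) = hinner (K i) (u i) (\<Psi> i x (v i))"
        if i: "i \<in> I" for i
        using hinner_hadjoint_left[OF hilb[OF i] bop[OF i x] HS_in[OF u i] HS_in[OF v i]]
          star_homD(3)[OF hom[OF i] x] by (simp add: Bop_sel)
      then show "hinner HS (dsum I K (\<lambda>i. \<Psi> i (sa_star X x)) u) v = hinner HS u (dsum I K (\<lambda>i. \<Psi> i x) v)"
        using u v by (simp add: hilb_sum_def[of I K] dsum_def cong: infsum_cong)
    qed
  qed
qed

end

text \<open>Uniqueness of the extension: \<pi>(d) \<Phi>(m) v = \<pi>(d m) v is the equation that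
  characterises \<open>mop\<close>.\<close>

lemma is_extension_mop:
  assumes H: "hilbert_space H" and B: "cstar_subalgebra B" and rep: "nondeg_rep B H \<pi>"
    and ext: "is_extension B (Bop H) \<pi> \<Phi>" and m: "m \<in> multipliers B" and v: "v \<in> hcarrier H"
  shows "\<Phi> m v = star_module.mop (hcarrier H) (hnorm' H) B \<pi> m v"
proof -
  have hom: "star_hom (Alg B) (Bop H) \<pi>" using rep by (simp add: nondeg_rep_def)
  interpret star_module "hcarrier H" "hinner H" "hnorm' H" B \<pi> by (rule star_module_rep[OF H B hom])
  have ess: "ess = hcarrier H" by (rule nondeg_rep_ess[OF H B rep])
  have "\<Phi> m \<in> bounded_ops H" by (rule is_extension_bounded_ops[OF ext m])
  then have "\<Phi> m v \<in> ess" using bounded_opsD(1) v ess by blast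
  moreover have "\<pi> d (\<Phi> m v) = \<pi> (snd m d) v" if "d \<in> B" for d
    using is_extension_mult(2)[OF ext B m that] by (simp add: Bop_sel fun_eq_iff)
  ultimately show ?thesis by (rule mop_eqI[symmetric])
qed

text \<open>The representation of \<open>L\<close> induced from a direct sum and the direct sum of
  the induced ones are compared on \<open>L\<close> only; this suffices since
  \<open>extension\<close> consults its argument on \<open>B\<close> alone.\<close>

lemma extension_cong:
  assumes "\<And>b. b \<in> B \<Longrightarrow> \<phi> b = \<psi> b" shows "extension B Y \<phi> = extension B Y \<psi>"
  unfolding extension_def using assms by simp

context hilb_family
begin

text \<open>The componentwise extensions add up to an extension, which settles existence. Conversely
  the components of the chosen extension satisfy the equations characterising \<open>mop\<close>, so
  it is the componentwise one.\<close>

lemma extension_sum: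
  assumes B: "cstar_subalgebra B" and rep: "\<And>i. i \<in> I \<Longrightarrow> nondeg_rep B (K i) (\<pi> i)"
  shows "is_extension B (Bop HS) (rep_sum I K \<pi>) (extension B (Bop HS) (rep_sum I K \<pi>))"
    and "m \<in> multipliers B \<Longrightarrow>
      extension B (Bop HS) (rep_sum I K \<pi>) m = dsum I K (\<lambda>i. extension B (Bop (K i)) (\<pi> i) m)"
proof -
  define \<Phi> where "\<Phi> i = extension B (Bop (K i)) (\<pi> i)" for i
  have \<Phi>: "is_extension B (Bop (K i)) (\<pi> i) (\<Phi> i)" if "i \<in> I" for i
    unfolding \<Phi>_def by (rule extension_Bop[OF hilb[OF that] B rep[OF that]])
  have \<Phi>_hom: "star_hom (Mult B) (Bop (K i)) (\<Phi> i)" and \<Phi>_emb: "\<And>b. b \<in> B \<Longrightarrow> \<Phi> i (mult_emb B b) = \<pi> i b"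
    if "i \<in> I" for i
    using \<Phi>[OF that] unfolding is_extension_def by auto
  have mod: "star_module (hcarrier (K i)) (hinner (K i)) (hnorm' (K i)) B (\<pi> i)" if "i \<in> I" for i
    using star_module_rep[OF hilb[OF that] B] rep[OF that] by (simp add: nondeg_rep_def)
  have ess: "star_module.ess (hcarrier (K i)) (hnorm' (K i)) B (\<pi> i) = hcarrier (K i)" if "i \<in> I" for i
    by (rule nondeg_rep_ess[OF hilb[OF that] B rep[OF that]])
  note \<Phi>_mop = is_extension_mop[OF hilb B rep \<Phi>]
  define \<Psi> where "\<Psi> m = dsum I K (\<lambda>i. \<Phi> i m)" for m
  have one_in: "mult_one B \<in> multipliers B"
    using cstar_sub_intros[OF B] unfolding multipliers_def mult_one_def bounded_clinear_on_def clinear_on_def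
    by (auto intro!: exI[of _ 1])
  have "star_hom (Mult B) (Bop HS) \<Psi>"
    unfolding \<Psi>_def
  proof (rule star_hom_dsum[OF \<Phi>_hom])
    show "sa_star (Mult B) m \<in> sa_carrier (Mult B)" if "m \<in> sa_carrier (Mult B)" for m
      using that multiplier_star_in[OF B] by (simp add: Mult_sel)
    fix m assume "m \<in> sa_carrier (Mult B)"
    then have m: "m \<in> multipliers B" by (simp add: Mult_sel)
    obtain C where C: "0 \<le> C" "\<forall>b\<in>B. norm (snd m b) \<le> C * norm b"
      using multiplier_snd_bound[OF m] .
    have "hnorm (K i) (\<Phi> i m v) \<le> 2 * C * hnorm (K i) v" if i: "i \<in> I" and v: "v \<in> hcarrier (K i)" for i v
    proof -
      interpret star_module "hcarrier (K i)" "hinner (K i)" "hnorm' (K i)" B "\<pi> i" by (rule mod[OF i])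
      have "mop m v \<in> hcarrier (K i)" "hnorm' (K i) (mop m v) \<le> 2 * C * hnorm' (K i) v"
        using mop_in[OF m] N_mop_le[OF m] C v ess[OF i] by blast+
      then show ?thesis using v by (simp add: \<Phi>_mop[OF i i i m v] hnorm_eq[OF hilb[OF i]])
    qed
    then show "\<exists>B\<ge>0. \<forall>i\<in>I. \<forall>v\<in>hcarrier (K i). hnorm (K i) (\<Phi> i m v) \<le> B * hnorm (K i) v"
      using C(1) by (intro exI[of _ "2 * C"]) auto
  qed auto
  moreover have "\<Psi> (mult_one B) = hid HS"
  proof -
    have "\<Phi> i (mult_one B) v = v" if i: "i \<in> I" and v: "v \<in> hcarrier (K i)" for i v
      using star_module.mop_one[OF mod[OF i]] \<Phi>_mop[OF i i i one_in v] v ess[OF i] by simp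
    then show ?thesis using HS_in HS_off by (auto simp: \<Psi>_def dsum_def hid_def fun_eq_iff)
  qed
  then have "(\<lambda>x. \<Psi> (mult_one B) (y x)) = y" "(\<lambda>x. y (\<Psi> (mult_one B) x)) = y"
    if "y \<in> bounded_ops HS" for y
    using hid_comp[OF HS_csubspace that] by simp_all
  moreover have "\<Psi> (mult_emb B b) = rep_sum I K \<pi> b" if "b \<in> B" for b
    using \<Phi>_emb[OF _ that] by (simp add: \<Psi>_def rep_sum_eq_dsum dsum_def fun_eq_iff)
  ultimately have "is_extension B (Bop HS) (rep_sum I K \<pi>) \<Psi>"
    unfolding is_extension_def Bop_sel by simp
  then show ext: "is_extension B (Bop HS) (rep_sum I K \<pi>) (extension B (Bop HS) (rep_sum I K \<pi>))"
    by (rule is_extension_extension)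
  define \<Xi> where "\<Xi> = extension B (Bop HS) (rep_sum I K \<pi>)"
  show "extension B (Bop HS) (rep_sum I K \<pi>) m = dsum I K (\<lambda>i. extension B (Bop (K i)) (\<pi> i) m)"
    if m: "m \<in> multipliers B"
    unfolding \<Xi>_def[symmetric] \<Phi>_def[symmetric]
  proof
    fix x
    have \<Xi>_bop: "\<Xi> m \<in> bounded_ops HS"
      unfolding \<Xi>_def by (rule is_extension_bounded_ops[OF ext m])
    show "\<Xi> m x = dsum I K (\<lambda>i. \<Phi> i m) x"
    proof (cases "x \<in> hcarrier HS")
      case x: True
      have \<Xi>x: "\<Xi> m x \<in> hcarrier HS" using bounded_opsD(1)[OF \<Xi>_bop x] .
      have "\<Xi> m x i = \<Phi> i m (x i)" if i: "i \<in> I" for i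
        unfolding \<Phi>_mop[OF i i i m HS_in[OF x i]]
      proof (rule star_module.mop_eqI[OF mod[OF i], symmetric])
        show "\<Xi> m x i \<in> star_module.ess (hcarrier (K i)) (hnorm' (K i)) B (\<pi> i)"
          using HS_in[OF \<Xi>x i] ess[OF i] by simp
        fix d assume d: "d \<in> B"
        have "rep_sum I K \<pi> d (\<Xi> m x) = rep_sum I K \<pi> (snd m d) x"
          using is_extension_mult(2)[OF ext B m d] by (simp add: Bop_sel fun_eq_iff \<Xi>_def)
        then show "\<pi> i d (\<Xi> m x i) = \<pi> i (snd m d) (x i)"
          using x \<Xi>x i by (auto simp: rep_sum_def fun_eq_iff split: if_splits)
      qed
      then show ?thesis using x HS_off[OF \<Xi>x] by (auto simp: dsum_def fun_eq_iff)
    next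
      case False
      then show ?thesis using bounded_opsD(3)[OF \<Xi>_bop] by (simp add: dsum_def)
    qed
  qed
qed

end

text \<open>Certifies the choices made inside (CP3'). \<open>extension_sum\<close> is used for the
  GNS representations of \<open>C\<close> and again for the representations of \<open>L\<close>
  induced from them, which are non-degenerate on each summand because the index set keeps only
  L-representations.\<close>

lemma universal_L_rep_extensions:
  assumes u: "universal_L_rep L C \<eta>L H \<rho>" and L: "cstar_subalgebra L" and C: "cstar_subalgebra C"
    and hom: "star_hom (Alg L) (Mult C) \<eta>L"
  shows "is_extension C (Bop H) \<rho> (extension C (Bop H) \<rho>)"
    and "is_extension L (Bop H) (induced_rep C \<eta>L H \<rho>)
      (extension L (Bop H) (induced_rep C \<eta>L H \<rho>))"
proof -
  obtain K \<pi> \<Omega> where gns: "\<And>\<phi>. state C \<phi> \<Longrightarrow> gns_triple C \<phi> (K \<phi>) (\<pi> \<phi>) (\<Omega> \<phi>)"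
    and H\<rho>: "H = hilb_sum {\<phi>. state C \<phi> \<and> L_representation L C \<eta>L (K \<phi>) (\<pi> \<phi>)} K"
      "\<rho> = rep_sum {\<phi>. state C \<phi> \<and> L_representation L C \<eta>L (K \<phi>) (\<pi> \<phi>)} K \<pi>"
    using u unfolding universal_L_rep_def Let_def by blast
  define I where "I = {\<phi>. state C \<phi> \<and> L_representation L C \<eta>L (K \<phi>) (\<pi> \<phi>)}"
  note H\<rho> = H\<rho>[folded I_def]
  interpret hilb_family I K
    using gns by unfold_locales (auto simp: I_def gns_triple_def)
  have rep: "nondeg_rep C (K \<phi>) (\<pi> \<phi>)" "nondeg_rep L (K \<phi>) (induced_rep C \<eta>L (K \<phi>) (\<pi> \<phi>))"
    if "\<phi> \<in> I" for \<phi>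
    using that by (auto simp: I_def L_representation_def)
  show "is_extension C (Bop H) \<rho> (extension C (Bop H) \<rho>)"
    unfolding H\<rho> by (rule extension_sum(1)[OF C rep(1)])
  have eq: "induced_rep C \<eta>L H \<rho> l = rep_sum I K (\<lambda>\<phi>. induced_rep C \<eta>L (K \<phi>) (\<pi> \<phi>)) l"
    if "l \<in> L" for l
  proof -
    have "\<eta>L l \<in> multipliers C" using star_homD(1)[OF hom] that by (simp add: Alg_sel Mult_sel)
    from extension_sum(2)[OF C rep(1) this] show ?thesis
      by (simp add: induced_rep_def H\<rho> rep_sum_eq_dsum)
  qed
  have "is_extension L (Bop H) (rep_sum I K (\<lambda>\<phi>. induced_rep C \<eta>L (K \<phi>) (\<pi> \<phi>)))
      (extension L (Bop H) (rep_sum I K (\<lambda>\<phi>. induced_rep C \<eta>L (K \<phi>) (\<pi> \<phi>))))"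
    unfolding H\<rho> by (rule extension_sum(1)[OF L rep(2)])
  then show "is_extension L (Bop H) (induced_rep C \<eta>L H \<rho>)
      (extension L (Bop H) (induced_rep C \<eta>L H \<rho>))"
    using eq extension_cong[of L _ _ "Bop H", OF eq] unfolding is_extension_def by simp
qed

text \<open>
  The condition (CP3') in a form that mentions only \<open>C\<close>: on vectors \<open>l c\<close> the unitary
  \<open>U(g)\<close> acts by \<open>l c \<mapsto> (\<eta>(g) l) c\<close>.
\<close>

lemma CP3'_covariance:
  assumes CP3': "CP3' A L \<eta> \<alpha> C \<eta>A \<eta>L" and L: "cstar_subalgebra L" and C: "cstar_subalgebra C"
    and homL: "star_hom (Alg L) (Mult C) \<eta>L" and homA: "star_hom (Alg A) (Mult C) \<eta>A"
    and \<eta>: "\<eta> g \<in> multipliers L" and a: "a \<in> A" "\<alpha> g a \<in> A"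
    and lc: "l \<in> L" "c \<in> C" "l' \<in> L" "c' \<in> C"
    and eq: "fst (\<eta>A a) (fst (\<eta>L (fst (sa_star (Mult L) (\<eta> g)) l)) c) = fst (\<eta>L l') c'"
  shows "fst (\<eta>A (\<alpha> g a)) (fst (\<eta>L l) c) = fst (\<eta>L (fst (\<eta> g) l')) c'"
proof -
  obtain H \<rho> where u: "universal_L_rep L C \<eta>L H \<rho>" and inj: "inj_on \<rho> C"
    and cov: "\<And>g a. a \<in> A \<Longrightarrow> sa_mult (Bop H)
          (sa_mult (Bop H) (eta_star L \<eta> H (induced_rep C \<eta>L H \<rho>) g) (induced_rep C \<eta>A H \<rho> a))
          (sa_star (Bop H) (eta_star L \<eta> H (induced_rep C \<eta>L H \<rho>) g))
        = induced_rep C \<eta>A H \<rho> (\<alpha> g a)"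
    using CP3' unfolding CP3'_def by blast
  note ext = universal_L_rep_extensions[OF u L C homL]
  define \<Theta> where "\<Theta> = extension C (Bop H) \<rho>"
  define \<pi>L where "\<pi>L = induced_rep C \<eta>L H \<rho>"
  define U where "U = extension L (Bop H) \<pi>L"
  have U: "is_extension L (Bop H) \<pi>L U" and \<Theta>: "is_extension C (Bop H) \<rho> \<Theta>"
    using ext by (auto simp: \<Theta>_def U_def \<pi>L_def)
  have U_hom: "star_hom (Mult L) (Bop H) U" using U by (simp add: is_extension_def)
  define h where "h = sa_star (Mult L) (\<eta> g)"
  have h: "h \<in> multipliers L" unfolding h_def by (rule multiplier_star_in[OF L \<eta>])
  have mL: "\<eta>L k \<in> multipliers C" if "k \<in> L" for k
    using star_homD(1)[OF homL] that by (simp add: Alg_sel Mult_sel)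
  have mA: "\<eta>A b \<in> multipliers C" if "b \<in> A" for b
    using star_homD(1)[OF homA] that by (simp add: Alg_sel Mult_sel)
  have \<rho>L: "\<pi>L k (\<rho> d x) = \<rho> (fst (\<eta>L k) d) x" if "k \<in> L" "d \<in> C" for k d x
    using is_extension_mult(1)[OF \<Theta> C mL[OF that(1)] that(2)]
    by (simp add: Bop_sel fun_eq_iff \<pi>L_def induced_rep_def \<Theta>_def)
  have \<rho>A: "\<Theta> (\<eta>A b) (\<rho> d x) = \<rho> (fst (\<eta>A b) d) x" if "b \<in> A" "d \<in> C" for b d x
    using is_extension_mult(1)[OF \<Theta> C mA[OF that(1)] that(2)] by (simp add: Bop_sel fun_eq_iff)
  have U\<pi>: "U m (\<pi>L k x) = \<pi>L (fst m k) x" if "m \<in> multipliers L" "k \<in> L" for m k x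
    using is_extension_mult(1)[OF U L that] by (simp add: Bop_sel fun_eq_iff)
  have "U h = hadjoint H (U (\<eta> g))"
    using star_homD(3)[OF U_hom, of "\<eta> g"] \<eta> by (simp add: h_def Mult_sel(1) Bop_sel)
  moreover have "(\<lambda>x. U (\<eta> g) (\<Theta> (\<eta>A a) (hadjoint H (U (\<eta> g)) x))) = \<Theta> (\<eta>A (\<alpha> g a))"
    using cov[OF a(1), of g]
    by (simp add: Bop_sel eta_star_def induced_rep_def[of C \<eta>A] \<Theta>_def U_def \<pi>L_def)
  ultimately have cov': "\<Theta> (\<eta>A (\<alpha> g a)) x = U (\<eta> g) (\<Theta> (\<eta>A a) (U h x))" for x by metis
  note in_L = lc(1,3) multiplier_fst_in[OF h lc(1)] multiplier_fst_in[OF \<eta> lc(3)]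
  note in_C = multiplier_fst_in[OF mL[OF in_L(1)] lc(2)] multiplier_fst_in[OF mL[OF in_L(3)] lc(2)]
    multiplier_fst_in[OF mL[OF in_L(4)] lc(4)]
  \<comment> \<open>\<open>\<rho>\<close> turns the actions of \<open>L\<close>, of \<open>A\<close>
    and of multipliers of \<open>L\<close> into the operators \<open>\<pi>L\<close>,
    \<open>\<Theta>\<close> and \<open>U\<close>, so (CP3') is evaluated on vectors
    \<open>\<rho> d x\<close> and pulled back to \<open>C\<close> by injectivity.\<close>
  have "\<rho> (fst (\<eta>A (\<alpha> g a)) (fst (\<eta>L l) c)) x = \<rho> (fst (\<eta>L (fst (\<eta> g) l')) c') x" for x
  proof -
    have "\<rho> (fst (\<eta>A (\<alpha> g a)) (fst (\<eta>L l) c)) x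
        = U (\<eta> g) (\<Theta> (\<eta>A a) (U h (\<pi>L l (\<rho> c x))))"
      using \<rho>A[OF a(2) in_C(1)] \<rho>L[OF lc(1,2)] cov' by metis
    also have "\<dots> = U (\<eta> g) (\<rho> (fst (\<eta>L l') c') x)"
      using U\<pi>[OF h lc(1)] \<rho>L[OF in_L(3) lc(2)] \<rho>A[OF a(1) in_C(2)] eq
      by (simp add: h_def)
    also have "\<dots> = \<rho> (fst (\<eta>L (fst (\<eta> g) l')) c') x"
      using U\<pi>[OF \<eta> lc(3)] \<rho>L[OF lc(3,4)] \<rho>L[OF in_L(4) lc(4)] by metis
    finally show ?thesis .
  qed
  then show ?thesis
    using inj_onD[OF inj _ multiplier_fst_in[OF mA[OF a(2)] in_C(1)] in_C(3)] by blast
qed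

section \<open>The restricted triple\<close>

text \<open>Cohen's theorem for \<open>B\<close> acting on itself, where approximate units make
  every element essential.\<close>

lemma cstar_factorization:
  assumes B: "cstar_subalgebra B" and b: "b \<in> B"
  obtains c d where "c \<in> B" "d \<in> B" "b = c * d"
proof -
  interpret star_module B "\<lambda>x y. star x * y" norm B "(*)" by (rule star_module_self[OF B])
  have "b \<in> ess" using b appr_left[OF B b] unfolding ess_def by blast
  then show ?thesis using cohen_factorization ess_in that by metis
qed

text \<open>This is the associativity m (c n) = (m c) n. Multiplied by a from the left, both sides
  become (a m) c n.\<close>

lemma multiplier_commute:
  assumes C: "cstar_subalgebra C" and m: "m \<in> multipliers C" and n: "n \<in> multipliers C" and c: "c \<in> C"
  shows "fst m (snd n c) = snd n (fst m c)"
proof -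
  have in_C: "fst m (snd n c) \<in> C" "snd n (fst m c) \<in> C"
    using multiplier_fst_in[OF m] multiplier_snd_in[OF n] c by auto
  have "a * fst m (snd n c) = a * snd n (fst m c)" if a: "a \<in> C" for a
  proof -
    have "a * fst m (snd n c) = snd m a * snd n c"
      using multiplier_central[OF m a multiplier_snd_in[OF n c]] by simp
    also have "\<dots> = snd n (snd m a * c)"
      using multiplier_snd_mult[OF n multiplier_snd_in[OF m a] c] by simp
    also have "\<dots> = a * snd n (fst m c)"
      using multiplier_central[OF m a c] multiplier_snd_mult[OF n a multiplier_fst_in[OF m c]] by simp
    finally show ?thesis .
  qed
  then have "star (fst m (snd n c) - snd n (fst m c)) * (fst m (snd n c) - snd n (fst m c)) = 0"
    using in_C cstar_sub_intros[OF C] by (simp add: right_diff_distrib)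
  then show ?thesis using star_mult_self_eq_0 by force
qed

lemma multiplier_mult_in:
  assumes m: "m \<in> multipliers B" and n: "n \<in> multipliers B" and B: "cstar_subalgebra B"
  shows "sa_mult (Mult B) m n \<in> multipliers B"
proof -
  have comp: "bounded_clinear_on B (\<lambda>b. f (h b))"
    if f: "bounded_clinear_on B f" and h: "bounded_clinear_on B h" for f h
  proof -
    obtain K K' where K: "\<forall>b\<in>B. norm (f b) \<le> K * norm b" "\<forall>b\<in>B. norm (h b) \<le> K' * norm b"
      using f h unfolding bounded_clinear_on_def by auto
    have "norm (f (h b)) \<le> (\<bar>K\<bar> * K') * norm b" if "b \<in> B" for b
    proof -
      have hb: "h b \<in> B" using h that unfolding bounded_clinear_on_def by blast
      have "norm (f (h b)) \<le> K * norm (h b)" using K(1) hb by blast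
      also have "\<dots> \<le> \<bar>K\<bar> * norm (h b)" by (intro mult_right_mono) auto
      also have "\<dots> \<le> \<bar>K\<bar> * (K' * norm b)" using K(2) that by (intro mult_left_mono) auto
      finally show ?thesis by (simp add: mult.assoc)
    qed
    then show ?thesis
      using f h unfolding bounded_clinear_on_def clinear_on_def by (auto intro!: exI[of _ "\<bar>K\<bar> * K'"])
  qed
  have "bounded_clinear_on B (fst m)" "bounded_clinear_on B (snd m)"
    "bounded_clinear_on B (fst n)" "bounded_clinear_on B (snd n)"
    using m n by (auto simp: multipliers_def)
  moreover have "snd n (snd m a) * b = a * fst m (fst n b)" if "a \<in> B" "b \<in> B" for a b
    using multiplier_central[OF n multiplier_snd_in[OF m that(1)] that(2)]
      multiplier_central[OF m that(1) multiplier_fst_in[OF n that(2)]] by simp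
  ultimately show ?thesis
    using comp multiplier_fst_mult[OF m] multiplier_fst_mult[OF n] multiplier_snd_mult[OF m]
      multiplier_snd_mult[OF n] multiplier_fst_in[OF n] multiplier_snd_in[OF m]
      multiplier_off[OF m] multiplier_off[OF n] multiplier_zero[OF B m] multiplier_zero[OF B n]
    unfolding multipliers_def Mult_def by simp
qed

lemma multiplier_tendsto:
  assumes C: "cstar_subalgebra C" and m: "m \<in> multipliers C"
    and X: "\<And>n. X n \<in> C" "X \<longlonglongrightarrow> x"
  shows "(\<lambda>n. fst m (X n)) \<longlonglongrightarrow> fst m x"
proof -
  have x: "x \<in> C" by (rule closed_sequentially[OF cstar_sub_closed[OF C] X])
  obtain K where K: "\<And>b. b \<in> C \<Longrightarrow> norm (fst m b) \<le> K * norm b"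
    using multiplier_fst_bounded[OF m] by blast
  have "(\<lambda>n. X n - x) \<longlonglongrightarrow> 0" using X(2) by (rule LIM_zero)
  then have "(\<lambda>n. fst m (X n) - fst m x) \<longlonglongrightarrow> 0"
  proof (rule tendsto_0_le)
    have "norm (fst m (X n) - fst m x) \<le> norm (X n - x) * K" for n
      using K[of "X n - x"] cstar_sub_diff[OF C X(1) x]
        clinear_on_diff[OF cstar_sub_csubspace[OF C] multiplier_fst_linear[OF m] X(1) x]
      by (simp add: mult.commute)
    then show "\<forall>\<^sub>F n in sequentially. norm (fst m (X n) - fst m x) \<le> norm (X n - x) * K" by simp
  qed
  then show ?thesis by (rule LIM_zero_cancel)
qed

lemma closed_ess:
  assumes mod: "star_module V ip norm L T" and V: "closed V"
  shows "closed (star_module.ess V norm L T)"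
proof -
  interpret star_module V ip norm L T by (rule mod)
  have "x \<in> ess" if x: "x \<in> closure ess" for x
  proof (rule ess_limit)
    show "x \<in> V" using x closure_minimal[of ess V] V ess_in by auto
    show "\<exists>y\<in>ess. norm (x - y) < \<epsilon>" if "\<epsilon> > 0" for \<epsilon>
      using x that unfolding closure_approachable by (metis dist_norm norm_minus_commute)
  qed
  then show ?thesis using closure_subset by (metis closure_closed subsetI subset_antisym closed_closure)
qed

lemma mult_restrict_in:
  assumes D: "D \<subseteq> C" "cstar_subalgebra D" and m: "m \<in> multipliers C"
    and inv: "\<And>d. d \<in> D \<Longrightarrow> fst m d \<in> D" "\<And>d. d \<in> D \<Longrightarrow> snd m d \<in> D"
  shows "mult_restrict D m \<in> multipliers D"
proof -
  have lin: "bounded_clinear_on D (\<lambda>b. if b \<in> D then f b else 0)"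
    if f: "clinear_on C f" "\<exists>K. \<forall>b\<in>C. norm (f b) \<le> K * norm b" "\<And>d. d \<in> D \<Longrightarrow> f d \<in> D" for f
  proof -
    obtain K where "\<forall>b\<in>D. norm (f b) \<le> K * norm b" using f(2) D(1) by blast
    then show ?thesis
      using f(1,3) D(1) cstar_sub_add[OF D(2)] cstar_sub_scaleC[OF D(2)]
      unfolding bounded_clinear_on_def clinear_on_def by (auto simp: subset_iff)
  qed
  show ?thesis
    using lin[OF multiplier_fst_linear[OF m] multiplier_fst_bounded[OF m] inv(1)]
      lin[OF multiplier_snd_linear[OF m] multiplier_snd_bounded[OF m] inv(2)]
      multiplier_fst_mult[OF m] multiplier_snd_mult[OF m] multiplier_central[OF m]
      cstar_sub_mult[OF D(2)] D(1)
    unfolding multipliers_def mult_restrict_def by (auto simp: subset_iff)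
qed

lemma eta_vee_apply:
  "d \<in> D \<Longrightarrow> fst (eta_vee D \<eta>X x) d = fst (\<eta>X x) d"
  "d \<in> D \<Longrightarrow> snd (eta_vee D \<eta>X x) d = snd (\<eta>X x) d"
  by (simp_all add: eta_vee_def mult_restrict_def)

lemma star_hom_eta_vee:
  assumes D: "D \<subseteq> C" "cstar_subalgebra D" and hom: "star_hom (Alg B) (Mult C) \<phi>" and B': "B' \<subseteq> B"
    and inv: "\<And>b d. b \<in> B' \<Longrightarrow> d \<in> D \<Longrightarrow> fst (\<phi> b) d \<in> D" "\<And>b d. b \<in> B' \<Longrightarrow> d \<in> D \<Longrightarrow> snd (\<phi> b) d \<in> D"
  shows "star_hom (Alg B') (Mult D) (eta_vee D \<phi>)"
proof -
  have m: "\<phi> b \<in> multipliers C" if "b \<in> B'" for b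
    using star_homD(1)[OF hom] B' that by (auto simp: Alg_sel Mult_sel)
  have zero: "fst (\<phi> b) 0 = 0" "snd (\<phi> b) 0 = 0" if "b \<in> B'" for b
    using clinear_on_zero[OF cstar_sub_csubspace[OF D(2)], of "fst (\<phi> b)"]
      clinear_on_zero[OF cstar_sub_csubspace[OF D(2)], of "snd (\<phi> b)"]
      multiplier_fst_linear[OF m[OF that]] multiplier_snd_linear[OF m[OF that]] D(1)
    by (auto simp: clinear_on_def subset_iff)
  \<comment> \<open>Restricted multipliers are 0 off \<open>D\<close>, so the clause for the adjoint
    compares membership of b with that of \<open>star b\<close>.\<close>
  have sD: "star b \<in> D \<longleftrightarrow> b \<in> D" for b using cstar_sub_star[OF D(2)] by (metis star_star)
  show ?thesis
    unfolding star_hom_def Alg_sel Mult_sel(1)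
  proof (intro conjI ballI allI)
    fix x y c assume x: "x \<in> B'" and y: "y \<in> B'"
    have xy: "x \<in> B" "y \<in> B" using x y B' by auto
    show "eta_vee D \<phi> x \<in> multipliers D"
      unfolding eta_vee_def by (rule mult_restrict_in[OF D m[OF x] inv(1)[OF x] inv(2)[OF x]])
    show "eta_vee D \<phi> (x + y) = sa_add (Mult D) (eta_vee D \<phi> x) (eta_vee D \<phi> y)"
      using star_homD(4)[OF hom, of x y] xy
      by (auto simp: eta_vee_def mult_restrict_def Mult_def Alg_sel fun_eq_iff)
    show "eta_vee D \<phi> (c *\<^sub>C x) = sa_scale (Mult D) c (eta_vee D \<phi> x)"
      using star_homD(2)[OF hom, of x c] xy
      by (auto simp: eta_vee_def mult_restrict_def Mult_def Alg_sel fun_eq_iff)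
    show "eta_vee D \<phi> (x * y) = sa_mult (Mult D) (eta_vee D \<phi> x) (eta_vee D \<phi> y)"
      using star_homD(5)[OF hom, of x y] xy inv(1)[OF y] inv(2)[OF x] zero x y
      by (auto simp: eta_vee_def mult_restrict_def Mult_def Alg_sel fun_eq_iff)
    show "eta_vee D \<phi> (star x) = sa_star (Mult D) (eta_vee D \<phi> x)"
      using star_homD(3)[OF hom, of x] xy
      by (auto simp: eta_vee_def mult_restrict_def Mult_def Alg_sel fun_eq_iff sD)
  qed
qed

text \<open>Collects what concerns the algebras alone; the group, its action and (CP3') enter in the
  final theorem.\<close>

locale cp_triple =
  fixes A :: "'a::cstar_algebra set" and L :: "'l::cstar_algebra set" and C :: "'c::cstar_algebra set"
    and \<eta>A :: "'a \<Rightarrow> 'c multiplier" and \<eta>L :: "'l \<Rightarrow> 'c multiplier"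
  assumes A_sub: "cstar_subalgebra A" and Lsub: "cstar_subalgebra L" and C_sub: "cstar_subalgebra C"
    and CP1: "CP1 A L C \<eta>A \<eta>L" and CP4: "CP4 A L C \<eta>A \<eta>L"
begin

lemma homA: "star_hom (Alg A) (Mult C) \<eta>A" and homL: "star_hom (Alg L) (Mult C) \<eta>L"
  using CP1 by (auto simp: CP1_def)

abbreviation "CL \<equiv> C_restr L C \<eta>L"
abbreviation "AL \<equiv> A_restr A L C \<eta>A \<eta>L"
abbreviation "D \<equiv> C_vee A L C \<eta>A \<eta>L"
abbreviation "lact l \<equiv> fst (\<eta>L l)"
abbreviation "aact a \<equiv> fst (\<eta>A a)"

lemma mL: "l \<in> L \<Longrightarrow> \<eta>L l \<in> multipliers C"
  using star_homD(1)[OF homL] by (simp add: Alg_sel Mult_sel)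

lemma mA: "a \<in> A \<Longrightarrow> \<eta>A a \<in> multipliers C"
  using star_homD(1)[OF homA] by (simp add: Alg_sel Mult_sel)

lemma star_fst_L: "l \<in> L \<Longrightarrow> star (fst (\<eta>L l) c) = snd (\<eta>L (star l)) (star c)"
  using star_homD(3)[OF homL, of l] by (simp add: Alg_sel Mult_sel star_star)

lemma star_snd_L: "l \<in> L \<Longrightarrow> star (snd (\<eta>L l) c) = fst (\<eta>L (star l)) (star c)"
  using star_homD(3)[OF homL, of l] by (simp add: Alg_sel Mult_sel star_star)

lemma star_fst_A: "a \<in> A \<Longrightarrow> star (fst (\<eta>A a) c) = snd (\<eta>A (star a)) (star c)"
  using star_homD(3)[OF homA, of a] by (simp add: Alg_sel Mult_sel star_star)

lemma star_snd_A: "a \<in> A \<Longrightarrow> star (snd (\<eta>A a) c) = fst (\<eta>A (star a)) (star c)"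
  using star_homD(3)[OF homA, of a] by (simp add: Alg_sel Mult_sel star_star)

sublocale M: star_module C "\<lambda>x y. star x * y" norm L "\<lambda>l. fst (\<eta>L l)"
  by (rule star_module_Mult_self[OF C_sub Lsub homL])

sublocale MA: star_module C "\<lambda>x y. star x * y" norm A "\<lambda>a. fst (\<eta>A a)"
  by (rule star_module_Mult_self[OF C_sub A_sub homA])

text \<open>The left ideal C L, adjoint to L C. As a module over \<open>L\<close> it has L C L as
  its essential part.\<close>

definition R :: "'c set" where "R = {snd (\<eta>L l) c | l c. l \<in> L \<and> c \<in> C}"

lemma R_iff: "x \<in> R \<longleftrightarrow> star x \<in> M.ess"
proof
  assume "x \<in> R"
  then show "star x \<in> M.ess"
    using M.T_in_ess cstar_sub_star[OF Lsub] cstar_sub_star[OF C_sub] star_snd_L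
    by (auto simp: R_def)
next
  assume "star x \<in> M.ess"
  then obtain l c where "l \<in> L" "c \<in> C" "star x = lact l c" unfolding M.ess_eq by blast
  then have "x = snd (\<eta>L (star l)) (star c)" using star_fst_L by (metis star_star)
  then show "x \<in> R"
    using \<open>l \<in> L\<close> \<open>c \<in> C\<close> cstar_sub_star[OF Lsub] cstar_sub_star[OF C_sub] unfolding R_def by blast
qed

lemma R_in: "x \<in> R \<Longrightarrow> x \<in> C"
  unfolding R_def using multiplier_snd_in[OF mL] by blast

lemma R_csubspace: "csubspace R"
  using M.ess_csubspace by (auto simp: csubspace_iff R_iff star_add star_scaleC)

lemma R_closed: "closed R"
  unfolding closed_sequential_limits
proof (intro allI impI)
  fix X x assume X: "(\<forall>n. X n \<in> R) \<and> X \<longlonglongrightarrow> x"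
  have cl: "closed M.ess" by (rule closed_ess[OF M.star_module_axioms cstar_sub_closed[OF C_sub]])
  have "\<And>n. star (X n) \<in> M.ess" using X R_iff by blast
  moreover have "(\<lambda>n. star (X n)) \<longlonglongrightarrow> star x" using X by (intro tendsto_star) simp
  ultimately have "star x \<in> M.ess" by (rule closed_sequentially[OF cl])
  then show "x \<in> R" by (simp add: R_iff)
qed

lemma R_lact: assumes "l \<in> L" "x \<in> R" shows "lact l x \<in> R"
proof -
  obtain k c where kc: "k \<in> L" "c \<in> C" "x = snd (\<eta>L k) c" using assms(2) by (auto simp: R_def)
  then have "lact l x = snd (\<eta>L k) (lact l c)"
    using multiplier_commute[OF C_sub mL mL] assms(1) by simp
  then show ?thesis using kc multiplier_fst_in[OF mL[OF assms(1)]] unfolding R_def by blast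
qed

sublocale MR: star_module R "\<lambda>x y. star x * y" norm L "\<lambda>l. fst (\<eta>L l)"
  using R_in by (intro star_module_Mult[OF C_sub Lsub homL R_closed R_csubspace] R_lact) auto

text \<open>By \<open>ess_eq\<close>, hence by Cohen's theorem, the mere set of products L (C L) is
  an essential part; closedness and closure under sums come with that.\<close>

lemma CL_eq: "CL = MR.ess"
  unfolding MR.ess_eq unfolding C_restr_def R_def by blast

lemma CL_in_ess: "x \<in> CL \<Longrightarrow> x \<in> M.ess"
  unfolding CL_eq MR.ess_eq using M.T_in_ess R_in by auto

lemma CL_in: "x \<in> CL \<Longrightarrow> x \<in> C"
  using CL_in_ess M.ess_in by blast

lemma CL_closed: "closed CL"
  unfolding CL_eq by (rule closed_ess[OF MR.star_module_axioms R_closed])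

lemma AL_iff: "a \<in> AL \<longleftrightarrow> a \<in> A \<and> (\<forall>x\<in>CL. aact a x \<in> CL \<and> aact (star a) x \<in> CL)"
  by (simp add: A_restr_def)

lemma AL_in: "a \<in> AL \<Longrightarrow> a \<in> A"
  by (simp add: AL_iff)

text \<open>Closedness is inherited from C_L, as a \<mapsto> a x is norm continuous for fixed
  x.\<close>

lemma AL_sub: "cstar_subalgebra AL"
proof -
  note sA = cstar_sub_star[OF A_sub]
  have CL_add: "x + y \<in> CL" and CL_scale: "c *\<^sub>C x \<in> CL" and CL_zero: "0 \<in> CL"
    if "x \<in> CL" "y \<in> CL" for x y c
    using that MR.ess_csubspace unfolding CL_eq csubspace_iff by auto
  have lim: "aact a x \<in> CL"
    if X: "\<And>n. X n \<in> A" "\<And>n. aact (X n) x \<in> CL" "X \<longlonglongrightarrow> a" "a \<in> A" "x \<in> CL" for X a x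
  proof (rule closed_sequentially[OF CL_closed X(2)])
    have "(\<lambda>n. X n - a) \<longlonglongrightarrow> 0" using X(3) by (rule LIM_zero)
    then have "(\<lambda>n. aact (X n) x - aact a x) \<longlonglongrightarrow> 0"
    proof (rule tendsto_0_le)
      have "norm (aact (X n) x - aact a x) \<le> norm (X n - a) * norm x" for n
        using MA.N_T_le[OF cstar_sub_diff[OF A_sub X(1) X(4)] CL_in[OF X(5)], of n]
          MA.T_diff_left[OF X(1) X(4) CL_in[OF X(5)]] by simp
      then show "\<forall>\<^sub>F n in sequentially. norm (aact (X n) x - aact a x) \<le> norm (X n - a) * norm x"
        by simp
    qed
    then show "(\<lambda>n. aact (X n) x) \<longlonglongrightarrow> aact a x" by (rule LIM_zero_cancel)
  qed
  have "closed AL"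
    unfolding closed_sequential_limits
  proof (intro allI impI)
    fix X a assume X: "(\<forall>n. X n \<in> AL) \<and> X \<longlonglongrightarrow> a"
    have XA: "\<And>n. X n \<in> A" using X AL_in by blast
    have a: "a \<in> A" using X by (intro closed_sequentially[OF cstar_sub_closed[OF A_sub] XA]) auto
    have "aact a x \<in> CL" "aact (star a) x \<in> CL" if "x \<in> CL" for x
      using lim[of X x a] lim[of "\<lambda>n. star (X n)" x "star a"] X XA a that sA
      by (auto simp: AL_iff intro: tendsto_star)
    then show "a \<in> AL" using a by (simp add: AL_iff)
  qed
  moreover have "csubspace AL"
    unfolding csubspace_iff
  proof (intro conjI ballI allI)
    have "aact 0 x = 0" if "x \<in> C" for x
      using MA.T_scale_left[OF cstar_sub_zero[OF A_sub] that, of 0] by simp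
    then show "0 \<in> AL" using CL_zero CL_in cstar_sub_zero[OF A_sub] by (auto simp: AL_iff)
    fix a b c assume ab: "a \<in> AL" "b \<in> AL"
    then show "a + b \<in> AL"
      using CL_add CL_in sA cstar_sub_add[OF A_sub] by (auto simp: AL_iff star_add MA.T_add_left)
    show "c *\<^sub>C a \<in> AL"
      using ab CL_scale CL_in sA cstar_sub_scaleC[OF A_sub]
      by (auto simp: AL_iff star_scaleC MA.T_scale_left)
  qed
  moreover have "a * b \<in> AL" if "a \<in> AL" "b \<in> AL" for a b
    using that CL_in sA cstar_sub_mult[OF A_sub] by (auto simp: AL_iff star_mult MA.T_mult)
  moreover have "star a \<in> AL" if "a \<in> AL" for a using that sA by (auto simp: AL_iff star_star)
  ultimately show ?thesis unfolding cstar_subalgebra_def by blast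
qed

section \<open>The products a l and l a as elements of C\<close>

lemma C_eqI:
  assumes "x \<in> C" "y \<in> C" "\<And>b. b \<in> C \<Longrightarrow> x * b = y * b" shows "x = y"
proof -
  have "(x - y) * star (x - y) = 0"
    using assms cstar_sub_intros[OF C_sub] by (simp add: left_diff_distrib)
  then show ?thesis using norm_mult_star[of "x - y"] by simp
qed

text \<open>The element of \<open>C\<close> that embeds as the multiplier a l, whose existence is
  the first half of (CP4). The product in the other order, \<open>la\<close>, is obtained from it by
  taking adjoints.\<close>

definition al :: "'a \<Rightarrow> 'l \<Rightarrow> 'c" where
  "al a l = (SOME c. c \<in> C \<and> mult_emb C c = sa_mult (Mult C) (\<eta>A a) (\<eta>L l))"

definition la :: "'l \<Rightarrow> 'a \<Rightarrow> 'c" where "la l a = star (al (star a) (star l))"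

lemma
  assumes a: "a \<in> A" and l: "l \<in> L"
  shows al_in: "al a l \<in> C"
    and al_mult: "b \<in> C \<Longrightarrow> al a l * b = aact a (lact l b)"
    and mult_al: "b \<in> C \<Longrightarrow> b * al a l = snd (\<eta>L l) (snd (\<eta>A a) b)"
proof -
  have "sa_mult (Mult C) (\<eta>A a) (\<eta>L l) \<in> mult_emb C ` C"
    using CP4 a l unfolding CP4_def by blast
  then have "\<exists>c. c \<in> C \<and> mult_emb C c = sa_mult (Mult C) (\<eta>A a) (\<eta>L l)" by force
  from someI_ex[OF this] have *: "al a l \<in> C" "mult_emb C (al a l) = sa_mult (Mult C) (\<eta>A a) (\<eta>L l)"
    by (auto simp: al_def)
  show "al a l \<in> C" by (rule *)
  show "al a l * b = aact a (lact l b)" "b * al a l = snd (\<eta>L l) (snd (\<eta>A a) b)" if "b \<in> C"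
    using mult_emb_apply[OF that, of "al a l"] unfolding *(2) by (auto simp: Mult_sel)
qed

lemma star_la: "star (la l a) = al (star a) (star l)"
  by (simp add: la_def star_star)

lemma
  assumes a: "a \<in> A" and l: "l \<in> L"
  shows la_in: "la l a \<in> C"
    and la_mult: "b \<in> C \<Longrightarrow> la l a * b = lact l (aact a b)"
proof -
  have s: "star a \<in> A" "star l \<in> L" using a l cstar_sub_star[OF A_sub] cstar_sub_star[OF Lsub] by auto
  note sC = cstar_sub_star[OF C_sub]
  show "la l a \<in> C" unfolding la_def using al_in[OF s] sC by blast
  assume b: "b \<in> C"
  have "star (star b * al (star a) (star l)) = lact l (aact a b)"
    unfolding mult_al[OF s sC[OF b]] using s by (simp add: star_snd_L star_snd_A star_star)
  then show "la l a * b = lact l (aact a b)" by (simp add: la_def star_mult star_star)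
qed

lemma mult_emb_la:
  assumes a: "a \<in> A" and l: "l \<in> L"
  shows "mult_emb C (la l a) = sa_mult (Mult C) (\<eta>L l) (\<eta>A a)"
proof (rule multiplier_eqI[OF C_sub mult_emb_in[OF C_sub la_in[OF a l]] multiplier_mult_in[OF mL[OF l] mA[OF a] C_sub]])
  show "fst (mult_emb C (la l a)) b = fst (sa_mult (Mult C) (\<eta>L l) (\<eta>A a)) b" if "b \<in> C" for b
    using la_mult[OF a l that] that by (simp add: mult_emb_apply Mult_sel)
qed

lemma D_eq: "D = cstar_generated {la l a | l a. l \<in> L \<and> a \<in> AL}"
proof -
  have "{c\<in>C. \<exists>l\<in>L. \<exists>a\<in>AL. mult_emb C c = sa_mult (Mult C) (\<eta>L l) (\<eta>A a)}
      = {la l a | l a. l \<in> L \<and> a \<in> AL}"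
  proof (intro set_eqI iffI)
    fix c assume "c \<in> {c\<in>C. \<exists>l\<in>L. \<exists>a\<in>AL. mult_emb C c = sa_mult (Mult C) (\<eta>L l) (\<eta>A a)}"
    then obtain l a where *: "c \<in> C" "l \<in> L" "a \<in> AL" "mult_emb C c = mult_emb C (la l a)"
      using mult_emb_la AL_in by auto
    then have "c = la l a" using AL_in la_in by (intro mult_emb_inject[OF C_sub]) auto
    then show "c \<in> {la l a | l a. l \<in> L \<and> a \<in> AL}" using * by blast
  qed (use mult_emb_la AL_in la_in in blast)
  then show ?thesis by (simp add: C_vee_def)
qed

lemma lact_la: "l \<in> L \<Longrightarrow> k \<in> L \<Longrightarrow> a \<in> A \<Longrightarrow> lact k (la l a) = la (k * l) a"
  by (rule C_eqI)
    (simp_all add: la_in la_mult M.T_in MA.T_in M.T_mult cstar_sub_mult[OF Lsub]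
      flip: multiplier_fst_mult[OF mL] multiplier_fst_mult[OF mA])

lemma aact_al: "l \<in> L \<Longrightarrow> a \<in> A \<Longrightarrow> b \<in> A \<Longrightarrow> aact b (al a l) = al (b * a) l"
  by (rule C_eqI)
    (simp_all add: al_in al_mult M.T_in MA.T_in MA.T_mult cstar_sub_mult[OF A_sub]
      flip: multiplier_fst_mult[OF mL] multiplier_fst_mult[OF mA])

lemma lact_al: "l \<in> L \<Longrightarrow> k \<in> L \<Longrightarrow> a \<in> A \<Longrightarrow> b \<in> A \<Longrightarrow> lact l (al (a * b) k) = la l a * al b k"
  by (rule C_eqI)
    (simp_all add: al_in al_mult la_in la_mult M.T_in MA.T_in MA.T_mult cstar_sub_mult[OF A_sub]
      cstar_sub_mult[OF C_sub] mult.assoc flip: multiplier_fst_mult[OF mL] multiplier_fst_mult[OF mA])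

lemma aact_la: "l \<in> L \<Longrightarrow> k \<in> L \<Longrightarrow> a \<in> A \<Longrightarrow> b \<in> A \<Longrightarrow> aact a (la (l * k) b) = al a l * la k b"
  by (rule C_eqI)
    (simp_all add: al_in al_mult la_in la_mult M.T_in MA.T_in M.T_mult cstar_sub_mult[OF Lsub]
      cstar_sub_mult[OF C_sub] mult.assoc flip: multiplier_fst_mult[OF mL] multiplier_fst_mult[OF mA])

section \<open>L and A_L multiply C_vee into itself\<close>

lemma D_sub: "cstar_subalgebra D"
  unfolding D_eq by (rule cstar_subalgebra_generated)

lemma la_in_D: "l \<in> L \<Longrightarrow> a \<in> AL \<Longrightarrow> la l a \<in> D"
  unfolding D_eq by (rule subsetD[OF cstar_generated_superset]) blast

lemma al_in_D: assumes "l \<in> L" "a \<in> AL" shows "al a l \<in> D"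
proof -
  have "star (la (star l) (star a)) \<in> D"
    using assms by (intro cstar_sub_star[OF D_sub] la_in_D cstar_sub_star[OF Lsub] cstar_sub_star[OF AL_sub])
  then show ?thesis by (simp add: star_la star_star)
qed

lemma D_subset: "D \<subseteq> C"
  unfolding D_eq using la_in AL_in by (intro cstar_generated_minimal C_sub) auto

text \<open>The set P asks the same of d and of \<open>star d\<close> to be *-closed; products are
  no obstacle as m (x y) = (m x) y. In return the adjoint generators a l must be checked besides the
  generators l a.\<close>

lemma D_invariant:
  assumes m: "m \<in> multipliers C"
    and gen: "\<And>l a. l \<in> L \<Longrightarrow> a \<in> AL \<Longrightarrow> fst m (la l a) \<in> D"
      "\<And>l a. l \<in> L \<Longrightarrow> a \<in> AL \<Longrightarrow> fst m (al a l) \<in> D"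
    and d: "d \<in> D"
  shows "fst m d \<in> D"
proof -
  define P where "P = {d \<in> D. fst m d \<in> D \<and> fst m (star d) \<in> D}"
  note Ds = cstar_sub_intros[OF D_sub]
  have DC: "x \<in> C" if "x \<in> D" for x using that D_subset by blast
  have lin: "x \<in> C \<Longrightarrow> y \<in> C \<Longrightarrow> fst m (x + y) = fst m x + fst m y"
    "x \<in> C \<Longrightarrow> fst m (c *\<^sub>C x) = c *\<^sub>C fst m x" for x y c
    using multiplier_fst_linear[OF m] by (auto simp: clinear_on_def)
  have "closed P"
    unfolding closed_sequential_limits
  proof (intro allI impI)
    fix X x assume X: "(\<forall>n. X n \<in> P) \<and> X \<longlonglongrightarrow> x"
    note clD = closed_sequentially[OF cstar_sub_closed[OF D_sub]]
    have XD: "X n \<in> D" "fst m (X n) \<in> D" "fst m (star (X n)) \<in> D" for n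
      using X unfolding P_def by blast+
    have lim: "X \<longlonglongrightarrow> x" using X by blast
    have "x \<in> D" by (rule clD[OF XD(1) lim])
    moreover have "fst m x \<in> D"
      by (rule clD[OF XD(2) multiplier_tendsto[OF C_sub m DC[OF XD(1)] lim]])
    moreover have "fst m (star x) \<in> D"
      by (rule clD[OF XD(3) multiplier_tendsto[OF C_sub m DC[OF Ds(7)[OF XD(1)]] tendsto_star[OF lim]]])
    ultimately show "x \<in> P" by (simp add: P_def)
  qed
  moreover have "csubspace P"
    unfolding csubspace_iff P_def
    using Ds DC lin multiplier_zero[OF C_sub m] by (simp add: star_add star_scaleC)
  moreover have "\<forall>x\<in>P. \<forall>y\<in>P. x * y \<in> P"
    unfolding P_def using Ds DC multiplier_fst_mult[OF m] by (simp add: star_mult)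
  moreover have "\<forall>x\<in>P. star x \<in> P"
    unfolding P_def using Ds by (simp add: star_star)
  ultimately have "cstar_subalgebra P" by (simp add: cstar_subalgebra_def)
  moreover have "{la l a | l a. l \<in> L \<and> a \<in> AL} \<subseteq> P"
    unfolding P_def using gen la_in_D cstar_sub_star[OF Lsub] cstar_sub_star[OF AL_sub]
    by (auto simp: star_la)
  ultimately have "D \<subseteq> P" unfolding D_eq by (intro cstar_generated_minimal)
  then show ?thesis using d by (auto simp: P_def)
qed

lemma D_lact: assumes l: "l \<in> L" and d: "d \<in> D" shows "lact l d \<in> D"
proof (rule D_invariant[OF mL[OF l] _ _ d])
  fix k a assume k: "k \<in> L" and a: "a \<in> AL"
  show "lact l (la k a) \<in> D"
    using l k a AL_in by (simp add: lact_la la_in_D cstar_sub_mult[OF Lsub])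
  obtain b c where bc: "b \<in> AL" "c \<in> AL" "a = b * c" using cstar_factorization[OF AL_sub a] .
  then show "lact l (al a k) \<in> D"
    using l k AL_in by (simp add: lact_al cstar_sub_mult[OF D_sub] la_in_D al_in_D)
qed

lemma D_aact: assumes a: "a \<in> AL" and d: "d \<in> D" shows "aact a d \<in> D"
proof (rule D_invariant[OF mA[OF AL_in[OF a]] _ _ d])
  fix k b assume k: "k \<in> L" and b: "b \<in> AL"
  show "aact a (al b k) \<in> D"
    using a k b AL_in by (simp add: aact_al al_in_D cstar_sub_mult[OF AL_sub])
  obtain l l' where "l \<in> L" "l' \<in> L" "k = l * l'" using cstar_factorization[OF Lsub k] .
  then show "aact a (la k b) \<in> D"
    using a b AL_in by (simp add: aact_la cstar_sub_mult[OF D_sub] la_in_D al_in_D)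
qed

lemma D_ract_L: assumes "l \<in> L" "d \<in> D" shows "snd (\<eta>L l) d \<in> D"
proof -
  have "star (lact (star l) (star d)) \<in> D"
    using assms by (intro cstar_sub_star[OF D_sub] D_lact cstar_sub_star[OF Lsub])
  then show ?thesis using assms(1) by (simp add: star_fst_L cstar_sub_star[OF Lsub] star_star)
qed

lemma D_ract_A: assumes "a \<in> AL" "d \<in> D" shows "snd (\<eta>A a) d \<in> D"
proof -
  have "star (aact (star a) (star d)) \<in> D"
    using assms by (intro cstar_sub_star[OF D_sub] D_aact cstar_sub_star[OF AL_sub])
  then show ?thesis
    using assms(1) AL_in by (simp add: star_fst_A cstar_sub_star[OF A_sub] star_star)
qed

lemma hom_vee_L: "star_hom (Alg L) (Mult D) (eta_vee D \<eta>L)"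
  by (rule star_hom_eta_vee[OF D_subset D_sub homL subset_refl D_lact D_ract_L])

lemma hom_vee_A: "star_hom (Alg AL) (Mult D) (eta_vee D \<eta>A)"
  using AL_in by (intro star_hom_eta_vee[OF D_subset D_sub homA _ D_aact D_ract_A]) auto

section \<open>Non-degeneracy of the restricted triple\<close>

lemma ess_mult: assumes "x \<in> M.ess" "y \<in> C" shows "x * y \<in> M.ess"
proof -
  obtain l w where lw: "l \<in> L" "w \<in> C" "x = lact l w" using assms(1) unfolding M.ess_eq by blast
  then have "x * y = lact l (w * y)" using multiplier_fst_mult[OF mL] assms(2) by simp
  then show ?thesis using lw assms(2) M.T_in_ess cstar_sub_mult[OF C_sub] by simp
qed

text \<open>\<open>(1 - e) x\<close> is small together with \<open>(1 - e) x x\<^sup>* (1 - e)\<^sup>*\<close>.\<close>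

lemma ess_of_mult_star:
  assumes x: "x \<in> C" and w: "x * star x \<in> M.ess" shows "x \<in> M.ess"
proof -
  have "\<exists>e\<in>appr L. norm (x - lact e x) < \<epsilon>" if "\<epsilon> > 0" for \<epsilon>
  proof -
    have "\<epsilon>\<^sup>2 > 0" using that by simp
    then obtain e where e: "e \<in> appr L" "norm (x * star x - lact e (x * star x)) < \<epsilon>\<^sup>2"
      using w unfolding M.ess_def by blast
    have eL: "e \<in> L" using appr_in[OF Lsub e(1)] .
    have sx: "star x \<in> C" using x cstar_sub_star[OF C_sub] by blast
    define y where "y = x - lact e x"
    have y: "y \<in> C" unfolding y_def using x eL by (intro M.V_diff M.T_in)
    define u where "u = y * star x"
    have u: "u \<in> C" unfolding u_def using y sx cstar_sub_mult[OF C_sub] by blast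
    have u_eq: "u = x * star x - lact e (x * star x)"
      using multiplier_fst_mult[OF mL[OF eL] x sx] by (simp add: u_def y_def left_diff_distrib)
    have "y * star y = y * star x - y * star (lact e x)"
      by (simp add: y_def star_diff right_diff_distrib)
    also have "y * star (lact e x) = snd (\<eta>L (star e)) (y * star x)"
      using multiplier_snd_mult[OF mL[OF cstar_sub_star[OF Lsub eL]] y sx] star_fst_L[OF eL] by simp
    finally have "y * star y = u - snd (\<eta>L (star e)) u" by (simp add: u_def)
    then have "star (y * star y) = star u - lact e (star u)"
      using star_snd_L[OF cstar_sub_star[OF Lsub eL]] by (simp add: star_diff star_star)
    then have "norm (y * star y) \<le> norm u"
      using M.appr_contractive[OF e(1) cstar_sub_star[OF C_sub u]] by (metis norm_star)
    then have "(norm y)\<^sup>2 < \<epsilon>\<^sup>2" using e(2) by (simp add: norm_mult_star u_eq)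
    then have "norm y < \<epsilon>" using that by (intro power2_less_imp_less[of _ \<epsilon>]) simp_all
    then show ?thesis using e(1) by (auto simp: y_def)
  qed
  then show ?thesis using x by (simp add: M.ess_def)
qed

text \<open>y = a l ends in l, so l y^* y = l (y^* a) l belongs to C_L and a maps it into C_L again.
  With y y^* y in L C, the element w = y y^* has w w^* in L C, and \<open>ess_of_mult_star\<close>
  leads from there to w and then to y.\<close>

lemma al_in_ess: assumes l: "l \<in> L" and a: "a \<in> AL" shows "al a l \<in> M.ess"
proof -
  define y where "y = al a l"
  have aA: "a \<in> A" using AL_in[OF a] .
  have y: "y \<in> C" "star y \<in> C" using al_in[OF aA l] cstar_sub_star[OF C_sub] by (auto simp: y_def)
  define z where "z = star y * y"
  have z: "z \<in> C" unfolding z_def using y cstar_sub_mult[OF C_sub] by blast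
  have "z = snd (\<eta>L l) (snd (\<eta>A a) (star y))"
    unfolding z_def y_def[symmetric] by (subst (2) y_def) (rule mult_al[OF aA l y(2)])
  then have "lact l z \<in> CL"
    using l multiplier_snd_in[OF mA[OF aA] y(2)] unfolding C_restr_def by blast
  then have "aact a (lact l z) \<in> M.ess" using a CL_in_ess by (simp add: AL_iff)
  then have "y * z \<in> M.ess" using al_mult[OF aA l z] by (simp add: y_def)
  then have "(y * star y) * star (y * star y) \<in> M.ess"
    using ess_mult[OF _ y(2), of "y * z"] by (simp add: z_def star_mult star_star mult.assoc)
  then have "y * star y \<in> M.ess"
    by (rule ess_of_mult_star[OF cstar_sub_mult[OF C_sub y]])
  then show ?thesis unfolding y_def[symmetric] by (rule ess_of_mult_star[OF y(1)])
qed

lemma la_in_ess: assumes l: "l \<in> L" and a: "a \<in> A" shows "la l a \<in> M.ess"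
proof -
  obtain k k' where k: "k \<in> L" "k' \<in> L" "l = k * k'" using cstar_factorization[OF Lsub l] .
  then have "la l a = lact k (la k' a)" using a by (simp add: lact_la)
  then show ?thesis using M.T_in_ess k la_in a by simp
qed

text \<open>The intersection of L C and C L is a C*-algebra, self-adjoint by symmetry, and contains
  the generators of C_vee.\<close>

lemma D_in_ess: "D \<subseteq> M.ess"
proof -
  define P where "P = {d \<in> C. d \<in> M.ess \<and> star d \<in> M.ess}"
  have cl: "closed M.ess" by (rule closed_ess[OF M.star_module_axioms cstar_sub_closed[OF C_sub]])
  have "P = M.ess \<inter> R" by (rule set_eqI) (auto simp: P_def R_iff dest: M.ess_in)
  then have "closed P" using cl R_closed by auto
  moreover have "csubspace P"
    unfolding csubspace_iff P_def using M.ess_zero M.ess_add M.ess_scale M.ess_in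
    by (simp add: star_add star_scaleC)
  moreover have "\<forall>x\<in>P. \<forall>y\<in>P. x * y \<in> P"
    unfolding P_def using ess_mult M.ess_in by (simp add: star_mult)
  moreover have "\<forall>x\<in>P. star x \<in> P" unfolding P_def using M.ess_in by (simp add: star_star)
  ultimately have "cstar_subalgebra P" by (simp add: cstar_subalgebra_def)
  moreover have "{la l a | l a. l \<in> L \<and> a \<in> AL} \<subseteq> P"
    unfolding P_def using la_in_ess al_in_ess la_in AL_in cstar_sub_star[OF Lsub] cstar_sub_star[OF AL_sub]
    by (auto simp: star_la)
  ultimately have "D \<subseteq> P" unfolding D_eq by (intro cstar_generated_minimal)
  then show ?thesis by (auto simp: P_def)
qed

sublocale MD: star_module D "\<lambda>x y. star x * y" norm L "\<lambda>l. fst (eta_vee D \<eta>L l)"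
  by (rule star_module_Mult_self[OF D_sub Lsub hom_vee_L])

text \<open>The approximation condition in \<open>ess\<close> involves only d and the e d, so it
  reads the same in \<open>C\<close> and in \<open>D\<close>. Cohen's theorem for the module
  \<open>D\<close> then puts the second factor into \<open>D\<close>.\<close>

lemma D_factorization: assumes d: "d \<in> D" obtains l w where "l \<in> L" "w \<in> D" "d = lact l w"
proof -
  have "d \<in> MD.ess"
    using D_in_ess d unfolding MD.ess_def M.ess_def by (auto simp: eta_vee_apply)
  then obtain l w where "l \<in> L" "w \<in> D" "d = fst (eta_vee D \<eta>L l) w"
    using MD.cohen_factorization MD.ess_in by metis
  then show ?thesis using that by (simp add: eta_vee_apply)
qed

lemma CP2_vee: "CP2 L D (eta_vee D \<eta>L)"
  unfolding CP2_def nondegenerate_def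
proof
  fix d assume "d \<in> D"
  then obtain l w where "l \<in> L" "w \<in> D" "d = lact l w" by (rule D_factorization)
  then have "d \<in> {fst (eta_vee D \<eta>L l) b | l b. l \<in> L \<and> b \<in> D}"
    using eta_vee_apply(1)[of w D \<eta>L l] by force
  then show "d \<in> closure (cspan {fst (eta_vee D \<eta>L l) b | l b. l \<in> L \<and> b \<in> D})"
    unfolding cspan_def by (rule subsetD[OF order_trans[OF cvec.span_superset closure_subset]])
qed

text \<open>C_vee is generated by the products l a, while (CP4) speaks of the products a l; the two
  families are adjoint to each other.\<close>

lemma CP4_vee: "CP4 AL L D (eta_vee D \<eta>A) (eta_vee D \<eta>L)"
proof -
  have emb: "sa_mult (Mult D) (eta_vee D \<eta>A a) (eta_vee D \<eta>L l) = mult_emb D (al a l)"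
    if a: "a \<in> AL" and l: "l \<in> L" for a l
  proof (rule multiplier_eqI[OF D_sub])
    have "eta_vee D \<eta>A a \<in> multipliers D" "eta_vee D \<eta>L l \<in> multipliers D"
      using star_homD(1)[OF hom_vee_A] star_homD(1)[OF hom_vee_L] a l by (auto simp: Alg_sel Mult_sel)
    then show "sa_mult (Mult D) (eta_vee D \<eta>A a) (eta_vee D \<eta>L l) \<in> multipliers D"
      by (rule multiplier_mult_in[OF _ _ D_sub])
    show "mult_emb D (al a l) \<in> multipliers D" by (rule mult_emb_in[OF D_sub al_in_D[OF l a]])
    show "fst (sa_mult (Mult D) (eta_vee D \<eta>A a) (eta_vee D \<eta>L l)) d = fst (mult_emb D (al a l)) d"
      if d: "d \<in> D" for d
      using al_mult[OF AL_in[OF a] l] d D_subset D_lact[OF l d]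
      by (auto simp: Mult_sel eta_vee_apply mult_emb_apply)
  qed
  define G where "G = {c \<in> D. \<exists>a\<in>AL. \<exists>l\<in>L.
    mult_emb D c = sa_mult (Mult D) (eta_vee D \<eta>A a) (eta_vee D \<eta>L l)}"
  have "cstar_generated G \<subseteq> D" by (rule cstar_generated_minimal[OF _ D_sub]) (auto simp: G_def)
  moreover have "D \<subseteq> cstar_generated G"
  proof -
    have "la l a \<in> cstar_generated G" if "l \<in> L" "a \<in> AL" for l a
    proof -
      have "al (star a) (star l) \<in> G"
        using that emb al_in_D cstar_sub_star[OF Lsub] cstar_sub_star[OF AL_sub]
        unfolding G_def by force
      then show ?thesis
        unfolding la_def using cstar_generated_superset
        by (intro cstar_sub_star[OF cstar_subalgebra_generated]) blast
    qed
    then show ?thesis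
      unfolding D_eq by (intro cstar_generated_minimal[OF _ cstar_subalgebra_generated]) blast
  qed
  ultimately show ?thesis
    unfolding CP4_def G_def[symmetric] using emb al_in_D by auto
qed

end

section \<open>Invariance of A_L under the action, and covariance of the restricted triple\<close>

theorem proposition7p11:
  fixes A :: "'a::cstar_algebra set" and L :: "'l::cstar_algebra set"
    and C :: "'c::cstar_algebra set"
    and \<eta> :: "'g::topological_group_add \<Rightarrow> 'l multiplier"
    and \<alpha> :: "'g \<Rightarrow> 'a \<Rightarrow> 'a"
    and \<eta>A :: "'a \<Rightarrow> 'c multiplier" and \<eta>L :: "'l \<Rightarrow> 'c multiplier"
  assumes "host_algebra L \<eta>"
    and "cstar_subalgebra A" and "cstar_action A \<alpha>"
    and "cstar_subalgebra C"
    and "CP1 A L C \<eta>A \<eta>L" and "CP3' A L \<eta> \<alpha> C \<eta>A \<eta>L" and "CP4 A L C \<eta>A \<eta>L"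
  shows "crossed_product_host (A_restr A L C \<eta>A \<eta>L) L \<eta> \<alpha>
    (C_vee A L C \<eta>A \<eta>L)
    (eta_vee (C_vee A L C \<eta>A \<eta>L) \<eta>A) (eta_vee (C_vee A L C \<eta>A \<eta>L) \<eta>L)"
proof -
  have L: "cstar_subalgebra L" using assms(1) by (simp add: host_algebra_def)
  interpret cp_triple A L C \<eta>A \<eta>L
    by unfold_locales (use assms L in auto)
  have \<eta>: "\<eta> g \<in> multipliers L" for g
    using assms(1) by (simp add: host_algebra_def mult_unitary_def)
  have \<eta>': "sa_star (Mult L) (\<eta> g) \<in> multipliers L" for g by (rule multiplier_star_in[OF L \<eta>])
  have \<alpha>_hom: "star_hom (Alg A) (Alg A) (\<alpha> g)" and \<alpha>_bij: "bij_betw (\<alpha> g) A A"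
    and \<alpha>_add: "a \<in> A \<Longrightarrow> \<alpha> (g + h) a = \<alpha> g (\<alpha> h a)" for g h a
    using assms(3) by (auto simp: cstar_action_def)
  have \<alpha>_in: "\<alpha> g a \<in> A" if "a \<in> A" for g a using star_homD(1)[OF \<alpha>_hom] that by (simp add: Alg_sel)
  have \<alpha>_star: "\<alpha> g (star a) = star (\<alpha> g a)" if "a \<in> A" for g a
    using star_homD(3)[OF \<alpha>_hom] that by (simp add: Alg_sel)
  note covariance = CP3'_covariance[OF assms(6) L assms(4) homL homA \<eta>]
  \<comment> \<open>For x = l r the covariance identity reads \<alpha>_g(a) x = \<eta>(g) (a
    ((\<eta>(g)^* l) r)). The multipliers of \<open>L\<close> change only the leftmost factor, so
    they preserve C_L, and so does a.\<close>
  have aact_\<alpha>: "aact (\<alpha> g a) x \<in> CL" if a: "a \<in> AL" and x: "x \<in> CL" for g a x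
  proof -
    obtain l r where lr: "l \<in> L" "r \<in> R" "x = lact l r" using x unfolding CL_eq MR.ess_eq by blast
    have l': "fst (sa_star (Mult L) (\<eta> g)) l \<in> L" using multiplier_fst_in[OF \<eta>' lr(1)] .
    then have "lact (fst (sa_star (Mult L) (\<eta> g)) l) r \<in> CL"
      unfolding CL_eq using lr MR.T_in_ess by blast
    then have "aact a (lact (fst (sa_star (Mult L) (\<eta> g)) l) r) \<in> CL" using a by (simp add: AL_iff)
    then obtain k s where ks: "k \<in> L" "s \<in> R"
      "aact a (lact (fst (sa_star (Mult L) (\<eta> g)) l) r) = lact k s"
      unfolding CL_eq MR.ess_eq by blast
    have "aact (\<alpha> g a) x = lact (fst (\<eta> g) k) s"
      unfolding lr(3) using covariance[OF AL_in[OF a] \<alpha>_in[OF AL_in[OF a]]] lr ks R_in by blast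
    then show ?thesis
      unfolding CL_eq using MR.T_in_ess[OF multiplier_fst_in[OF \<eta> ks(1)] ks(2)] by simp
  qed
  have \<alpha>_AL: "\<alpha> g a \<in> AL" if a: "a \<in> AL" for g a
    using aact_\<alpha>[OF a] aact_\<alpha>[OF cstar_sub_star[OF AL_sub a]] \<alpha>_star[OF AL_in[OF a]]
      \<alpha>_in[OF AL_in[OF a]] by (simp add: AL_iff)
  \<comment> \<open>\<open>cstar_action\<close> has no clause for the neutral element; it follows
    from \<alpha>_0 \<alpha>_0 = \<alpha>_0 by injectivity.\<close>
  have \<alpha>_0: "\<alpha> 0 a = a" if "a \<in> A" for a
    using \<alpha>_add[OF that, of 0 0] \<alpha>_bij[of 0] \<alpha>_in[OF that] that
    by (auto simp: bij_betw_def inj_on_def)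
  have action: "cstar_action AL \<alpha>"
    unfolding cstar_action_def
  proof (intro conjI allI ballI)
    fix g
    show "star_hom (Alg AL) (Alg AL) (\<alpha> g)"
      using \<alpha>_hom[of g] \<alpha>_AL AL_in unfolding star_hom_def by (simp add: Alg_sel)
    have "inj_on (\<alpha> g) AL" using \<alpha>_bij[of g] AL_in unfolding bij_betw_def inj_on_def by blast
    moreover have "a \<in> \<alpha> g ` AL" if a: "a \<in> AL" for a
    proof
      show "a = \<alpha> g (\<alpha> (- g) a)" using \<alpha>_add[OF AL_in[OF a], of g "- g"] \<alpha>_0[OF AL_in[OF a]] by simp
    qed (rule \<alpha>_AL[OF a])
    ultimately show "bij_betw (\<alpha> g) AL AL" unfolding bij_betw_def using \<alpha>_AL by blast
  qed (use \<alpha>_add AL_in in blast)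
  have "CP3 AL L \<eta> \<alpha> D (eta_vee D \<eta>A) (eta_vee D \<eta>L)"
    unfolding CP3_def
  proof (intro allI ballI)
    fix g a assume a: "a \<in> AL"
    define \<Phi> where "\<Phi> = extension L (Mult D) (eta_vee D \<eta>L)"
    have ext: "is_extension L (Mult D) (eta_vee D \<eta>L) \<Phi>"
      unfolding \<Phi>_def using extension_Mult[OF D_sub L hom_vee_L] CP2_vee by (simp add: CP2_def)
    have hom: "star_hom (Mult L) (Mult D) \<Phi>" using ext by (simp add: is_extension_def)
    have \<Phi>_in: "\<Phi> m \<in> multipliers D" if "m \<in> multipliers L" for m
      using star_homD(1)[OF hom] that by (simp add: Mult_sel(1))
    have \<Phi>_lact: "fst (\<Phi> m) (lact l d) = lact (fst m l) d"
      if "m \<in> multipliers L" "l \<in> L" "d \<in> D" for m l d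
      using is_extension_mult(1)[OF ext L that(1,2)] that(3)
      by (metis Mult_sel(6) eta_vee_apply(1))
    have star: "sa_star (Mult D) (\<Phi> (\<eta> g)) = \<Phi> (sa_star (Mult L) (\<eta> g))"
      using star_homD(3)[OF hom] \<eta> by (simp add: Mult_sel(1))
    have vee_in: "eta_vee D \<eta>A b \<in> multipliers D" if "b \<in> AL" for b
      using star_homD(1)[OF hom_vee_A] that by (simp add: Alg_sel Mult_sel(1))
    show "sa_mult (Mult D) (sa_mult (Mult D) (\<Phi> (\<eta> g)) (eta_vee D \<eta>A a)) (sa_star (Mult D) (\<Phi> (\<eta> g)))
        = eta_vee D \<eta>A (\<alpha> g a)"
      unfolding star
    proof (rule multiplier_eqI[OF D_sub])
      show "sa_mult (Mult D) (sa_mult (Mult D) (\<Phi> (\<eta> g)) (eta_vee D \<eta>A a)) (\<Phi> (sa_star (Mult L) (\<eta> g)))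
          \<in> multipliers D"
        by (intro multiplier_mult_in D_sub \<Phi>_in \<eta> \<eta>' vee_in a)
      show "eta_vee D \<eta>A (\<alpha> g a) \<in> multipliers D" by (rule vee_in[OF \<alpha>_AL[OF a]])
      fix d assume "d \<in> D"
      \<comment> \<open>Both d and, below, a (l' w) are factored inside \<open>D\<close>: there
        \<open>\<Phi>\<close> can be evaluated on the products, while \<open>covariance\<close>
        compares them in \<open>C\<close>.\<close>
      then obtain l w where lw: "l \<in> L" "w \<in> D" "d = lact l w" by (rule D_factorization)
      define l' where "l' = fst (sa_star (Mult L) (\<eta> g)) l"
      have l': "l' \<in> L" unfolding l'_def using multiplier_fst_in[OF \<eta>' lw(1)] .
      have "aact a (lact l' w) \<in> D" by (rule D_aact[OF a D_lact[OF l' lw(2)]])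
      then obtain k s where ks: "k \<in> L" "s \<in> D" "aact a (lact l' w) = lact k s"
        by (rule D_factorization)
      have "fst (\<Phi> (\<eta> g)) (fst (eta_vee D \<eta>A a) (fst (\<Phi> (sa_star (Mult L) (\<eta> g))) d))
          = fst (\<Phi> (\<eta> g)) (aact a (lact l' w))"
        using \<Phi>_lact[OF \<eta>' lw(1,2)] D_lact[OF l' lw(2)] by (simp add: lw(3) eta_vee_apply l'_def)
      also have "\<dots> = lact (fst (\<eta> g) k) s" unfolding ks(3) by (rule \<Phi>_lact[OF \<eta> ks(1,2)])
      also have "\<dots> = aact (\<alpha> g a) d"
        unfolding lw(3)
        by (rule covariance[OF AL_in[OF a] \<alpha>_in[OF AL_in[OF a]] lw(1) _ ks(1), symmetric])
          (use ks(2,3) lw(2) D_subset in \<open>auto simp: l'_def\<close>)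
      finally show "fst (sa_mult (Mult D) (sa_mult (Mult D) (\<Phi> (\<eta> g)) (eta_vee D \<eta>A a))
          (\<Phi> (sa_star (Mult L) (\<eta> g)))) d = fst (eta_vee D \<eta>A (\<alpha> g a)) d"
        using \<open>d \<in> D\<close> by (simp add: Mult_sel eta_vee_apply)
    qed
  qed
  then show ?thesis
    unfolding crossed_product_host_def CP1_def
    using assms(1) action AL_sub D_sub hom_vee_A hom_vee_L CP2_vee CP4_vee by blast
qed

end
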